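(* Let $\mu_1(h)$ denote the first eigenvalue of the biharmonic operator with Dirichlet boundary conditions acting in $L^2(R_h)$, where $R_h=[0,h]\times[0,1]$. Then $$\mu_1(h)=c^4+2dc^2\pi^2h^{-2}+O(h^{-3})$$ as $h\to\infty$, where $c\approx 4.73004$ is the first positive solution of $\cosh c\cos c=1$ and $$d=\frac{2\tanh c\tan c-c\tanh c-c\tan c}{c\tanh c-c\tan c}\approx 0.54988.$$
   Context: For $h>0$ let $R_h=[0,h]\times[0,1]\subseteq\mathbb R^2$. The biharmonic operator $\Delta^2|_{\mathrm{DIR}}$ (Dirichlet, or clamped plate, boundary conditions) acting in $L^2(R_h)$ is the non-negative self-adjoint operator associated with the closed quadratic form $Q(f)=\int_{R_h}|\Delta f|^2$ if $f\in W^{2,2}_0(R_h)$, and $Q(f)=\infty$ otherwise. It has compact resolvent, and its first eigenvalue is $\mu_1(h)=\inf\{Q(f):f\in L^2(R_h),\ \|f\|_2=1\}$. *)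

theory Defs
  imports "HOL-Analysis.Analysis" "HOL-Library.Landau_Symbols"
begin

definition rect :: "real \<Rightarrow> (real \<times> real) set" where
  "rect h = {0..h} \<times> {0..1}"

fun C_k :: "nat \<Rightarrow> (real \<times> real \<Rightarrow> complex) \<Rightarrow> bool" where
  "C_k 0 f = continuous_on UNIV f"
| "C_k (Suc k) f = (f differentiable_on UNIV \<and>
     (\<forall>v. C_k k (\<lambda>p. frechet_derivative f (at p) v)))"

definition pdx :: "(real \<times> real \<Rightarrow> complex) \<Rightarrow> real \<times> real \<Rightarrow> complex" where
  "pdx f p = frechet_derivative f (at p) (1, 0)"

definition pdy :: "(real \<times> real \<Rightarrow> complex) \<Rightarrow> real \<times> real \<Rightarrow> complex" where
  "pdy f p = frechet_derivative f (at p) (0, 1)"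

definition partial :: "nat \<Rightarrow> nat \<Rightarrow> (real \<times> real \<Rightarrow> complex) \<Rightarrow> real \<times> real \<Rightarrow> complex" where
  "partial i j f = (pdx ^^ i) ((pdy ^^ j) f)"

text \<open>The space of smooth functions with compact support in the open rectangle,
  each extended by zero to the whole plane.\<close>

definition test_fun :: "real \<Rightarrow> (real \<times> real \<Rightarrow> complex) set" where
  "test_fun h = {\<phi>. (\<forall>k. C_k k \<phi>) \<and>
     (\<exists>K. compact K \<and> K \<subseteq> interior (rect h) \<and> (\<forall>p. p \<notin> K \<longrightarrow> \<phi> p = 0))}"

text \<open>Elements of the Lebesgue and Sobolev spaces are represented by functions on the plane;
  only their values on the rectangle matter, and these only almost everywhere.\<close>

definition L2 :: "real \<Rightarrow> (real \<times> real \<Rightarrow> complex) set" where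
  "L2 h = {f \<in> borel_measurable (lebesgue_on (rect h)).
     integrable (lebesgue_on (rect h)) (\<lambda>p. (cmod (f p))\<^sup>2)}"

definition norm2 :: "real \<Rightarrow> (real \<times> real \<Rightarrow> complex) \<Rightarrow> real" where
  "norm2 h f = sqrt (\<integral>p. (cmod (f p))\<^sup>2 \<partial>lebesgue_on (rect h))"

definition has_weak_partial ::
  "real \<Rightarrow> nat \<Rightarrow> nat \<Rightarrow> (real \<times> real \<Rightarrow> complex) \<Rightarrow> (real \<times> real \<Rightarrow> complex) \<Rightarrow> bool" where
  "has_weak_partial h i j f g \<longleftrightarrow> g \<in> L2 h \<and>
     (\<forall>\<phi>\<in>test_fun h. (\<integral>p. f p * partial i j \<phi> p \<partial>lebesgue_on (rect h)) =
        (-1) ^ (i + j) * (\<integral>p. g p * \<phi> p \<partial>lebesgue_on (rect h)))"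

definition W22 :: "real \<Rightarrow> (real \<times> real \<Rightarrow> complex) set" where
  "W22 h = {f \<in> L2 h. \<forall>i j. i + j \<le> 2 \<longrightarrow> (\<exists>g. has_weak_partial h i j f g)}"

text \<open>Weak derivatives are unique up to null sets, so the choice below is immaterial
  wherever it occurs under an integral.\<close>

definition weak_partial ::
  "real \<Rightarrow> nat \<Rightarrow> nat \<Rightarrow> (real \<times> real \<Rightarrow> complex) \<Rightarrow> real \<times> real \<Rightarrow> complex" where
  "weak_partial h i j f = (SOME g. has_weak_partial h i j f g)"

text \<open>The closure of the test functions in the Sobolev norm.\<close>

definition W22_0 :: "real \<Rightarrow> (real \<times> real \<Rightarrow> complex) set" where
  "W22_0 h = {f \<in> W22 h. \<exists>\<phi>. (\<forall>n::nat. \<phi> n \<in> test_fun h) \<and>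
     (\<forall>i j. i + j \<le> 2 \<longrightarrow>
        (\<lambda>n. norm2 h (\<lambda>p. partial i j (\<phi> n) p - weak_partial h i j f p)) \<longlonglongrightarrow> 0)}"

definition weak_laplacian ::
  "real \<Rightarrow> (real \<times> real \<Rightarrow> complex) \<Rightarrow> real \<times> real \<Rightarrow> complex" where
  "weak_laplacian h f p = weak_partial h 2 0 f p + weak_partial h 0 2 f p"

definition Q :: "real \<Rightarrow> (real \<times> real \<Rightarrow> complex) \<Rightarrow> ennreal" where
  "Q h f = (if f \<in> W22_0 h
     then \<integral>\<^sup>+p. ennreal ((cmod (weak_laplacian h f p))\<^sup>2) \<partial>lebesgue_on (rect h)
     else \<infinity>)"

text \<open>For \<open>h > 0\<close> the infimum is finite, since some unit vectors lie in the form domain;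
  hence the conversion to a real number loses nothing.\<close>

definition mu1 :: "real \<Rightarrow> real" where
  "mu1 h = enn2real (INF f\<in>{f \<in> L2 h. norm2 h f = 1}. Q h f)"

definition c_beam :: real where
  "c_beam = (LEAST x. 0 < x \<and> cosh x * cos x = 1)"

definition d_beam :: real where
  "d_beam = (2 * tanh c_beam * tan c_beam - c_beam * tanh c_beam - c_beam * tan c_beam) /
     (c_beam * tanh c_beam - c_beam * tan c_beam)"

end

theory Submission
  imports Defs "HOL-Computational_Algebra.Polynomial"
begin

text \<open>
  Lower bound. On test functions two integrations by parts turn \<open>\<integral>\<bar>\<Delta>\<phi>\<bar>\<^sup>2\<close> into
  \<open>\<integral>\<bar>\<phi>\<^sub>x\<^sub>x\<bar>\<^sup>2 + 2\<bar>\<phi>\<^sub>x\<^sub>y\<bar>\<^sup>2 + \<bar>\<phi>\<^sub>y\<^sub>y\<bar>\<^sup>2\<close>. Dropping the first term and applying the Poincare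
  inequality in \<open>x\<close> to \<open>\<phi>\<^sub>y\<close> leaves, for every \<open>x\<close>, the form \<open>\<integral>v''\<^sup>2 + 2t \<integral>v'\<^sup>2\<close> of a clamped beam with
  \<open>t = (\<pi>/h)\<^sup>2\<close>. First order perturbation theory around the ground state \<open>u\<close> of the beam gives
  \<open>c\<^sup>4 + 2t \<integral>u'\<^sup>2 - O(t\<^sup>2)\<close>, and \<open>\<integral>u'\<^sup>2 = d c\<^sup>2\<close>. The error is only \<open>O(h\<^sup>-\<^sup>4)\<close>.

  Upper bound. The product of \<open>u(y)\<close> and of \<open>sin(\<pi>x/h)\<close>, cut off smoothly in layers of width one at
  both short edges, has Rayleigh quotient \<open>c\<^sup>4 + 2 d c\<^sup>2 (\<pi>/h)\<^sup>2 + O(h\<^sup>-\<^sup>3)\<close>: in the layers the sine is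
  of size \<open>O(1/h)\<close>, so they contribute \<open>O(h\<^sup>-\<^sup>2)\<close>, against a squared norm of order \<open>h\<close>.
\<close>

text \<open>No spectral theorem enters: \<open>mu1\<close> is an infimum, so an energy inequality on
  test functions and a family of trial functions suffice. The inequality reaches the form domain by
  density. Weak derivatives are picked by \<open>SOME\<close>, so this rests on their uniqueness
  almost everywhere, hence on a fundamental lemma. The perturbation step splits v into its component
  along u and an orthogonal rest w. The cross term in \<open>\<integral>v'\<^sup>2\<close> becomes a
  pairing of u'' with w; \<open>\<integral>w\<^sup>2\<close> absorbs it thanks to the room between
  c^4 and 16 pi^4, at the price of a term of order t^2. The power h^-3 comes from the short edges:
  the clamped condition also asks for zero slope there, while sin(pi x/h) has slope pi/h at the
  ends. The beam has to be cut off too, because trial functions have compact support in the open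
  rectangle. Its double zeros at 0 and 1 keep the derivatives of the cut profile up to order two
  bounded, however thin the layer. This second cutoff is therefore removed by a limit at fixed h and
  leaves no error.\<close>

section \<open>The constants c and d\<close>

text \<open>The cosine and the exponential are enclosed at one eighth of the argument by a Taylor polynomial
  and then propagated by the double angle formula and by taking the eighth power.\<close>

lemma cos_taylor_bound:
  fixes x :: real
  shows "\<bar>cos x - (1 - x^2/2 + x^4/24 - x^6/720 + x^8/40320 - x^10/3628800)\<bar> \<le> x^12/479001600"
proof -
  obtain t where t: "cos x = (\<Sum>m<12. cos_coeff m * x ^ m) + (cos (t + 1/2 * real 12 * pi) / fact 12) * x ^ 12"
    using Maclaurin_cos_expansion[of x 12] by auto
  have s: "(\<Sum>m<12. cos_coeff m * x ^ m) = 1 - x^2/2 + x^4/24 - x^6/720 + x^8/40320 - x^10/3628800"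
    by (simp add: cos_coeff_def fact_numeral lessThan_nat_numeral)
  have f: "fact 12 = (479001600::real)" by (simp add: fact_numeral)
  have "\<bar>cos x - (1 - x^2/2 + x^4/24 - x^6/720 + x^8/40320 - x^10/3628800)\<bar>
      = \<bar>cos (t + 1/2 * real 12 * pi)\<bar> * (x^12 / 479001600)"
    unfolding t s f by (simp add: abs_mult)
  also have "\<dots> \<le> 1 * (x^12 / 479001600)"
    by (intro mult_right_mono) (auto simp: abs_cos_le_one)
  finally show ?thesis by simp
qed

lemma exp_taylor_bound:
  fixes x :: real
  assumes "0 \<le> x" "x \<le> 3/5"
  shows "\<bar>exp x - (\<Sum>m<12. x ^ m / fact m)\<bar> \<le> 2 * x^12 / 479001600"
proof -
  obtain t where t: "\<bar>t\<bar> \<le> \<bar>x\<bar>" "exp x = (\<Sum>m<12. x ^ m / fact m) + (exp t / fact 12) * x ^ 12"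
    using Maclaurin_exp_le[of x 12] by auto
  have "exp t \<le> exp (3/5)" using t(1) assms by auto
  also have "\<dots> \<le> 2" using exp_bound[of "3/5"] by (simp add: power2_eq_square)
  finally have e: "exp t \<le> 2" .
  have f: "fact 12 = (479001600::real)" by (simp add: fact_numeral)
  have "\<bar>exp x - (\<Sum>m<12. x ^ m / fact m)\<bar> = exp t * (x^12 / 479001600)"
    unfolding t(2) f by simp
  also have "\<dots> \<le> 2 * (x^12 / 479001600)"
    by (intro mult_right_mono) (use e in auto)
  finally show ?thesis by simp
qed

text \<open>The map z -> 2 z^2 - 1 is monotone only on each side of 0. The enclosure must therefore
  not straddle 0, and its ends swap roles when it lies on the negative side.\<close>

lemma cos_double_bounds:
  fixes x l u :: real
  assumes "l \<le> cos x" "cos x \<le> u" "0 \<le> l \<or> u \<le> 0"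
  shows "2 * (if 0 \<le> l then l else u)^2 - 1 \<le> cos (2*x) \<and> cos (2*x) \<le> 2 * (if 0 \<le> l then u else l)^2 - 1"
proof -
  have "(if 0 \<le> l then l else u)^2 \<le> (cos x)^2 \<and> (cos x)^2 \<le> (if 0 \<le> l then u else l)^2"
  proof (cases "0 \<le> l")
    case True
    then show ?thesis using assms by (auto intro!: power_mono)
  next
    case False
    then have "(- u)^2 \<le> (- cos x)^2 \<and> (- cos x)^2 \<le> (- l)^2"
      using assms by (intro conjI power_mono) auto
    then show ?thesis using False by simp
  qed
  then show ?thesis unfolding cos_double_cos by auto
qed

lemma cosh_bounds_of_exp:
  fixes x l u :: real
  assumes "l \<le> exp x" "exp x \<le> u" "0 < l"
  shows "(l + 1 / u) / 2 \<le> cosh x" "cosh x \<le> (u + 1 / l) / 2"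
proof -
  have "1 / u \<le> exp (- x)" "exp (- x) \<le> 1 / l"
    using assms unfolding exp_minus inverse_eq_divide by (auto intro!: divide_left_mono)
  then show "(l + 1 / u) / 2 \<le> cosh x" "cosh x \<le> (u + 1 / l) / 2"
    using assms by (simp_all add: cosh_field_def)
qed

text \<open>The points 4.730035 and 4.730045 are 4.73004 -+ 0.000005, the ends of the interval
  claimed for \<open>c_beam\<close>. The enclosures are just fine enough to put cosh x cos x below 1
  at the first and above 1 at the second.\<close>

lemma cos_c_lower: "0.0176451034 \<le> cos (4.730035::real)" "cos (4.730035::real) \<le> 0.0176451046"
proof -
  have 0: "0.83024214019 \<le> cos (0.591254375::real) \<and> cos (0.591254375::real) \<le> 0.83024214021"
    using cos_taylor_bound[of "0.591254375", unfolded abs_le_iff] by (simp add: power_divide)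
  have 1: "0.3786040226 \<le> cos (1.182508750::real) \<and> cos (1.182508750::real) \<le> 0.3786040228"
    using cos_double_bounds[OF conjunct1[OF 0] conjunct2[OF 0]] by (simp add: power2_eq_square)
  have 2: "(-0.7133179882) \<le> cos (2.365017500::real) \<and> cos (2.365017500::real) \<le> (-0.7133179878)"
    using cos_double_bounds[OF conjunct1[OF 1] conjunct2[OF 1]] by (simp add: power2_eq_square)
  have 3: "0.0176451034 \<le> cos (4.730035000::real) \<and> cos (4.730035000::real) \<le> 0.0176451046"
    using cos_double_bounds[OF conjunct1[OF 2] conjunct2[OF 2]] by (simp add: power2_eq_square)
  show "0.0176451034 \<le> cos (4.730035::real)" "cos (4.730035::real) \<le> 0.0176451046" using 3 by auto
qed

lemma exp_c_lower: "113.29952 \<le> exp (4.730035::real)" "exp (4.730035::real) \<le> 113.29953"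
proof -
  have 0: "1.8062527131 \<le> exp (0.591254375::real) \<and> exp (0.591254375::real) \<le> 1.8062527133"
    using exp_taylor_bound[of "0.591254375", unfolded abs_le_iff] by (simp add: lessThan_nat_numeral power_divide fact_numeral)
  have e: "exp (4.730035::real) = exp 0.591254375 ^ 8"
    by (simp flip: exp_of_nat_mult)
  have "1.8062527131 ^ 8 \<le> exp (0.591254375::real) ^ 8" "exp (0.591254375::real) ^ 8 \<le> 1.8062527133 ^ 8"
    using 0 by (auto intro!: power_mono)
  then show "113.29952 \<le> exp (4.730035::real)" "exp (4.730035::real) \<le> 113.29953"
    unfolding e by (simp_all add: power_divide)
qed

lemma cosh_c_lower: "56.65417 \<le> cosh (4.730035::real)" "cosh (4.730035::real) \<le> 56.65418"
  using cosh_bounds_of_exp[OF exp_c_lower] by simp_all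

lemma cos_c_upper: "0.0176551018 \<le> cos (4.730045::real)" "cos (4.730045::real) \<le> 0.0176551031"
proof -
  have 0: "0.83024144343 \<le> cos (0.591255625::real) \<and> cos (0.591255625::real) \<le> 0.83024144345"
    using cos_taylor_bound[of "0.591255625", unfolded abs_le_iff] by (simp add: power_divide)
  have 1: "0.3786017087 \<le> cos (1.182511250::real) \<and> cos (1.182511250::real) \<le> 0.3786017089"
    using cos_double_bounds[OF conjunct1[OF 0] conjunct2[OF 0]] by (simp add: power2_eq_square)
  have 2: "(-0.7133214924) \<le> cos (2.365022500::real) \<and> cos (2.365022500::real) \<le> (-0.7133214920)"
    using cos_double_bounds[OF conjunct1[OF 1] conjunct2[OF 1]] by (simp add: power2_eq_square)
  have 3: "0.0176551018 \<le> cos (4.730045000::real) \<and> cos (4.730045000::real) \<le> 0.0176551031"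
    using cos_double_bounds[OF conjunct1[OF 2] conjunct2[OF 2]] by (simp add: power2_eq_square)
  show "0.0176551018 \<le> cos (4.730045::real)" "cos (4.730045::real) \<le> 0.0176551031" using 3 by auto
qed

lemma exp_c_upper: "113.30066 \<le> exp (4.730045::real)" "exp (4.730045::real) \<le> 113.30067"
proof -
  have 0: "1.8062549710 \<le> exp (0.591255625::real) \<and> exp (0.591255625::real) \<le> 1.8062549711"
    using exp_taylor_bound[of "0.591255625", unfolded abs_le_iff] by (simp add: lessThan_nat_numeral power_divide fact_numeral)
  have e: "exp (4.730045::real) = exp 0.591255625 ^ 8"
    by (simp flip: exp_of_nat_mult)
  have "1.8062549710 ^ 8 \<le> exp (0.591255625::real) ^ 8" "exp (0.591255625::real) ^ 8 \<le> 1.8062549711 ^ 8"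
    using 0 by (auto intro!: power_mono)
  then show "113.30066 \<le> exp (4.730045::real)" "exp (4.730045::real) \<le> 113.30067"
    unfolding e by (simp_all add: power_divide)
qed

lemma cosh_c_upper: "56.65474 \<le> cosh (4.730045::real)" "cosh (4.730045::real) \<le> 56.65475"
  using cosh_bounds_of_exp[OF exp_c_upper] by simp_all

text \<open>Both bounds read off the sign of cos at half the value. The number 3.1532 gives 3 pi/2 <
  4.7298 < 4.730035, so the enclosed root lies beyond 3 pi/2; 3 < pi gives 2 pi > 6 and later 16
  pi^4 >= 1296.\<close>

lemma pi_bounds_coarse: "3 < pi" "pi < 3.1532"
proof -
  have c: "0 < cos (1.5::real)" "cos (1.5766::real) < 0"
    using cos_taylor_bound[of "1.5", unfolded abs_le_iff] cos_taylor_bound[of "1.5766", unfolded abs_le_iff]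
    by (simp_all add: power_divide)
  show "3 < pi"
  proof (rule ccontr)
    assume "\<not> 3 < pi"
    then have "cos 1.5 \<le> cos (pi/2)"
      using pi_ge_two by (intro cos_monotone_0_pi_le) auto
    then show False using c by simp
  qed
  show "pi < 3.1532"
  proof (rule ccontr)
    assume "\<not> pi < 3.1532"
    then have "0 \<le> cos (1.5766::real)" by (intro cos_ge_zero) auto
    then show False using c by simp
  qed
qed

section \<open>The first positive root of cosh x cos x = 1\<close>

lemma cosh_mul_cos_strict_mono:
  fixes x y :: real
  assumes "3 * pi / 2 \<le> x" "x < y" "y \<le> 2 * pi"
  shows "cosh x * cos x < cosh y * cos y"
proof (rule DERIV_pos_imp_increasing_open[OF assms(2)])
  fix t :: real assume t: "x < t" "t < y"
  have "cos (2 * pi - t) > 0" by (rule cos_gt_zero_pi) (use t assms pi_gt_zero in auto)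
  then have c: "cos t > 0" by (simp add: cos_diff)
  have "sin (2 * pi - t) > 0" by (rule sin_gt_zero) (use t assms pi_gt_zero in auto)
  then have s: "sin t < 0" by (simp add: sin_diff)
  have "t > 0" using t assms pi_gt_zero by linarith
  then have "sinh t * cos t + cosh t * (- sin t) > 0"
    using c s by (intro add_pos_pos mult_pos_pos) auto
  moreover have "((\<lambda>x. cosh x * cos x) has_real_derivative sinh t * cos t + cosh t * (- sin t)) (at t)"
    by (auto intro!: derivative_eq_intros simp: algebra_simps)
  ultimately show "\<exists>z. ((\<lambda>x. cosh x * cos x) has_real_derivative z) (at t) \<and> 0 < z" by blast
qed (auto intro!: continuous_intros)

text \<open>Up to pi/2 the product decreases from its value 1 at 0: its derivative sinh cos - cosh
  sin vanishes at 0 and has itself the derivative - 2 sinh sin < 0. From pi/2 to 3 pi/2 the cosine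
  is not positive.\<close>

lemma cosh_mul_cos_less_1:
  fixes x :: real
  assumes "0 < x" "x \<le> 3 * pi / 2"
  shows "cosh x * cos x < 1"
proof (cases "x \<le> pi / 2")
  case True
  have "cosh x * cos x < cosh 0 * cos 0"
  proof (rule DERIV_neg_imp_decreasing_open[OF assms(1)])
    fix t :: real assume t: "0 < t" "t < x"
    have "sinh t * cos t - cosh t * sin t < sinh 0 * cos 0 - cosh 0 * sin 0"
    proof (rule DERIV_neg_imp_decreasing_open[OF t(1)])
      fix r :: real assume r: "0 < r" "r < t"
      have "sin r > 0" by (rule sin_gt_zero) (use r t True pi_gt_zero in linarith)+
      then have "- (2 * sinh r * sin r) < 0" using r by simp
      moreover have "((\<lambda>x. sinh x * cos x - cosh x * sin x) has_real_derivative - (2 * sinh r * sin r)) (at r)"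
        by (auto intro!: derivative_eq_intros simp: algebra_simps)
      ultimately show "\<exists>z. ((\<lambda>x. sinh x * cos x - cosh x * sin x) has_real_derivative z) (at r) \<and> z < 0" by blast
    qed (auto intro!: continuous_intros)
    then have "sinh t * cos t + cosh t * (- sin t) < 0" by simp
    moreover have "((\<lambda>x. cosh x * cos x) has_real_derivative sinh t * cos t + cosh t * (- sin t)) (at t)"
      by (auto intro!: derivative_eq_intros simp: algebra_simps)
    ultimately show "\<exists>z. ((\<lambda>x. cosh x * cos x) has_real_derivative z) (at t) \<and> z < 0" by blast
  qed (auto intro!: continuous_intros)
  then show ?thesis by simp
next
  case False
  have "cos (x - pi) \<ge> 0" by (rule cos_ge_zero) (use False assms in auto)
  then have "cos x \<le> 0" by (simp add: cos_diff)
  then have "cosh x * cos x \<le> 0" by (intro mult_nonneg_nonpos) auto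
  then show ?thesis by simp
qed

text \<open>\<open>LEAST\<close> over the reals has content only if the minimum is attained. The
  intermediate value theorem supplies a root c between the two enclosures, and the product stays
  below 1 on (0, c): up to 3 pi/2 by \<open>cosh_mul_cos_less_1\<close>, after that by
  monotonicity.\<close>

lemma c_beam_props:
  shows "3 * pi / 2 < c_beam" "c_beam < 2 * pi" "cosh c_beam * cos c_beam = 1"
    "\<And>x. 0 < x \<Longrightarrow> x < c_beam \<Longrightarrow> cosh x * cos x \<noteq> 1"
    "4.730035 < c_beam" "c_beam < 4.730045"
proof -
  let ?g = "\<lambda>x::real. cosh x * cos x"
  have lo: "?g 4.730035 < 1"
  proof -
    have "?g 4.730035 \<le> 56.65418 * 0.0176451047"
      by (intro mult_mono) (use cosh_c_lower cos_c_lower in auto)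
    then show ?thesis by simp
  qed
  have up: "1 < ?g 4.730045"
  proof -
    have "56.65474 * 0.0176551018 \<le> ?g 4.730045"
      by (intro mult_mono) (use cosh_c_upper cos_c_upper in auto)
    then show ?thesis by simp
  qed
  have "\<exists>c\<ge>4.730035. c \<le> 4.730045 \<and> ?g c = 1"
    by (rule IVT') (use lo up in \<open>auto intro!: continuous_intros simp: less_imp_le\<close>)
  then obtain c where c: "4.730035 \<le> c" "c \<le> 4.730045" "?g c = 1" by blast
  have c': "4.730035 < c" "c < 4.730045"
    using c lo up by (metis less_irrefl less_le)+
  have less: "?g x < 1" if "0 < x" "x < c" for x
  proof (cases "x \<le> 3 * pi / 2")
    case True
    then show ?thesis using cosh_mul_cos_less_1 that by simp
  next
    case False
    then have "?g x < ?g c" using cosh_mul_cos_strict_mono[of x c] that c pi_bounds_coarse by simp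
    then show ?thesis using c by simp
  qed
  have "c_beam = c"
    unfolding c_beam_def
  proof (rule Least_equality)
    show "0 < c \<and> cosh c * cos c = 1" using c by simp
    show "c \<le> y" if "0 < y \<and> cosh y * cos y = 1" for y
      using less[of y] that by force
  qed
  then show "3 * pi / 2 < c_beam" "c_beam < 2 * pi" "cosh c_beam * cos c_beam = 1"
    "\<And>x. 0 < x \<Longrightarrow> x < c_beam \<Longrightarrow> cosh x * cos x \<noteq> 1"
    "4.730035 < c_beam" "c_beam < 4.730045"
    using c c' less pi_bounds_coarse by (auto, force)
qed

text \<open>The root equation gives the cosine, and then the square of the sine is tanh^2. The sign
  is negative because c lies between pi and 2 pi. All later identities at c thereby become rational
  in cosh c and sinh c.\<close>

lemma sin_c_beam: "sin c_beam = - sinh c_beam / cosh c_beam"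
  and cos_c_beam: "cos c_beam = 1 / cosh c_beam"
proof -
  show c: "cos c_beam = 1 / cosh c_beam"
    using c_beam_props(3) cosh_real_pos[of c_beam] by (simp add: field_simps)
  have "(sin c_beam)^2 = (sinh c_beam / cosh c_beam)^2"
    using cosh_real_pos[of c_beam] unfolding sin_squared_eq c power_divide sinh_square_eq
    by (simp add: field_simps)
  moreover have "sin (2 * pi - c_beam) > 0"
    by (rule sin_gt_zero) (use c_beam_props pi_gt_zero in linarith)+
  then have "sin c_beam < 0" by (simp add: sin_diff)
  moreover have "sinh c_beam / cosh c_beam > 0" using c_beam_props pi_gt_zero by simp
  ultimately show "sin c_beam = - sinh c_beam / cosh c_beam"
    by (auto simp: power2_eq_iff)
qed

text \<open>At the root tan c = - sinh c, so numerator and denominator share the factor tanh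
  c.\<close>

lemma d_beam_eq: "d_beam = (c_beam * (cosh c_beam - 1) - 2 * sinh c_beam) / (c_beam * (cosh c_beam + 1))"
proof -
  define c where "c = c_beam"
  have p: "c > 0" "sinh c > 0" "cosh c > 0"
    using c_beam_props pi_gt_zero by (auto simp: c_def)
  have t: "tan c = - sinh c" "tanh c = sinh c / cosh c"
    unfolding c_def tan_def sin_c_beam cos_c_beam tanh_def by auto
  have "c * tanh c - c * tan c = (c * (cosh c + 1)) * (sinh c / cosh c)"
    unfolding t using p by (simp add: field_simps)
  moreover have "2 * tanh c * tan c - c * tanh c - c * tan c
      = (c * (cosh c - 1) - 2 * sinh c) * (sinh c / cosh c)"
    unfolding t using p by (simp add: field_simps)
  ultimately show ?thesis
    unfolding d_beam_def c_def[symmetric] using p by simp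
qed

lemma d_beam_approx: "\<bar>d_beam - 0.54988\<bar> < 0.000005"
proof -
  define c where "c = c_beam"
  define C where "C = cosh c"
  define e where "e = exp (- c)"
  have c: "4.730035 < c" "c < 4.730045" using c_beam_props by (auto simp: c_def)
  have "cosh 4.730035 \<le> C" "C \<le> cosh 4.730045"
    unfolding C_def using c by (auto simp: cosh_real_nonneg_le_iff)
  then have C: "56.65417 \<le> C" "C \<le> 56.65475"
    using cosh_c_lower cosh_c_upper by auto
  have "exp (- 4.730045) \<le> e" "e \<le> exp (- 4.730035)" unfolding e_def using c by auto
  moreover have "1 / 113.30067 \<le> exp (- 4.730045::real)" "exp (- 4.730035::real) \<le> 1 / 113.29952"
    unfolding exp_minus inverse_eq_divide
    by (rule divide_left_mono; use exp_c_lower exp_c_upper in simp)+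
  ultimately have e: "1 / 113.30067 \<le> e" "e \<le> 1 / 113.29952" by linarith+
  have S: "sinh c = C - e" unfolding C_def e_def by (simp add: cosh_minus_sinh[symmetric])
  obtain D where D: "C = D - 1" "D > 0" using C by (intro that[of "C + 1"]) auto
  \<comment> \<open>Here d = (C - 1)/(C + 1) - 2 sinh c/(c (C + 1)) with sinh c = C - e. In P and in
    R each of c, C and e occurs at most once, so the separate bounds on them can be inserted without
    losing correlations inside a term.\<close>
  define P where "P = 2 / (C + 1)"
  define R where "R = 2 / c * (1 - (1 + e) / (C + 1))"
  have "d_beam = 1 - P - R"
    unfolding P_def R_def d_beam_eq c_def[symmetric] S C_def[symmetric] D using c D by (simp add: field_simps)
  moreover have "2 / 57.65475 \<le> P" "P \<le> 2 / 57.65417"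
    unfolding P_def by (rule divide_left_mono; use C in simp)+
  moreover have "2 / 4.730045 * (1 - (1 + 1 / 113.29952) / 57.65417) \<le> R"
    unfolding R_def using c C e by (intro mult_mono diff_left_mono divide_left_mono frac_le add_left_mono) auto
  moreover have "R \<le> 2 / 4.730035 * (1 - (1 + 1 / 113.30067) / 57.65475)"
    unfolding R_def using c C e by (intro mult_mono diff_left_mono divide_left_mono frac_le add_left_mono) auto
  ultimately show ?thesis unfolding abs_less_iff by simp
qed

section \<open>Poincare and Wirtinger inequalities\<close>

lemma continuous_on_if_DERIV:
  fixes f f' :: "real \<Rightarrow> real"
  assumes "\<And>x. (f has_real_derivative f' x) (at x)"
  shows "continuous_on S f"
  by (metis DERIV_continuous_on assms has_field_derivative_at_within)

text \<open>At a zero p of the sine a double zero of \<open>(u - a)\<^sup>2\<close> meets a simple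
  pole, so the limit is 0. This is also the value at p, because u p = a. Both difference quotients
  at p are exhibited to compute the limit.\<close>

lemma continuous_on_cot_mult_square:
  fixes u u' :: "real \<Rightarrow> real"
  assumes "\<omega> > 0"
    and der: "\<And>x. (u has_real_derivative u' x) (at x)"
    and zero: "\<And>x. x \<in> {A..B} \<Longrightarrow> sin (\<omega> * (x - z)) = 0 \<Longrightarrow> u x = a"
  shows "continuous_on {A..B} (\<lambda>x. \<omega> * (u x - a)\<^sup>2 * cot (\<omega> * (x - z)))"
proof (intro continuous_at_imp_continuous_on ballI)
  fix p assume p: "p \<in> {A..B}"
  let ?G = "\<lambda>x. \<omega> * (u x - a)\<^sup>2 * cot (\<omega> * (x - z))"
  have cu: "isCont u x" for x using der DERIV_isCont by blast
  show "isCont ?G p"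
  proof (cases "sin (\<omega> * (p - z)) = 0")
    case False
    then show ?thesis using cu unfolding cot_def by (intro continuous_intros) auto
  next
    case True
    then have up: "u p = a" using zero p by blast
    have cosn: "cos (\<omega> * (p - z)) \<noteq> 0" using True sin_zero_abs_cos_one by fastforce
    have "((\<lambda>x. sin (\<omega> * (x - z))) has_real_derivative cos (\<omega> * (p - z)) * \<omega>) (at p)"
      by (auto intro!: derivative_eq_intros)
    then have s: "((\<lambda>x. sin (\<omega> * (x - z)) / (x - p)) \<longlongrightarrow> cos (\<omega> * (p - z)) * \<omega>) (at p)"
      using True unfolding has_field_derivative_iff by simp
    have q: "((\<lambda>x. (u x - a) / (x - p)) \<longlongrightarrow> u' p) (at p)"
      using der[of p] up unfolding has_field_derivative_iff by simp
    have "isCont (\<lambda>x. u x - a) p" "isCont (\<lambda>x. cos (\<omega> * (x - z))) p"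
      using cu by (auto intro!: continuous_intros)
    then have r: "((\<lambda>x. u x - a) \<longlongrightarrow> 0) (at p)"
      "((\<lambda>x. cos (\<omega> * (x - z))) \<longlongrightarrow> cos (\<omega> * (p - z))) (at p)"
      using up by (auto simp: isCont_def)
    have L: "((\<lambda>x. \<omega> * ((u x - a) * ((u x - a) / (x - p)) * cos (\<omega> * (x - z))
          / (sin (\<omega> * (x - z)) / (x - p)))) \<longlongrightarrow>
        \<omega> * (0 * u' p * cos (\<omega> * (p - z)) / (cos (\<omega> * (p - z)) * \<omega>))) (at p)"
      using cosn assms(1) by (intro tendsto_intros s q r) auto
    have eq: "\<omega> * ((u x - a) * ((u x - a) / (x - p)) * cos (\<omega> * (x - z))
          / (sin (\<omega> * (x - z)) / (x - p))) = ?G x" if "x \<noteq> p" for x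
      using that unfolding cot_def by (simp add: power2_eq_square)
    have "(?G \<longlongrightarrow> \<omega> * (0 * u' p * cos (\<omega> * (p - z)) / (cos (\<omega> * (p - z)) * \<omega>))) (at p)"
      by (rule Lim_transform_eventually[OF L]) (use eq in \<open>unfold eventually_at_filter, blast intro: always_eventually\<close>)
    then have "(?G \<longlongrightarrow> 0) (at p)" by simp
    then show ?thesis unfolding isCont_def using up by simp
  qed
qed

text \<open>Integrating the square of \<open>u' - \<omega> (u - a) cot\<close>; the cotangent is singular exactly where
  \<open>u = a\<close>.\<close>

lemma cot_inequality:
  fixes u u' :: "real \<Rightarrow> real"
  assumes "A \<le> B" "\<omega> > 0"
    and der: "\<And>x. (u has_real_derivative u' x) (at x)"
    and cont: "continuous_on UNIV u'"
    and zero: "\<And>x. x \<in> {A..B} \<Longrightarrow> sin (\<omega> * (x - z)) = 0 \<Longrightarrow> u x = a"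
    and per: "(u A - a)\<^sup>2 * cot (\<omega> * (A - z)) = (u B - a)\<^sup>2 * cot (\<omega> * (B - z))"
  shows "\<omega>\<^sup>2 * integral {A..B} (\<lambda>x. (u x - a)\<^sup>2) \<le> integral {A..B} (\<lambda>x. (u' x)\<^sup>2)"
proof -
  let ?k = "\<lambda>x. cot (\<omega> * (x - z))"
  let ?G = "\<lambda>x. \<omega> * (u x - a)\<^sup>2 * ?k x"
  let ?G' = "\<lambda>x. 2 * (u x - a) * u' x * \<omega> * ?k x - \<omega>\<^sup>2 * (u x - a)\<^sup>2 * (1 + (?k x)\<^sup>2)"
  define S where "S = {x \<in> {A..B}. sin (\<omega> * (x - z)) = 0}"
  \<comment> \<open>The fundamental theorem used below tolerates finitely many points without
    derivative, provided the antiderivative is continuous. Finiteness follows from pi >= 1: the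
    index i of a zero obeys |i| <= \<omega> |x - z|.\<close>
  have "S \<subseteq> (\<lambda>i. z + of_int i * pi / \<omega>) ` {- \<lceil>\<omega> * (\<bar>A\<bar> + \<bar>B\<bar> + \<bar>z\<bar>)\<rceil> .. \<lceil>\<omega> * (\<bar>A\<bar> + \<bar>B\<bar> + \<bar>z\<bar>)\<rceil>}"
  proof
    fix x assume x: "x \<in> S"
    then obtain i :: int where i: "\<omega> * (x - z) = of_int i * pi"
      unfolding S_def sin_zero_iff_int2 by auto
    have "\<bar>real_of_int i\<bar> * 1 \<le> \<bar>real_of_int i\<bar> * pi"
      using pi_ge_two by (intro mult_left_mono) auto
    also have "\<dots> = \<omega> * \<bar>x - z\<bar>" using i assms(2) by (metis abs_mult abs_of_pos pi_gt_zero)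
    also have "\<dots> \<le> \<omega> * (\<bar>A\<bar> + \<bar>B\<bar> + \<bar>z\<bar>)"
      using x assms(2) by (intro mult_left_mono) (auto simp: S_def)
    finally have "\<bar>i\<bar> \<le> \<lceil>\<omega> * (\<bar>A\<bar> + \<bar>B\<bar> + \<bar>z\<bar>)\<rceil>" by linarith
    moreover have "x = z + of_int i * pi / \<omega>" using i assms(2) by (simp add: field_simps)
    ultimately show "x \<in> (\<lambda>i. z + of_int i * pi / \<omega>) ` {- \<lceil>\<omega> * (\<bar>A\<bar> + \<bar>B\<bar> + \<bar>z\<bar>)\<rceil> .. \<lceil>\<omega> * (\<bar>A\<bar> + \<bar>B\<bar> + \<bar>z\<bar>)\<rceil>}"
      by (intro image_eqI) auto
  qed
  then have "finite S" by (rule finite_subset) auto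
  have "(?G' has_integral ?G B - ?G A) {A..B}"
  proof (rule fundamental_theorem_of_calculus_strong[OF \<open>finite S\<close> assms(1)])
    fix x assume "x \<in> {A..B} - S"
    then have s: "sin (\<omega> * (x - z)) \<noteq> 0" unfolding S_def by auto
    have k: "1 + (?k x)\<^sup>2 = 1 / (sin (\<omega> * (x - z)))\<^sup>2"
      using s sin_cos_squared_add[of "\<omega> * (x - z)"] by (simp add: cot_def field_simps)
    have dk: "(?k has_real_derivative - (1 + (?k x)\<^sup>2) * \<omega>) (at x)"
      unfolding k by (rule DERIV_chain'[of "\<lambda>x. \<omega> * (x - z)", THEN DERIV_cong, OF _ DERIV_cot])
        (use s in \<open>auto intro!: derivative_eq_intros simp: inverse_eq_divide\<close>)
    have "(?G has_real_derivative \<omega> * (2 * (u x - a) * u' x) * ?k x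
        + \<omega> * (u x - a)\<^sup>2 * (- (1 + (?k x)\<^sup>2) * \<omega>)) (at x)"
      by (rule derivative_eq_intros der dk refl | simp)+
    then show "(?G has_vector_derivative ?G' x) (at x)"
      unfolding has_real_derivative_iff_has_vector_derivative
      by (rule has_vector_derivative_eq_rhs) (simp add: algebra_simps power2_eq_square)
  next
    show "continuous_on {A..B} ?G"
      by (rule continuous_on_cot_mult_square[OF assms(2) der zero]) auto
  qed
  moreover have "?G B - ?G A = 0" using per by (simp add: algebra_simps)
  ultimately have G': "(?G' has_integral 0) {A..B}" by simp
  have cu: "continuous_on T u" for T by (rule continuous_on_if_DERIV[OF der])
  have cu': "continuous_on T u'" for T using cont continuous_on_subset by blast
  have i: "(\<lambda>x. (u' x)\<^sup>2) integrable_on {A..B}" "(\<lambda>x. \<omega>\<^sup>2 * (u x - a)\<^sup>2) integrable_on {A..B}"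
    by (intro integrable_continuous_real continuous_intros cu cu')+
  have "0 \<le> integral {A..B} (\<lambda>x. (u' x)\<^sup>2) - integral {A..B} (\<lambda>x. \<omega>\<^sup>2 * (u x - a)\<^sup>2)"
  proof (rule has_integral_le[OF G' has_integral_diff[OF integrable_integral integrable_integral]])
    fix x assume "x \<in> {A..B}"
    have "0 \<le> (u' x - \<omega> * (u x - a) * ?k x)\<^sup>2" by simp
    also have "\<dots> = (u' x)\<^sup>2 - \<omega>\<^sup>2 * (u x - a)\<^sup>2 - ?G' x"
      by (simp add: power2_eq_square algebra_simps)
    finally show "?G' x \<le> (u' x)\<^sup>2 - \<omega>\<^sup>2 * (u x - a)\<^sup>2" by simp
  qed (rule i)+
  then show ?thesis by simp
qed

text \<open>With \<omega> = pi/h and z = 0 the cotangent is singular in [0, h] exactly at the two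
  ends, where u vanishes; the boundary terms vanish for the same reason.\<close>

lemma poincare_dirichlet:
  fixes u u' :: "real \<Rightarrow> real"
  assumes "h > 0"
    and der: "\<And>x. (u has_real_derivative u' x) (at x)"
    and cont: "continuous_on UNIV u'"
    and "u 0 = 0" "u h = 0"
  shows "(pi / h)\<^sup>2 * integral {0..h} (\<lambda>x. (u x)\<^sup>2) \<le> integral {0..h} (\<lambda>x. (u' x)\<^sup>2)"
proof -
  have "(pi / h)\<^sup>2 * integral {0..h} (\<lambda>x. (u x - 0)\<^sup>2) \<le> integral {0..h} (\<lambda>x. (u' x)\<^sup>2)"
  proof (rule cot_inequality[OF _ _ der cont, where z = 0])
    fix x assume x: "x \<in> {0..h}" "sin (pi / h * (x - 0)) = 0"
    then obtain i :: int where "pi / h * x = of_int i * pi" unfolding sin_zero_iff_int2 by auto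
    then have i: "x = of_int i * h" using assms(1) by (simp add: field_simps)
    then have "0 \<le> i" "i \<le> 1" using x assms(1) by (auto simp: zero_le_mult_iff)
    then have "i = 0 \<or> i = 1" by auto
    then show "u x = 0" using i assms by auto
  qed (use assms in auto)
  then show ?thesis by simp
qed

text \<open>The intermediate value theorem yields two points at distance \<open>1/2\<close> where \<open>u\<close> takes the same
  value; subtracting that value reduces the claim to a Dirichlet problem on intervals of
  length \<open>1/2\<close>.\<close>

lemma wirtinger:
  fixes u u' :: "real \<Rightarrow> real"
  assumes der: "\<And>x. (u has_real_derivative u' x) (at x)"
    and cont: "continuous_on UNIV u'"
    and per: "u 0 = u 1" and mean: "integral {0..1} u = 0"
  shows "(2 * pi)\<^sup>2 * integral {0..1} (\<lambda>x. (u x)\<^sup>2) \<le> integral {0..1} (\<lambda>x. (u' x)\<^sup>2)"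
proof -
  have cu: "continuous_on T u" for T by (rule continuous_on_if_DERIV[OF der])
  have cs: "continuous_on T (\<lambda>x. u (x + 1/2))" for T
    by (rule continuous_on_compose2[OF cu[of UNIV]]) (auto intro!: continuous_intros)
  define g where "g = (\<lambda>x. u (x + 1/2) - u x)"
  have cg: "continuous_on T g" for T unfolding g_def by (intro continuous_intros cu cs)
  \<comment> \<open>Periodicity turns the shift by 1/2 into a sign change, so g changes sign on
    [0, 1/2].\<close>
  have "g (1/2) = - g 0" unfolding g_def using per by simp
  then have "\<exists>x\<ge>0. x \<le> 1/2 \<and> g x = 0"
    using IVT'[of g 0 0 "1/2"] IVT2'[of g "1/2" 0 0] cg by (cases "g 0 \<le> 0") auto
  then obtain z where z: "0 \<le> z" "z \<le> 1/2" "u (z + 1/2) = u z" unfolding g_def by auto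
  define a where "a = u z"
  have "(2 * pi)\<^sup>2 * integral {0..1} (\<lambda>x. (u x - a)\<^sup>2) \<le> integral {0..1} (\<lambda>x. (u' x)\<^sup>2)"
  proof (rule cot_inequality[OF _ _ der cont, where z = z])
    fix x :: real assume x: "x \<in> {0..1}" "sin (2 * pi * (x - z)) = 0"
    then obtain i :: int where "2 * pi * (x - z) = of_int i * pi" unfolding sin_zero_iff_int2 by auto
    then have "2 * (x - z) = of_int i" using pi_gt_zero by (metis mult.assoc mult.commute mult_right_cancel less_irrefl)
    then have i: "x = z + of_int i / 2" by simp
    have "- 1 \<le> i" "i \<le> 2" using x z i by auto
    then have "i = -1 \<or> i = 0 \<or> i = 1 \<or> i = 2" by auto
    then consider "x = 0 \<and> z + 1/2 = 1" | "x = z" | "x = z + 1/2" | "x = 1 \<and> z = 0"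
      using i x z by force
    then show "u x = a" unfolding a_def by cases (metis per z(3), simp, simp add: z(3), simp add: per)
  next
    have e: "2 * pi * (1 - z) = 2 * pi * (0 - z) + 2 * pi" by (simp add: algebra_simps)
    have "sin (2 * pi * (1 - z)) = sin (2 * pi * (0 - z))" "cos (2 * pi * (1 - z)) = cos (2 * pi * (0 - z))"
      unfolding e by simp_all
    then show "(u 0 - a)\<^sup>2 * cot (2 * pi * (0 - z)) = (u 1 - a)\<^sup>2 * cot (2 * pi * (1 - z))"
      using per by (simp add: cot_def)
  qed auto
  \<comment> \<open>The zero mean removes the cross term, so shifting u by a only enlarges the left
    side of the inequality and the shift can be undone.\<close>
  moreover have "integral {0..1} (\<lambda>x. (u x - a)\<^sup>2) = integral {0..1} (\<lambda>x. (u x)\<^sup>2) + a\<^sup>2"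
  proof (rule integral_unique)
    have mean': "(u has_integral 0) {0..1}"
      using integrable_integral[OF integrable_continuous_real[OF cu], of 0 1] mean by simp
    have "((\<lambda>x. (u x)\<^sup>2 - 2 * a * u x + a\<^sup>2) has_integral
        (integral {0..1} (\<lambda>x. (u x)\<^sup>2) - 2 * a * 0 + a\<^sup>2)) {0..1}"
      using has_integral_const_real[of "a\<^sup>2" 0 1] mean'
      by (intro has_integral_add has_integral_diff has_integral_mult_right)
        (auto intro!: integrable_integral integrable_continuous_real continuous_intros cu)
    then show "((\<lambda>x. (u x - a)\<^sup>2) has_integral integral {0..1} (\<lambda>x. (u x)\<^sup>2) + a\<^sup>2) {0..1}"
      by (simp add: power2_eq_square algebra_simps)
  qed
  ultimately have le: "(2 * pi)\<^sup>2 * (integral {0..1} (\<lambda>x. (u x)\<^sup>2) + a\<^sup>2) \<le> integral {0..1} (\<lambda>x. (u' x)\<^sup>2)"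
    by simp
  have "(2 * pi)\<^sup>2 * integral {0..1} (\<lambda>x. (u x)\<^sup>2)
      \<le> (2 * pi)\<^sup>2 * (integral {0..1} (\<lambda>x. (u x)\<^sup>2) + a\<^sup>2)"
    by (intro mult_left_mono) auto
  from this le show ?thesis by (rule order_trans)
qed

text \<open>Clamped ends make z and z1 periodic, and z1 has mean zero because z takes equal values
  at 0 and 1. The periodic inequality thus applies twice and gives (2 pi)^4; only the zero mean of z
  has to be arranged beforehand.\<close>

lemma fourth_order_wirtinger:
  fixes z z1 z2 :: "real \<Rightarrow> real"
  assumes der: "\<And>x. (z has_real_derivative z1 x) (at x)" "\<And>x. (z1 has_real_derivative z2 x) (at x)"
    and cont: "continuous_on UNIV z2"
    and bc: "z 0 = 0" "z 1 = 0" "z1 0 = 0" "z1 1 = 0" and mean: "integral {0..1} z = 0"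
  shows "16 * pi ^ 4 * integral {0..1} (\<lambda>x. (z x)\<^sup>2) \<le> integral {0..1} (\<lambda>x. (z2 x)\<^sup>2)"
proof -
  have c1: "continuous_on UNIV z1" by (rule continuous_on_if_DERIV[OF der(2)])
  have "(z1 has_integral z 1 - z 0) {0..1}"
    by (rule fundamental_theorem_of_calculus)
      (auto simp flip: has_real_derivative_iff_has_vector_derivative intro: der(1) has_field_derivative_at_within)
  then have m1: "integral {0..1} z1 = 0" using bc by (simp add: integral_unique)
  have "(2 * pi)\<^sup>2 * integral {0..1} (\<lambda>x. (z x)\<^sup>2) \<le> integral {0..1} (\<lambda>x. (z1 x)\<^sup>2)"
    by (rule wirtinger[OF der(1) c1]) (use bc mean in auto)
  then have "(2 * pi)\<^sup>2 * ((2 * pi)\<^sup>2 * integral {0..1} (\<lambda>x. (z x)\<^sup>2))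
      \<le> (2 * pi)\<^sup>2 * integral {0..1} (\<lambda>x. (z1 x)\<^sup>2)"
    by (rule mult_left_mono) simp
  also have "\<dots> \<le> integral {0..1} (\<lambda>x. (z2 x)\<^sup>2)"
    by (rule wirtinger[OF der(2) cont]) (use bc m1 in auto)
  finally show ?thesis by (simp add: power2_eq_square power4_eq_xxxx mult.assoc mult.left_commute)
qed

section \<open>The clamped beam\<close>

text \<open>The classical coefficient (cosh c - cos c)/(sinh c - sin c) of the clamped mode, with
  cos c and sin c eliminated by the root equation.\<close>

definition beam_ratio :: real where
  "beam_ratio = sinh c_beam / (cosh c_beam + 1)"

text \<open>The ground state of the clamped beam in the textbook scaling, which turns out to have
  unit norm already, see \<open>integral_beam_square\<close>.\<close>

definition beam :: "real \<Rightarrow> real" where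
  "beam y = cosh (c_beam * y) - cos (c_beam * y) - beam_ratio * (sinh (c_beam * y) - sin (c_beam * y))"

definition beam1 :: "real \<Rightarrow> real" where
  "beam1 y = c_beam * (sinh (c_beam * y) + sin (c_beam * y)
     - beam_ratio * (cosh (c_beam * y) - cos (c_beam * y)))"

definition beam2 :: "real \<Rightarrow> real" where
  "beam2 y = c_beam\<^sup>2 * (cosh (c_beam * y) + cos (c_beam * y)
     - beam_ratio * (sinh (c_beam * y) + sin (c_beam * y)))"

definition beam3 :: "real \<Rightarrow> real" where
  "beam3 y = c_beam ^ 3 * (sinh (c_beam * y) - sin (c_beam * y)
     - beam_ratio * (cosh (c_beam * y) + cos (c_beam * y)))"

lemma beam_derivs:
  "(beam has_real_derivative beam1 y) (at y within S)"
  "(beam1 has_real_derivative beam2 y) (at y within S)"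
  "(beam2 has_real_derivative beam3 y) (at y within S)"
  "(beam3 has_real_derivative c_beam ^ 4 * beam y) (at y within S)"
  unfolding beam_def[abs_def] beam1_def[abs_def] beam2_def[abs_def] beam3_def[abs_def]
  by (auto intro!: derivative_eq_intros simp: algebra_simps power2_eq_square power3_eq_cube power4_eq_xxxx)

lemma beam_continuous [continuous_intros]:
  "continuous_on S beam" "continuous_on S beam1" "continuous_on S beam2" "continuous_on S beam3"
  by (rule continuous_on_if_DERIV, rule beam_derivs)+

lemma c_beam_pos: "c_beam > 0"
  using c_beam_props(5) by simp

text \<open>The conditions at 0 are built into the formula. At 1 one coefficient has to satisfy two
  conditions, \<open>beam_ratio * S = C - 1\<close> and \<open>beam_ratio * (C + 1) = S\<close>;
  they agree because S^2 = C^2 - 1. Multiplying by C clears the denominators of sin c and cos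
  c.\<close>

lemma beam_boundary:
  "beam 0 = 0" "beam1 0 = 0" "beam2 0 = 2 * c_beam\<^sup>2" "beam3 0 = - 2 * beam_ratio * c_beam ^ 3"
  "beam 1 = 0" "beam1 1 = 0" "beam2 1 = 2 * c_beam\<^sup>2" "beam3 1 = 2 * beam_ratio * c_beam ^ 3"
proof -
  show "beam 0 = 0" "beam1 0 = 0" "beam2 0 = 2 * c_beam\<^sup>2" "beam3 0 = - 2 * beam_ratio * c_beam ^ 3"
    by (simp_all add: beam_def beam1_def beam2_def beam3_def)
  define C where "C = cosh c_beam"
  define S where "S = sinh c_beam"
  have C: "C > 0" unfolding C_def by simp
  have SC: "S\<^sup>2 = (C + 1) * (C - 1)"
    unfolding S_def C_def sinh_square_eq by (simp add: algebra_simps power2_eq_square)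
  have r: "beam_ratio * S = C - 1"
    unfolding beam_ratio_def S_def[symmetric] C_def[symmetric] using SC C by (simp add: power2_eq_square)
  have rC: "beam_ratio * (C + 1) = S"
    unfolding beam_ratio_def S_def[symmetric] C_def[symmetric] using C by simp
  note defs = sin_c_beam cos_c_beam S_def[symmetric] C_def[symmetric]
  have "C * beam 1 = C * C - 1 - beam_ratio * S * (C + 1)"
    unfolding beam_def using C by (simp add: defs field_simps)
  then show "beam 1 = 0" unfolding r using C by (simp add: algebra_simps)
  have "C * beam1 1 = c_beam * (C - 1) * (S - beam_ratio * (C + 1))"
    unfolding beam1_def using C by (simp add: defs field_simps)
  then show "beam1 1 = 0" unfolding rC using C by simp
  have "C * beam2 1 = c_beam\<^sup>2 * (C * C + 1 - beam_ratio * S * (C - 1))"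
    unfolding beam2_def using C by (simp add: defs field_simps)
  also have "\<dots> = C * (2 * c_beam\<^sup>2)" unfolding r by (simp add: algebra_simps)
  finally show "beam2 1 = 2 * c_beam\<^sup>2" using C by simp
  have "C * beam3 1 = c_beam ^ 3 * ((C + 1) * S - beam_ratio * (C * C + 1))"
    unfolding beam3_def using C by (simp add: defs field_simps)
  also have "\<dots> = C * (2 * beam_ratio * c_beam ^ 3)"
    unfolding rC[symmetric] by (simp add: algebra_simps)
  finally show "beam3 1 = 2 * beam_ratio * c_beam ^ 3" using C by simp
qed

text \<open>The antiderivative comes from the conservation law that a solution of \<open>u'''' = k u\<close>
  inherits from the scaling \<open>y \<mapsto> s y\<close>.\<close>

lemma integral_square_fourth_order_ode:
  fixes u u1 u2 u3 :: "real \<Rightarrow> real"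
  assumes der: "\<And>y. (u has_real_derivative u1 y) (at y)" "\<And>y. (u1 has_real_derivative u2 y) (at y)"
    "\<And>y. (u2 has_real_derivative u3 y) (at y)" "\<And>y. (u3 has_real_derivative k * u y) (at y)"
    and bc: "u 0 = 0" "u 1 = 0"
  shows "4 * k * integral {0..1} (\<lambda>y. (u y)\<^sup>2) =
    (u2 1)\<^sup>2 - 2 * u1 1 * u3 1 - u1 1 * u2 1 + u1 0 * u2 0"
proof -
  let ?F = "\<lambda>y. y * ((u2 y)\<^sup>2 + k * (u y)\<^sup>2 - 2 * u1 y * u3 y) + 3 * u y * u3 y - u1 y * u2 y"
  have "((\<lambda>y. 4 * k * (u y)\<^sup>2) has_integral ?F 1 - ?F 0) {0..1}"
  proof (rule fundamental_theorem_of_calculus)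
    fix y :: real
    have "(?F has_real_derivative 4 * k * (u y)\<^sup>2) (at y)"
      by (rule derivative_eq_intros der refl)+ (simp add: algebra_simps power2_eq_square)
    then show "(?F has_vector_derivative 4 * k * (u y)\<^sup>2) (at y within {0..1})"
      by (simp add: has_real_derivative_iff_has_vector_derivative has_vector_derivative_at_within)
  qed simp
  then have "integral {0..1} (\<lambda>y. 4 * k * (u y)\<^sup>2) = ?F 1 - ?F 0"
    by (rule integral_unique)
  then show ?thesis using bc by simp
qed

lemma integral_beam_square: "integral {0..1} (\<lambda>y. (beam y)\<^sup>2) = 1"
proof -
  have "4 * c_beam ^ 4 * integral {0..1} (\<lambda>y. (beam y)\<^sup>2) = 4 * c_beam ^ 4"
    by (subst integral_square_fourth_order_ode[OF beam_derivs])
      (simp_all add: beam_boundary power2_eq_square power4_eq_xxxx)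
  then show ?thesis using c_beam_pos by simp
qed

text \<open>The derivative u' solves the same equation u'''' = c^4 u and vanishes at both ends, so
  the conservation law applies to the chain of derivatives shifted by one.\<close>

lemma integral_beam1_square: "integral {0..1} (\<lambda>y. (beam1 y)\<^sup>2) = d_beam * c_beam\<^sup>2"
proof -
  have d: "((\<lambda>y. c_beam ^ 4 * beam y) has_real_derivative c_beam ^ 4 * beam1 y) (at y)" for y
    by (rule DERIV_cmult[OF beam_derivs(1)])
  have "4 * c_beam ^ 4 * integral {0..1} (\<lambda>y. (beam1 y)\<^sup>2)
      = 4 * c_beam ^ 4 * (beam_ratio\<^sup>2 * c_beam\<^sup>2 - 2 * beam_ratio * c_beam)"
    by (subst integral_square_fourth_order_ode[OF beam_derivs(2,3,4) d])
      (simp_all add: beam_boundary power2_eq_square power3_eq_cube power4_eq_xxxx algebra_simps)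
  then have "integral {0..1} (\<lambda>y. (beam1 y)\<^sup>2) = beam_ratio\<^sup>2 * c_beam\<^sup>2 - 2 * beam_ratio * c_beam"
    using c_beam_pos by simp
  also have "\<dots> = d_beam * c_beam\<^sup>2"
  proof -
    define C where "C = cosh c_beam"
    define S where "S = sinh c_beam"
    have C: "C > 0" unfolding C_def by simp
    have "S\<^sup>2 = (C + 1) * (C - 1)"
      unfolding S_def C_def sinh_square_eq by (simp add: algebra_simps power2_eq_square)
    then have r2: "beam_ratio\<^sup>2 = (C - 1) / (C + 1)" and r: "beam_ratio = S / (C + 1)"
      unfolding beam_ratio_def S_def[symmetric] C_def[symmetric] power_divide
      using C by (simp_all add: power2_eq_square)
    show ?thesis
      unfolding r2 unfolding r d_beam_eq S_def[symmetric] C_def[symmetric]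
      using c_beam_pos C by (simp add: divide_simps power2_eq_square) (simp add: algebra_simps)
  qed
  finally show ?thesis .
qed

text \<open>Since c^4 u is the derivative of u''', the mean of u is a jump of boundary values. It is
  the divisor in \<open>clamped_beam_gap\<close>, where a multiple of u has to cancel a given
  mean.\<close>

lemma integral_beam_pos: "integral {0..1} beam > 0"
proof -
  have "((\<lambda>y. c_beam ^ 4 * beam y) has_integral beam3 1 - beam3 0) {0..1}"
    by (rule fundamental_theorem_of_calculus)
      (auto simp flip: has_real_derivative_iff_has_vector_derivative intro: beam_derivs)
  then have "c_beam ^ 4 * integral {0..1} beam = 4 * beam_ratio * c_beam ^ 3"
    using integral_unique[of "\<lambda>y. c_beam ^ 4 * beam y"] by (simp add: beam_boundary)
  moreover have "beam_ratio > 0"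
    unfolding beam_ratio_def using c_beam_pos by (auto intro!: divide_pos_pos add_pos_pos)
  ultimately have "0 < c_beam ^ 4 * integral {0..1} beam"
    using c_beam_pos by simp
  then show ?thesis using c_beam_pos by (simp add: zero_less_mult_iff)
qed

text \<open>The first identity is the weak eigenvalue equation of u tested with a clamped v. The
  second writes the cross term of the perturbation as a pairing with v itself, so that it can be
  estimated by the norm of v alone.\<close>

lemma integral_beam2_mult:
  assumes der: "\<And>y. (v has_real_derivative v1 y) (at y)" "\<And>y. (v1 has_real_derivative v2 y) (at y)"
    and cont: "continuous_on UNIV v2"
    and bc: "v 0 = 0" "v 1 = 0" "v1 0 = 0" "v1 1 = 0"
  shows "integral {0..1} (\<lambda>y. beam2 y * v2 y) = c_beam ^ 4 * integral {0..1} (\<lambda>y. beam y * v y)"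
    and "integral {0..1} (\<lambda>y. beam1 y * v1 y) = - integral {0..1} (\<lambda>y. beam2 y * v y)"
proof -
  have cv: "continuous_on S v" "continuous_on S v1" "continuous_on S v2" for S
    using continuous_on_if_DERIV[OF der(1)] continuous_on_if_DERIV[OF der(2)] continuous_on_subset[OF cont]
    by auto
  let ?F = "\<lambda>y. beam2 y * v1 y - beam3 y * v y"
  have "((\<lambda>y. beam2 y * v2 y - c_beam ^ 4 * (beam y * v y)) has_integral ?F 1 - ?F 0) {0..1}"
  proof (rule fundamental_theorem_of_calculus)
    fix y :: real
    have "(?F has_real_derivative beam2 y * v2 y - c_beam ^ 4 * (beam y * v y)) (at y)"
      by (rule derivative_eq_intros der beam_derivs refl)+ (simp add: algebra_simps)
    then show "(?F has_vector_derivative beam2 y * v2 y - c_beam ^ 4 * (beam y * v y)) (at y within {0..1})"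
      by (simp add: has_real_derivative_iff_has_vector_derivative has_vector_derivative_at_within)
  qed simp
  then have "integral {0..1} (\<lambda>y. beam2 y * v2 y - c_beam ^ 4 * (beam y * v y)) = 0"
    using bc by (simp add: integral_unique)
  then show "integral {0..1} (\<lambda>y. beam2 y * v2 y) = c_beam ^ 4 * integral {0..1} (\<lambda>y. beam y * v y)"
    by (subst (asm) integral_diff) (auto intro!: integrable_continuous_real continuous_intros cv)
  let ?F = "\<lambda>y. beam1 y * v y"
  have "((\<lambda>y. beam1 y * v1 y + beam2 y * v y) has_integral ?F 1 - ?F 0) {0..1}"
  proof (rule fundamental_theorem_of_calculus)
    fix y :: real
    have "(?F has_real_derivative beam1 y * v1 y + beam2 y * v y) (at y)"
      by (rule derivative_eq_intros der beam_derivs refl)+ (simp add: algebra_simps)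
    then show "(?F has_vector_derivative beam1 y * v1 y + beam2 y * v y) (at y within {0..1})"
      by (simp add: has_real_derivative_iff_has_vector_derivative has_vector_derivative_at_within)
  qed simp
  then have "integral {0..1} (\<lambda>y. beam1 y * v1 y + beam2 y * v y) = 0"
    using bc by (simp add: integral_unique)
  then show "integral {0..1} (\<lambda>y. beam1 y * v1 y) = - integral {0..1} (\<lambda>y. beam2 y * v y)"
    by (subst (asm) integral_add) (auto intro!: integrable_continuous_real continuous_intros cv)
qed

lemma integral_square_lincomb:
  fixes f g :: "real \<Rightarrow> real"
  assumes "continuous_on {0..1} f" "continuous_on {0..1} g"
  shows "integral {0..1} (\<lambda>y. (a * f y + b * g y)\<^sup>2) =
    a\<^sup>2 * integral {0..1} (\<lambda>y. (f y)\<^sup>2) + 2 * a * b * integral {0..1} (\<lambda>y. g y * f y)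
    + b\<^sup>2 * integral {0..1} (\<lambda>y. (g y)\<^sup>2)"
proof -
  have "((\<lambda>y. a\<^sup>2 * (f y)\<^sup>2 + 2 * a * b * (g y * f y) + b\<^sup>2 * (g y)\<^sup>2) has_integral
    a\<^sup>2 * integral {0..1} (\<lambda>y. (f y)\<^sup>2) + 2 * a * b * integral {0..1} (\<lambda>y. g y * f y)
    + b\<^sup>2 * integral {0..1} (\<lambda>y. (g y)\<^sup>2)) {0..1}"
    by (intro has_integral_add has_integral_mult_right integrable_integral
        integrable_continuous_real continuous_intros assms)
  moreover have "(\<lambda>y. a\<^sup>2 * (f y)\<^sup>2 + 2 * a * b * (g y * f y) + b\<^sup>2 * (g y)\<^sup>2) = (\<lambda>y. (a * f y + b * g y)\<^sup>2)"
    by (auto simp: power2_eq_square algebra_simps)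
  ultimately show ?thesis by (simp add: integral_unique)
qed

lemma integral_beam2_square: "integral {0..1} (\<lambda>y. (beam2 y)\<^sup>2) = c_beam ^ 4"
  using integral_beam2_mult(1)[OF beam_derivs(1,2) beam_continuous(3)] integral_beam_square
  by (simp add: beam_boundary power2_eq_square)

text \<open>Adding the multiple of the ground state that makes the mean vanish gives the first bound on
  \<open>\<integral>v''\<^sup>2\<close>; this replaces a spectral gap, since \<open>16 \<pi>\<^sup>4 > c\<^sup>4\<close>.\<close>

lemma clamped_beam_gap:
  assumes der: "\<And>y. (v has_real_derivative v1 y) (at y)" "\<And>y. (v1 has_real_derivative v2 y) (at y)"
    and cont: "continuous_on UNIV v2"
    and bc: "v 0 = 0" "v 1 = 0" "v1 0 = 0" "v1 1 = 0"
  shows "16 * pi ^ 4 * integral {0..1} (\<lambda>y. (v y)\<^sup>2)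
      - (16 * pi ^ 4 - c_beam ^ 4) * (integral {0..1} (\<lambda>y. beam y * v y))\<^sup>2
    \<le> integral {0..1} (\<lambda>y. (v2 y)\<^sup>2)"
proof -
  have cv: "continuous_on S v" "continuous_on S v1" "continuous_on S v2" for S
    using continuous_on_if_DERIV[OF der(1)] continuous_on_if_DERIV[OF der(2)] continuous_on_subset[OF cont]
    by auto
  define g where "g = - integral {0..1} v / integral {0..1} beam"
  define \<alpha> where "\<alpha> = integral {0..1} (\<lambda>y. beam y * v y)"
  let ?V0 = "integral {0..1} (\<lambda>y. (v y)\<^sup>2)" and ?V2 = "integral {0..1} (\<lambda>y. (v2 y)\<^sup>2)"
  have "16 * pi ^ 4 * integral {0..1} (\<lambda>y. (1 * v y + g * beam y)\<^sup>2)
      \<le> integral {0..1} (\<lambda>y. (1 * v2 y + g * beam2 y)\<^sup>2)"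
  proof (rule fourth_order_wirtinger)
    show "((\<lambda>y. 1 * v y + g * beam y) has_real_derivative 1 * v1 y + g * beam1 y) (at y)" for y
      by (rule derivative_eq_intros der beam_derivs refl)+ simp
    show "((\<lambda>y. 1 * v1 y + g * beam1 y) has_real_derivative 1 * v2 y + g * beam2 y) (at y)" for y
      by (rule derivative_eq_intros der beam_derivs refl)+ simp
    have "integral {0..1} (\<lambda>y. 1 * v y + g * beam y) = integral {0..1} v + g * integral {0..1} beam"
      by (subst integral_add) (auto intro!: integrable_continuous_real continuous_intros cv)
    then show "integral {0..1} (\<lambda>y. 1 * v y + g * beam y) = 0"
      unfolding g_def using integral_beam_pos by simp
  qed (auto intro!: continuous_intros cv simp: bc beam_boundary)
  then have *: "16 * pi ^ 4 * (?V0 + 2 * g * \<alpha> + g\<^sup>2) \<le> ?V2 + 2 * g * (c_beam ^ 4 * \<alpha>) + g\<^sup>2 * c_beam ^ 4"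
    unfolding integral_square_lincomb[OF cv(1) beam_continuous(1)]
      integral_square_lincomb[OF cv(3) beam_continuous(3)]
      integral_beam2_mult(1)[OF der cont bc] integral_beam_square integral_beam2_square \<alpha>_def
    by simp
  have "c_beam ^ 4 \<le> (2 * pi) ^ 4"
    using c_beam_props(2) c_beam_pos by (intro power_mono) auto
  \<comment> \<open>The multiple g is not under control, but all terms containing it complete to
    this square, whose factor is nonnegative because c < 2 pi.\<close>
  then have "0 \<le> (16 * pi ^ 4 - c_beam ^ 4) * (g + \<alpha>)\<^sup>2" by (simp add: power_mult_distrib)
  also have "\<dots> = (16 * pi ^ 4 - c_beam ^ 4) * (2 * g * \<alpha> + g\<^sup>2) + (16 * pi ^ 4 - c_beam ^ 4) * \<alpha>\<^sup>2"
    by (simp add: algebra_simps power2_eq_square)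
  finally show ?thesis using * unfolding \<alpha>_def[symmetric] by (simp add: algebra_simps)
qed

text \<open>Write v = \<alpha> u + w with w orthogonal to u. The gap gives
  \<open>\<integral>v''\<^sup>2\<close> >= c^4 \<alpha>^2 + 16 pi^4
  \<open>\<integral>w\<^sup>2\<close>, and dropping \<open>\<integral>w'\<^sup>2\<close> bounds
  \<open>\<integral>v'\<^sup>2\<close> below by \<alpha>^2 b plus a cross term equal to - 2 \<alpha>
  \<open>\<integral>u'' w\<close>. The rest is a sum of four nonnegative quantities.\<close>

lemma clamped_beam_lower_bound:
  assumes der: "\<And>y. (v has_real_derivative v1 y) (at y)" "\<And>y. (v1 has_real_derivative v2 y) (at y)"
    and cont: "continuous_on UNIV v2"
    and bc: "v 0 = 0" "v 1 = 0" "v1 0 = 0" "v1 1 = 0"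
    and t: "0 \<le> t" "t \<le> 1"
  shows "(c_beam ^ 4 + 2 * t * (d_beam * c_beam\<^sup>2) - 4 * c_beam ^ 4 * t\<^sup>2) * integral {0..1} (\<lambda>y. (v y)\<^sup>2)
    \<le> integral {0..1} (\<lambda>y. (v2 y)\<^sup>2) + 2 * t * integral {0..1} (\<lambda>y. (v1 y)\<^sup>2)"
proof -
  have cv: "continuous_on S v" "continuous_on S v1" "continuous_on S v2" for S
    using continuous_on_if_DERIV[OF der(1)] continuous_on_if_DERIV[OF der(2)] continuous_on_subset[OF cont]
    by auto
  define \<alpha> where "\<alpha> = integral {0..1} (\<lambda>y. beam y * v y)"
  define b where "b = d_beam * c_beam\<^sup>2"
  define V0 where "V0 = integral {0..1} (\<lambda>y. (v y)\<^sup>2)"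
  define V1 where "V1 = integral {0..1} (\<lambda>y. (v1 y)\<^sup>2)"
  define V2 where "V2 = integral {0..1} (\<lambda>y. (v2 y)\<^sup>2)"
  define M where "M = integral {0..1} (\<lambda>y. beam2 y * v y)"
  define K where "K = 16 * pi ^ 4"
  define c4 where "c4 = c_beam ^ 4"
  have gap: "K * V0 - (K - c4) * \<alpha>\<^sup>2 \<le> V2"
    using clamped_beam_gap[OF der cont bc] unfolding K_def c4_def V0_def V2_def \<alpha>_def .
  \<comment> \<open>A function that is not integrable has integral 0, so this holds for every
    f.\<close>
  have sq: "0 \<le> integral {0..1} (\<lambda>y. (f y)\<^sup>2)" for f :: "real \<Rightarrow> real"
    by (cases "(\<lambda>y. (f y)\<^sup>2) integrable_on {0..1}") (auto simp: integral_nonneg not_integrable_integral)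
  have W: "0 \<le> V0 - \<alpha>\<^sup>2"
    using sq[of "\<lambda>y. 1 * v y + (- \<alpha>) * beam y"]
    unfolding integral_square_lincomb[OF cv(1) beam_continuous(1)] integral_beam_square
    by (simp add: V0_def \<alpha>_def power2_eq_square)
  have V1: "2 * \<alpha> * (- M) - \<alpha>\<^sup>2 * b \<le> V1"
    using sq[of "\<lambda>y. 1 * v1 y + (- \<alpha>) * beam1 y"]
    unfolding integral_square_lincomb[OF cv(2) beam_continuous(2)] integral_beam1_square
      integral_beam2_mult(2)[OF der cont bc]
    by (simp add: V1_def M_def b_def power2_eq_square)
  have bb: "b = - integral {0..1} (\<lambda>y. beam2 y * beam y)"
    using integral_beam2_mult(2)[OF beam_derivs(1,2) beam_continuous(3)] integral_beam1_square
    by (simp add: beam_boundary power2_eq_square b_def)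
  \<comment> \<open>The square of w - 2 t \<alpha> u'' absorbs the cross term: it uses up one copy
    of \<open>\<integral>w\<^sup>2\<close> and 4 t^2 \<alpha>^2 c^4, the origin of the error
    constant in the statement.\<close>
  have M: "0 \<le> V0 - \<alpha>\<^sup>2 - 4 * t * \<alpha> * (M + \<alpha> * b) + 4 * t\<^sup>2 * \<alpha>\<^sup>2 * c4"
  proof -
    let ?w = "\<lambda>y. 1 * v y + (- \<alpha>) * beam y"
    have "integral {0..1} (\<lambda>y. beam2 y * ?w y) = integral {0..1} (\<lambda>y. beam2 y * v y - \<alpha> * (beam2 y * beam y))"
      by (simp add: algebra_simps)
    also have "\<dots> = M + \<alpha> * b"
      unfolding bb M_def by (subst integral_diff) (auto intro!: integrable_continuous_real continuous_intros cv)
    finally have m: "integral {0..1} (\<lambda>y. beam2 y * ?w y) = M + \<alpha> * b" .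
    have w: "integral {0..1} (\<lambda>y. (?w y)\<^sup>2) = V0 - \<alpha>\<^sup>2"
      unfolding integral_square_lincomb[OF cv(1) beam_continuous(1)] integral_beam_square
      by (simp add: V0_def \<alpha>_def power2_eq_square)
    have cw: "continuous_on {0..1} ?w" by (intro continuous_intros cv)
    have "0 \<le> integral {0..1} (\<lambda>y. (1 * ?w y + (- 2 * t * \<alpha>) * beam2 y)\<^sup>2)"
      by (rule sq)
    also have "\<dots> = V0 - \<alpha>\<^sup>2 + 2 * (- 2 * t * \<alpha>) * (M + \<alpha> * b) + (- 2 * t * \<alpha>)\<^sup>2 * c4"
      unfolding integral_square_lincomb[OF cw beam_continuous(3)] w m integral_beam2_square c4_def by simp
    finally show ?thesis by (simp add: power2_eq_square algebra_simps)
  qed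
  \<comment> \<open>What remains of the coefficient of \<open>\<integral>w\<^sup>2\<close> after one
    copy is spent. Crude numbers suffice: 1296 - 1 - 625 - 30 > 0.\<close>
  have "K - 1 - c4 - 2 * t * b + 4 * c4 * t\<^sup>2 \<ge> 0"
  proof -
    have "3 ^ 4 \<le> pi ^ 4" using pi_bounds_coarse by (intro power_mono) auto
    then have "K \<ge> 1296" unfolding K_def by simp
    moreover have "c4 \<le> 5 ^ 4" unfolding c4_def using c_beam_props(6) c_beam_pos by (intro power_mono) auto
    then have "c4 \<le> 625" by simp
    moreover have "b \<le> 0.6 * 5\<^sup>2" unfolding b_def using c_beam_props(5,6) c_beam_pos d_beam_approx[unfolded abs_less_iff]
      by (intro mult_mono power_mono) auto
    then have "2 * t * b \<le> 2 * t * 15" using t by (intro mult_left_mono) auto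
    moreover have "0 \<le> 4 * c4 * t\<^sup>2" unfolding c4_def using c_beam_pos by simp
    ultimately show ?thesis using t by linarith
  qed
  then have 1: "0 \<le> (K - 1 - c4 - 2 * t * b + 4 * c4 * t\<^sup>2) * (V0 - \<alpha>\<^sup>2)"
    using W by (rule mult_nonneg_nonneg)
  have 2: "0 \<le> 2 * t * (V1 - (2 * \<alpha> * (- M) - \<alpha>\<^sup>2 * b))"
    using V1 t by (intro mult_nonneg_nonneg) auto
  have 3: "0 \<le> V2 - (K * V0 - (K - c4) * \<alpha>\<^sup>2)"
    using gap by simp
  have "V2 + 2 * t * V1 - (c4 + 2 * t * b - 4 * c4 * t\<^sup>2) * V0
      = V2 - (K * V0 - (K - c4) * \<alpha>\<^sup>2) + 2 * t * (V1 - (2 * \<alpha> * (- M) - \<alpha>\<^sup>2 * b))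
        + (V0 - \<alpha>\<^sup>2 - 4 * t * \<alpha> * (M + \<alpha> * b) + 4 * t\<^sup>2 * \<alpha>\<^sup>2 * c4)
        + (K - 1 - c4 - 2 * t * b + 4 * c4 * t\<^sup>2) * (V0 - \<alpha>\<^sup>2)"
    by (simp add: algebra_simps power2_eq_square)
  also have "\<dots> \<ge> 0"
    by (intro add_nonneg_nonneg 1 2 3 M)
  finally have "(c4 + 2 * t * b - 4 * c4 * t\<^sup>2) * V0 \<le> V2 + 2 * t * V1"
    by simp
  then show ?thesis unfolding V0_def V1_def V2_def b_def c4_def .
qed

section \<open>Test functions on the rectangle\<close>

lemma pdx_eq: "pdx f = (\<lambda>p. frechet_derivative f (at p) (1, 0))"
  and pdy_eq: "pdy f = (\<lambda>p. frechet_derivative f (at p) (0, 1))"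
  by (auto simp: pdx_def pdy_def)

lemma smooth_pd:
  assumes "\<forall>k. C_k k f"
  shows "\<forall>k. C_k k (pdx f)" "\<forall>k. C_k k (pdy f)"
  using assms C_k.simps(2)[of _ f] unfolding pdx_eq pdy_eq by blast+

lemma smooth_continuous_on: "\<forall>k. C_k k f \<Longrightarrow> continuous_on S f"
  using C_k.simps(1) continuous_on_subset by blast

lemma smooth_has_derivative:
  "\<forall>k. C_k k f \<Longrightarrow> (f has_derivative frechet_derivative f (at p)) (at p)"
  using C_k.simps(2)[of 0 f] by (cases p) (simp add: differentiable_on_def frechet_derivative_works)

lemma has_vector_derivative_pdx:
  assumes "(f has_derivative frechet_derivative f (at (x, y))) (at (x, y))"
  shows "((\<lambda>x. f (x, y)) has_vector_derivative pdx f (x, y)) (at x within S)"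
proof -
  interpret linear "frechet_derivative f (at (x, y))"
    using assms has_derivative_linear by blast
  have "((\<lambda>x. f (x, y)) has_derivative (\<lambda>t. frechet_derivative f (at (x, y)) (t, 0))) (at x)"
    by (rule has_derivative_compose[of "\<lambda>x. (x, y)" "\<lambda>t. (t, 0)", OF _ assms])
      (auto intro!: derivative_eq_intros)
  moreover have "frechet_derivative f (at (x, y)) (t, 0) = t *\<^sub>R pdx f (x, y)" for t
    using scale[of t "(1, 0)"] by (simp add: pdx_def)
  ultimately show ?thesis
    unfolding has_vector_derivative_def by (auto intro: has_derivative_at_withinI)
qed

lemma has_vector_derivative_pdy:
  assumes "(f has_derivative frechet_derivative f (at (x, y))) (at (x, y))"
  shows "((\<lambda>y. f (x, y)) has_vector_derivative pdy f (x, y)) (at y within S)"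
proof -
  interpret linear "frechet_derivative f (at (x, y))"
    using assms has_derivative_linear by blast
  have "((\<lambda>y. f (x, y)) has_derivative (\<lambda>t. frechet_derivative f (at (x, y)) (0, t))) (at y)"
    by (rule has_derivative_compose[of "\<lambda>y. (x, y)" "\<lambda>t. (0, t)", OF _ assms])
      (auto intro!: derivative_eq_intros)
  moreover have "frechet_derivative f (at (x, y)) (0, t) = t *\<^sub>R pdy f (x, y)" for t
    using scale[of t "(0, 1)"] by (simp add: pdy_def)
  ultimately show ?thesis
    unfolding has_vector_derivative_def by (auto intro: has_derivative_at_withinI)
qed

lemma rect_eq_cbox: "rect h = cbox (0, 0) (h, 1)"
  by (auto simp: rect_def cbox_Pair_eq)

lemma interior_rect: "interior (rect h) = {0<..<h} \<times> {0<..<1}"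
  by (simp add: rect_def interior_Times)

lemma test_fun_smooth: "f \<in> test_fun h \<Longrightarrow> \<forall>k. C_k k f"
  by (simp add: test_fun_def)

lemma test_fun_eq_0:
  assumes "f \<in> test_fun h" "\<not> (0 < x \<and> x < h \<and> 0 < y \<and> y < 1)"
  shows "f (x, y) = 0"
  using assms by (fastforce simp: test_fun_def interior_rect)

lemma test_fun_pd:
  assumes "f \<in> test_fun h"
  shows "pdx f \<in> test_fun h" "pdy f \<in> test_fun h"
proof -
  obtain K where K: "compact K" "K \<subseteq> interior (rect h)" "\<And>p. p \<notin> K \<Longrightarrow> f p = 0"
    using assms by (auto simp: test_fun_def)
  have "frechet_derivative f (at p) = (\<lambda>v. 0)" if "p \<notin> K" for p
  proof -
    have "(f has_derivative (\<lambda>v. 0)) (at p)"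
      by (rule has_derivative_transform_within_open[of "\<lambda>_. 0" _ _ UNIV "- K"])
        (use that K in \<open>auto simp: compact_imp_closed\<close>)
    then show ?thesis by (rule frechet_derivative_at[symmetric])
  qed
  then show "pdx f \<in> test_fun h" "pdy f \<in> test_fun h"
    using smooth_pd[OF test_fun_smooth[OF assms]] K(1,2)
    unfolding test_fun_def pdx_def pdy_def by auto
qed

lemma smooth_section:
  assumes "\<forall>k. C_k k g"
  shows "continuous_on T (\<lambda>s. g (s, y))" "continuous_on T (\<lambda>s. g (x, s))"
  by (rule continuous_on_compose2[OF smooth_continuous_on[OF assms, of UNIV]];
      auto intro!: continuous_intros)+

text \<open>Both sides have the same integral along every horizontal segment, by differentiating the
  fundamental theorem of calculus under the integral sign.\<close>

lemma pdx_pdy_commute: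
  assumes f: "\<forall>k. C_k k f"
  shows "pdx (pdy f) = pdy (pdx f)"
proof
  fix p :: "real \<times> real"
  obtain x0 y0 where p: "p = (x0, y0)" by (cases p)
  have fx: "\<forall>k. C_k k (pdx f)" and fy: "\<forall>k. C_k k (pdy f)"
    and fxy: "\<forall>k. C_k k (pdy (pdx f))" and fyx: "\<forall>k. C_k k (pdx (pdy f))"
    using f by (auto simp: smooth_pd)
  \<comment> \<open>The left end only has to make x0 an interior point of the interval [a, x0 + 1]
    on which derivatives are compared.\<close>
  define a where "a = x0 - 1"
  have ftc: "integral {a..b} (\<lambda>s. pdx g (s, y)) = g (b, y) - g (a, y)"
    if "\<forall>k. C_k k g" "a \<le> b" for g y b
    by (rule integral_unique, rule fundamental_theorem_of_calculus[OF that(2)])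
      (rule has_vector_derivative_pdx[OF smooth_has_derivative[OF that(1)]])
  have eq: "integral {a..b} (\<lambda>s. pdy (pdx f) (s, y0)) = integral {a..b} (\<lambda>s. pdx (pdy f) (s, y0))"
    if "a \<le> b" for b
  proof -
    have "((\<lambda>y. integral (cbox a b) (\<lambda>s. pdx f (s, y))) has_vector_derivative
        integral (cbox a b) (\<lambda>s. pdy (pdx f) (s, y0))) (at y0 within UNIV)"
    proof (rule leibniz_rule_vector_derivative)
      show "((\<lambda>y. pdx f (s, y)) has_vector_derivative pdy (pdx f) (s, y)) (at y within UNIV)" for s y
        by (rule has_vector_derivative_pdy[OF smooth_has_derivative[OF fx]])
      show "(\<lambda>s. pdx f (s, y)) integrable_on cbox a b" for y
        by (rule integrable_continuous[OF smooth_section(1)[OF fx]])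
      show "continuous_on (UNIV \<times> cbox a b) (\<lambda>(y, s). pdy (pdx f) (s, y))"
        unfolding case_prod_beta
        by (rule continuous_on_compose2[OF smooth_continuous_on[OF fxy, of UNIV]])
          (auto intro!: continuous_intros)
    qed auto
    moreover have "(\<lambda>y. integral (cbox a b) (\<lambda>s. pdx f (s, y))) = (\<lambda>y. f (b, y) - f (a, y))"
      using ftc[OF f that] by simp
    moreover have "((\<lambda>y. f (b, y) - f (a, y)) has_vector_derivative pdy f (b, y0) - pdy f (a, y0)) (at y0 within UNIV)"
      by (intro has_vector_derivative_diff has_vector_derivative_pdy smooth_has_derivative f)
    ultimately have "integral (cbox a b) (\<lambda>s. pdy (pdx f) (s, y0)) = pdy f (b, y0) - pdy f (a, y0)"
      using vector_derivative_unique_at by (metis (no_types, lifting))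
    then show ?thesis using ftc[OF fy that] by simp
  qed
  let ?D = "\<lambda>s. pdx (pdy f) (s, y0) - pdy (pdx f) (s, y0)"
  have cD: "continuous_on T ?D" for T by (intro continuous_intros smooth_section fxy fyx)
  have "((\<lambda>u. integral {a..u} ?D) has_vector_derivative ?D x0) (at x0 within {a..x0+1})"
    by (rule integral_has_vector_derivative[OF cD]) (auto simp: a_def)
  moreover have "((\<lambda>u. integral {a..u} ?D) has_vector_derivative 0) (at x0 within {a..x0+1})"
  proof (rule has_vector_derivative_transform[OF _ _ has_vector_derivative_const])
    show "integral {a..u} ?D = 0" if "u \<in> {a..x0+1}" for u
      using eq[of u] that
      by (subst integral_diff) (auto intro!: integrable_continuous_real smooth_section fxy fyx)
  qed (auto simp: a_def)
  ultimately have "?D x0 = 0"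
    by (rule vector_derivative_unique_within[rotated]) (auto simp: a_def trivial_limit_within islimpt_Icc)
  then show "pdx (pdy f) p = pdy (pdx f) p" by (simp add: p)
qed

section \<open>Integration over the rectangle\<close>

lemma continuous_integrable_rect:
  fixes F :: "real \<times> real \<Rightarrow> 'a::euclidean_space"
  assumes "continuous_on UNIV F"
  shows "integrable (lebesgue_on (rect h)) F"
  unfolding rect_eq_cbox using assms continuous_on_subset by (blast intro: continuous_imp_integrable)

lemma integral_rect_iterated:
  fixes F :: "real \<times> real \<Rightarrow> 'a::euclidean_space"
  assumes "continuous_on UNIV F"
  shows "integral\<^sup>L (lebesgue_on (rect h)) F = integral {0..h} (\<lambda>x. integral {0..1} (\<lambda>y. F (x, y)))"
    and "integral\<^sup>L (lebesgue_on (rect h)) F = integral {0..1} (\<lambda>y. integral {0..h} (\<lambda>x. F (x, y)))"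
proof -
  have c: "continuous_on T F" for T using assms continuous_on_subset by blast
  have "integral\<^sup>L (lebesgue_on (rect h)) F = integral (rect h) F"
    by (rule lebesgue_integral_eq_integral[OF continuous_integrable_rect[OF assms]])
      (simp add: rect_eq_cbox)
  also have "\<dots> = integral {0..h} (\<lambda>x. integral {0..1} (\<lambda>y. F (x, y)))"
    unfolding rect_eq_cbox using integral_prod_continuous[OF c] by simp
  finally show 1: "integral\<^sup>L (lebesgue_on (rect h)) F = integral {0..h} (\<lambda>x. integral {0..1} (\<lambda>y. F (x, y)))" .
  show "integral\<^sup>L (lebesgue_on (rect h)) F = integral {0..1} (\<lambda>y. integral {0..h} (\<lambda>x. F (x, y)))"
    unfolding 1 using integral_swap_continuous[of 0 0 h 1 "\<lambda>x y. F (x, y)"] c by simp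
qed

text \<open>A general bilinear map covers two uses: the real inner product on the complex numbers
  for the energy identity, and complex multiplication for weak derivatives. The boundary terms
  vanish through the factor f alone.\<close>

lemma integral_rect_by_parts:
  fixes B :: "complex \<Rightarrow> complex \<Rightarrow> 'a::euclidean_space"
  assumes "bounded_bilinear B"
    and f: "f \<in> test_fun h" and g: "\<forall>k. C_k k g" and "h \<ge> 0"
  shows "(\<integral>p. B (f p) (pdx g p) \<partial>lebesgue_on (rect h)) =
      - (\<integral>p. B (pdx f p) (g p) \<partial>lebesgue_on (rect h))"
    and "(\<integral>p. B (f p) (pdy g p) \<partial>lebesgue_on (rect h)) =
      - (\<integral>p. B (pdy f p) (g p) \<partial>lebesgue_on (rect h))"
proof -
  interpret bounded_bilinear B by fact
  note fs = test_fun_smooth[OF f]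
  note c = smooth_continuous_on[OF fs] smooth_continuous_on[OF g]
    smooth_continuous_on[OF smooth_pd(1)[OF fs]] smooth_continuous_on[OF smooth_pd(1)[OF g]]
    smooth_continuous_on[OF smooth_pd(2)[OF fs]] smooth_continuous_on[OF smooth_pd(2)[OF g]]
  have "(\<integral>p. B (f p) (pdx g p) + B (pdx f p) (g p) \<partial>lebesgue_on (rect h)) = 0"
  proof (subst integral_rect_iterated(2))
    show "continuous_on UNIV (\<lambda>p. B (f p) (pdx g p) + B (pdx f p) (g p))"
      by (intro continuous_intros continuous_on c)
    have "((\<lambda>x. B (f (x, y)) (pdx g (x, y)) + B (pdx f (x, y)) (g (x, y))) has_integral
        B (f (h, y)) (g (h, y)) - B (f (0, y)) (g (0, y))) {0..h}" for y
      by (rule fundamental_theorem_of_calculus[OF \<open>h \<ge> 0\<close>])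
        (intro has_vector_derivative has_vector_derivative_pdx smooth_has_derivative fs g)
    then have "integral {0..h} (\<lambda>x. B (f (x, y)) (pdx g (x, y)) + B (pdx f (x, y)) (g (x, y))) = 0" for y
      using test_fun_eq_0[OF f] by (simp add: integral_unique zero_left)
    then show "integral {0..1} (\<lambda>y. integral {0..h} (\<lambda>x. B (f (x, y)) (pdx g (x, y)) + B (pdx f (x, y)) (g (x, y)))) = 0"
      by simp
  qed
  then show "(\<integral>p. B (f p) (pdx g p) \<partial>lebesgue_on (rect h)) =
      - (\<integral>p. B (pdx f p) (g p) \<partial>lebesgue_on (rect h))"
    by (subst (asm) Bochner_Integration.integral_add)
      (auto intro!: continuous_integrable_rect continuous_on c simp: eq_neg_iff_add_eq_0)
  have "(\<integral>p. B (f p) (pdy g p) + B (pdy f p) (g p) \<partial>lebesgue_on (rect h)) = 0"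
  proof (subst integral_rect_iterated(1))
    show "continuous_on UNIV (\<lambda>p. B (f p) (pdy g p) + B (pdy f p) (g p))"
      by (intro continuous_intros continuous_on c)
    have "((\<lambda>y. B (f (x, y)) (pdy g (x, y)) + B (pdy f (x, y)) (g (x, y))) has_integral
        B (f (x, 1)) (g (x, 1)) - B (f (x, 0)) (g (x, 0))) {0..1}" for x
      by (rule fundamental_theorem_of_calculus)
        (simp, intro has_vector_derivative has_vector_derivative_pdy smooth_has_derivative fs g)
    then have "integral {0..1} (\<lambda>y. B (f (x, y)) (pdy g (x, y)) + B (pdy f (x, y)) (g (x, y))) = 0" for x
      using test_fun_eq_0[OF f] by (simp add: integral_unique zero_left)
    then show "integral {0..h} (\<lambda>x. integral {0..1} (\<lambda>y. B (f (x, y)) (pdy g (x, y)) + B (pdy f (x, y)) (g (x, y)))) = 0"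
      by simp
  qed
  then show "(\<integral>p. B (f p) (pdy g p) \<partial>lebesgue_on (rect h)) =
      - (\<integral>p. B (pdy f p) (g p) \<partial>lebesgue_on (rect h))"
    by (subst (asm) Bochner_Integration.integral_add)
      (auto intro!: continuous_integrable_rect continuous_on c simp: eq_neg_iff_add_eq_0)
qed

lemma integral_laplacian_square:
  assumes f: "f \<in> test_fun h" and "h \<ge> 0"
  shows "(\<integral>p. (cmod (pdx (pdx f) p + pdy (pdy f) p))\<^sup>2 \<partial>lebesgue_on (rect h)) =
    (\<integral>p. (cmod (pdx (pdx f) p))\<^sup>2 \<partial>lebesgue_on (rect h))
    + 2 * (\<integral>p. (cmod (pdx (pdy f) p))\<^sup>2 \<partial>lebesgue_on (rect h))
    + (\<integral>p. (cmod (pdy (pdy f) p))\<^sup>2 \<partial>lebesgue_on (rect h))"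
proof -
  note fs = test_fun_smooth[OF f]
  note tx = test_fun_pd(1)[OF f] and ty = test_fun_pd(2)[OF f]
  have c: "continuous_on UNIV (pdx (pdx f))" "continuous_on UNIV (pdx (pdy f))" "continuous_on UNIV (pdy (pdy f))"
    using fs by (auto intro!: smooth_continuous_on smooth_pd)
  \<comment> \<open>The inner product of complex numbers a and b is Re (a conj b), so the expansion
    of the squared Laplacian contains exactly twice this term. One x-derivative and one y-derivative
    change sides, and the two signs cancel.\<close>
  have "(\<integral>p. pdx (pdx f) p \<bullet> pdy (pdy f) p \<partial>lebesgue_on (rect h))
      = - (\<integral>p. pdx f p \<bullet> pdx (pdy (pdy f)) p \<partial>lebesgue_on (rect h))"
    using integral_rect_by_parts(1)[OF bounded_bilinear_inner tx _ \<open>h \<ge> 0\<close>, of "pdy (pdy f)"] fs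
    by (simp add: smooth_pd)
  also have "pdx (pdy (pdy f)) = pdy (pdx (pdy f))"
    by (rule pdx_pdy_commute) (use fs smooth_pd in blast)
  also have "- (\<integral>p. pdx f p \<bullet> pdy (pdx (pdy f)) p \<partial>lebesgue_on (rect h))
      = (\<integral>p. pdy (pdx f) p \<bullet> pdx (pdy f) p \<partial>lebesgue_on (rect h))"
    using integral_rect_by_parts(2)[OF bounded_bilinear_inner tx _ \<open>h \<ge> 0\<close>, of "pdx (pdy f)"] fs
    by (simp add: smooth_pd)
  also have "pdy (pdx f) = pdx (pdy f)"
    using pdx_pdy_commute[OF fs] by simp
  finally have mixed: "(\<integral>p. pdx (pdx f) p \<bullet> pdy (pdy f) p \<partial>lebesgue_on (rect h))
      = (\<integral>p. (cmod (pdx (pdy f) p))\<^sup>2 \<partial>lebesgue_on (rect h))"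
    by (simp add: power2_norm_eq_inner)
  have "(\<integral>p. (cmod (pdx (pdx f) p + pdy (pdy f) p))\<^sup>2 \<partial>lebesgue_on (rect h)) =
    (\<integral>p. (cmod (pdx (pdx f) p))\<^sup>2 + 2 * (pdx (pdx f) p \<bullet> pdy (pdy f) p) + (cmod (pdy (pdy f) p))\<^sup>2
      \<partial>lebesgue_on (rect h))"
    by (intro Bochner_Integration.integral_cong refl)
      (simp add: power2_norm_eq_inner inner_add_left inner_add_right inner_commute)
  also have "\<dots> = (\<integral>p. (cmod (pdx (pdx f) p))\<^sup>2 \<partial>lebesgue_on (rect h))
    + 2 * (\<integral>p. pdx (pdx f) p \<bullet> pdy (pdy f) p \<partial>lebesgue_on (rect h))
    + (\<integral>p. (cmod (pdy (pdy f) p))\<^sup>2 \<partial>lebesgue_on (rect h))"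
    by (subst Bochner_Integration.integral_add Bochner_Integration.integral_mult_right_zero
        | intro continuous_integrable_rect continuous_intros c refl)+
  finally show ?thesis unfolding mixed .
qed

section \<open>One-dimensional inequalities carried over to the rectangle\<close>

lemma integral_cmod_square:
  fixes f :: "real \<Rightarrow> complex"
  assumes "continuous_on {a..b} f"
  shows "integral {a..b} (\<lambda>x. (cmod (f x))\<^sup>2) =
    integral {a..b} (\<lambda>x. (Re (f x))\<^sup>2) + integral {a..b} (\<lambda>x. (Im (f x))\<^sup>2)"
  unfolding cmod_power2
  by (rule integral_add) (intro integrable_continuous_real continuous_intros assms)+

lemma integrable_section_integral:
  fixes F :: "real \<times> real \<Rightarrow> real"
  assumes "continuous_on UNIV F"
  shows "(\<lambda>x. integral {0..1} (\<lambda>y. F (x, y))) integrable_on {0..h}"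
    "(\<lambda>y. integral {0..h} (\<lambda>x. F (x, y))) integrable_on {0..1}"
proof -
  show "(\<lambda>x. integral {0..1} (\<lambda>y. F (x, y))) integrable_on {0..h}"
    using integral_integrable_2dim[of 0 0 h 1 F] continuous_on_subset[OF assms] by simp
  have "continuous_on UNIV (\<lambda>(y, x). F (x, y))"
    unfolding case_prod_beta
    by (rule continuous_on_compose2[OF assms]) (auto intro!: continuous_intros)
  then show "(\<lambda>y. integral {0..h} (\<lambda>x. F (x, y))) integrable_on {0..1}"
    using integral_integrable_2dim[of 0 0 1 h "\<lambda>(y, x). F (x, y)"] continuous_on_subset by fastforce
qed

lemma Re_Im_has_real_derivative:
  assumes "(f has_vector_derivative f') (at x)"
  shows "((\<lambda>x. Re (f x)) has_real_derivative Re f') (at x)"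
    "((\<lambda>x. Im (f x)) has_real_derivative Im f') (at x)"
  using bounded_linear.has_vector_derivative[OF bounded_linear_Re assms]
    bounded_linear.has_vector_derivative[OF bounded_linear_Im assms]
  by (auto simp: has_real_derivative_iff_has_vector_derivative)

lemma poincare_rect:
  assumes f: "f \<in> test_fun h" and "h > 0"
  shows "(pi / h)\<^sup>2 * (\<integral>p. (cmod (f p))\<^sup>2 \<partial>lebesgue_on (rect h))
    \<le> (\<integral>p. (cmod (pdx f p))\<^sup>2 \<partial>lebesgue_on (rect h))"
proof -
  note fs = test_fun_smooth[OF f]
  note fx = smooth_pd(1)[OF fs]
  have c: "continuous_on UNIV (\<lambda>p. (cmod (f p))\<^sup>2)" "continuous_on UNIV (\<lambda>p. (cmod (pdx f p))\<^sup>2)"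
    by (intro continuous_intros smooth_continuous_on fs fx)+
  have "(pi / h)\<^sup>2 * integral {0..h} (\<lambda>x. (cmod (f (x, y)))\<^sup>2) \<le> integral {0..h} (\<lambda>x. (cmod (pdx f (x, y)))\<^sup>2)" for y
  proof -
    note d = Re_Im_has_real_derivative[OF has_vector_derivative_pdx[OF smooth_has_derivative[OF fs]]]
    have "(pi / h)\<^sup>2 * integral {0..h} (\<lambda>x. (Re (f (x, y)))\<^sup>2) \<le> integral {0..h} (\<lambda>x. (Re (pdx f (x, y)))\<^sup>2)"
      by (rule poincare_dirichlet[OF \<open>h > 0\<close> d(1)])
        (auto intro!: continuous_intros smooth_section fx simp: test_fun_eq_0[OF f])
    moreover have "(pi / h)\<^sup>2 * integral {0..h} (\<lambda>x. (Im (f (x, y)))\<^sup>2) \<le> integral {0..h} (\<lambda>x. (Im (pdx f (x, y)))\<^sup>2)"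
      by (rule poincare_dirichlet[OF \<open>h > 0\<close> d(2)])
        (auto intro!: continuous_intros smooth_section fx simp: test_fun_eq_0[OF f])
    ultimately show ?thesis
      unfolding integral_cmod_square[OF smooth_section(1)[OF fs]] integral_cmod_square[OF smooth_section(1)[OF fx]]
      by (simp add: distrib_left)
  qed
  then have "integral {0..1} (\<lambda>y. (pi / h)\<^sup>2 * integral {0..h} (\<lambda>x. (cmod (f (x, y)))\<^sup>2))
      \<le> integral {0..1} (\<lambda>y. integral {0..h} (\<lambda>x. (cmod (pdx f (x, y)))\<^sup>2))"
    by (intro integral_le integrable_on_mult_right integrable_section_integral[OF c(1)] integrable_section_integral[OF c(2)])
  then show ?thesis
    unfolding integral_rect_iterated(2)[OF c(1)] integral_rect_iterated(2)[OF c(2)] by simp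
qed

text \<open>On each vertical line the real and the imaginary part of f are clamped profiles, since f
  and \<open>pdy f\<close> are both test functions. The beam estimate is applied to the two parts
  and integrated over x.\<close>

lemma strip_lower_bound:
  assumes f: "f \<in> test_fun h" and "h > 0" and t: "0 \<le> t" "t \<le> 1"
  shows "(c_beam ^ 4 + 2 * t * (d_beam * c_beam\<^sup>2) - 4 * c_beam ^ 4 * t\<^sup>2) *
      (\<integral>p. (cmod (f p))\<^sup>2 \<partial>lebesgue_on (rect h))
    \<le> (\<integral>p. (cmod (pdy (pdy f) p))\<^sup>2 \<partial>lebesgue_on (rect h))
      + 2 * t * (\<integral>p. (cmod (pdy f p))\<^sup>2 \<partial>lebesgue_on (rect h))"
proof -
  define L where "L = c_beam ^ 4 + 2 * t * (d_beam * c_beam\<^sup>2) - 4 * c_beam ^ 4 * t\<^sup>2"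
  note fs = test_fun_smooth[OF f]
  note fy = smooth_pd(2)[OF fs]
  note fyy = smooth_pd(2)[OF fy]
  have c: "continuous_on UNIV (\<lambda>p. (cmod (f p))\<^sup>2)" "continuous_on UNIV (\<lambda>p. (cmod (pdy f p))\<^sup>2)"
    "continuous_on UNIV (\<lambda>p. (cmod (pdy (pdy f) p))\<^sup>2)"
    by (intro continuous_intros smooth_continuous_on fs fy fyy)+
  have "L * integral {0..1} (\<lambda>y. (cmod (f (x, y)))\<^sup>2) \<le> integral {0..1} (\<lambda>y. (cmod (pdy (pdy f) (x, y)))\<^sup>2)
      + 2 * t * integral {0..1} (\<lambda>y. (cmod (pdy f (x, y)))\<^sup>2)" for x
  proof -
    note d = Re_Im_has_real_derivative[OF has_vector_derivative_pdy[OF smooth_has_derivative[OF fs]]]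
      and d2 = Re_Im_has_real_derivative[OF has_vector_derivative_pdy[OF smooth_has_derivative[OF fy]]]
    have "L * integral {0..1} (\<lambda>y. (Re (f (x, y)))\<^sup>2) \<le> integral {0..1} (\<lambda>y. (Re (pdy (pdy f) (x, y)))\<^sup>2)
        + 2 * t * integral {0..1} (\<lambda>y. (Re (pdy f (x, y)))\<^sup>2)"
      unfolding L_def
      by (rule clamped_beam_lower_bound[OF d(1) d2(1) _ _ _ _ _ t])
        (auto intro!: continuous_intros smooth_section fyy simp: test_fun_eq_0[OF f] test_fun_eq_0[OF test_fun_pd(2)[OF f]])
    moreover have "L * integral {0..1} (\<lambda>y. (Im (f (x, y)))\<^sup>2) \<le> integral {0..1} (\<lambda>y. (Im (pdy (pdy f) (x, y)))\<^sup>2)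
        + 2 * t * integral {0..1} (\<lambda>y. (Im (pdy f (x, y)))\<^sup>2)"
      unfolding L_def
      by (rule clamped_beam_lower_bound[OF d(2) d2(2) _ _ _ _ _ t])
        (auto intro!: continuous_intros smooth_section fyy simp: test_fun_eq_0[OF f] test_fun_eq_0[OF test_fun_pd(2)[OF f]])
    ultimately show ?thesis
      unfolding integral_cmod_square[OF smooth_section(2)[OF fs]] integral_cmod_square[OF smooth_section(2)[OF fy]]
        integral_cmod_square[OF smooth_section(2)[OF fyy]]
      by (simp add: distrib_left)
  qed
  then have "integral {0..h} (\<lambda>x. L * integral {0..1} (\<lambda>y. (cmod (f (x, y)))\<^sup>2))
      \<le> integral {0..h} (\<lambda>x. integral {0..1} (\<lambda>y. (cmod (pdy (pdy f) (x, y)))\<^sup>2)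
      + 2 * t * integral {0..1} (\<lambda>y. (cmod (pdy f (x, y)))\<^sup>2))"
    by (intro integral_le integrable_on_mult_right integrable_add integrable_section_integral c)
  also have "\<dots> = integral {0..h} (\<lambda>x. integral {0..1} (\<lambda>y. (cmod (pdy (pdy f) (x, y)))\<^sup>2))
      + 2 * t * integral {0..h} (\<lambda>x. integral {0..1} (\<lambda>y. (cmod (pdy f (x, y)))\<^sup>2))"
    by (subst integral_add) (auto intro!: integrable_on_mult_right integrable_section_integral c)
  finally show ?thesis
    unfolding integral_rect_iterated(1)[OF c(1)] integral_rect_iterated(1)[OF c(2)]
      integral_rect_iterated(1)[OF c(3)] L_def[symmetric] by simp
qed

lemma test_fun_lower_bound:
  assumes f: "f \<in> test_fun h" and "h \<ge> pi"
  shows "(c_beam ^ 4 + 2 * d_beam * c_beam\<^sup>2 * (pi / h)\<^sup>2 - 4 * c_beam ^ 4 * (pi / h) ^ 4) *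
      (\<integral>p. (cmod (f p))\<^sup>2 \<partial>lebesgue_on (rect h))
    \<le> (\<integral>p. (cmod (pdx (pdx f) p + pdy (pdy f) p))\<^sup>2 \<partial>lebesgue_on (rect h))"
proof -
  have h: "h > 0" using assms(2) pi_gt_zero by linarith
  let ?I = "\<lambda>F. \<integral>p. (cmod (F p))\<^sup>2 \<partial>lebesgue_on (rect h)"
  \<comment> \<open>The hypothesis on h serves to make t = (pi/h)^2 admissible in the beam
    estimate.\<close>
  have "pi / h \<le> 1" using assms(2) h by simp
  then have t: "(pi / h)\<^sup>2 \<le> 1" using h by (intro power_le_one) auto
  have "(c_beam ^ 4 + 2 * (pi / h)\<^sup>2 * (d_beam * c_beam\<^sup>2) - 4 * c_beam ^ 4 * ((pi / h)\<^sup>2)\<^sup>2) * ?I f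
      \<le> ?I (pdy (pdy f)) + 2 * (pi / h)\<^sup>2 * ?I (pdy f)"
    by (rule strip_lower_bound[OF f h _ t]) simp
  also have "\<dots> \<le> ?I (pdy (pdy f)) + 2 * ?I (pdx (pdy f))"
    using poincare_rect[OF test_fun_pd(2)[OF f] h] by simp
  also have "\<dots> \<le> ?I (pdx (pdx f)) + 2 * ?I (pdx (pdy f)) + ?I (pdy (pdy f))"
    by simp
  also have "\<dots> = ?I (\<lambda>p. pdx (pdx f) p + pdy (pdy f) p)"
    using integral_laplacian_square[OF f] h by simp
  finally show ?thesis by (simp add: mult.assoc mult.commute mult.left_commute flip: power_mult)
qed

section \<open>Smooth cutoff functions\<close>

text \<open>Asking for some derivative, rather than fixing \<open>deriv\<close>, lets every closure
  property be proved by induction with an explicit witness.\<close>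

fun C_k1 :: "nat \<Rightarrow> (real \<Rightarrow> real) \<Rightarrow> bool" where
  "C_k1 0 f = continuous_on UNIV f"
| "C_k1 (Suc k) f = (\<exists>f'. (\<forall>x. (f has_real_derivative f' x) (at x)) \<and> C_k1 k f')"

lemma C_k1_Suc_imp: "C_k1 (Suc k) f \<Longrightarrow> C_k1 k f"
proof (induction k arbitrary: f)
  case 0
  then show ?case using continuous_on_if_DERIV by auto
next
  case (Suc k)
  then show ?case by (metis C_k1.simps(2))
qed

lemma C_k1_const: "C_k1 k (\<lambda>x. c)"
proof (induction k arbitrary: c)
  case (Suc k)
  then show ?case by (auto intro!: exI[of _ "\<lambda>_. 0"])
qed auto

lemma C_k1_add: "C_k1 k f \<Longrightarrow> C_k1 k g \<Longrightarrow> C_k1 k (\<lambda>x. f x + g x)"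
proof (induction k arbitrary: f g)
  case 0
  then show ?case by (auto intro!: continuous_intros)
next
  case (Suc k)
  then obtain f' g' where "\<forall>x. (f has_real_derivative f' x) (at x)" "C_k1 k f'"
    "\<forall>x. (g has_real_derivative g' x) (at x)" "C_k1 k g'" by auto
  then show ?case using Suc.IH[of f' g']
    by (auto intro!: exI[of _ "\<lambda>x. f' x + g' x"] DERIV_add)
qed

lemma C_k1_mult: "C_k1 k f \<Longrightarrow> C_k1 k g \<Longrightarrow> C_k1 k (\<lambda>x. f x * g x)"
proof (induction k arbitrary: f g)
  case 0
  then show ?case by (auto intro!: continuous_intros)
next
  case (Suc k)
  then obtain f' g' where d: "\<forall>x. (f has_real_derivative f' x) (at x)" "C_k1 k f'"
    "\<forall>x. (g has_real_derivative g' x) (at x)" "C_k1 k g'" by auto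
  have "C_k1 k (\<lambda>x. f' x * g x + f x * g' x)"
    by (intro C_k1_add Suc.IH d Suc.prems[THEN C_k1_Suc_imp])
  moreover have "\<forall>x. ((\<lambda>x. f x * g x) has_real_derivative f' x * g x + f x * g' x) (at x)"
    using d by (auto intro!: derivative_eq_intros)
  ultimately show ?case by auto
qed

lemma C_k1_affine: "C_k1 k f \<Longrightarrow> C_k1 k (\<lambda>x. f (a * x + b))"
proof (induction k arbitrary: f)
  case 0
  then have "continuous_on UNIV f" by simp
  then show ?case using continuous_on_compose2[of UNIV f UNIV "\<lambda>x. a * x + b"]
    by (simp add: continuous_on_add continuous_on_mult_left)
next
  case (Suc k)
  then obtain f' where d: "\<forall>x. (f has_real_derivative f' x) (at x)" "C_k1 k f'" by auto
  have "((\<lambda>x. f (a * x + b)) has_real_derivative f' (a * x + b) * a) (at x)" for x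
    by (rule DERIV_chain'[of "\<lambda>x. a * x + b"]) (use d in \<open>auto intro!: derivative_eq_intros\<close>)
  moreover have "C_k1 k (\<lambda>x. f' (a * x + b) * a)"
    by (intro C_k1_mult C_k1_const Suc.IH d)
  ultimately show ?case
    unfolding C_k1.simps by (intro exI[of _ "\<lambda>x. f' (a * x + b) * a"] conjI allI)
qed

lemma C_k1_sin_cos: "C_k1 k (sin :: real \<Rightarrow> real)" "C_k1 k (cos :: real \<Rightarrow> real)"
proof (induction k)
  case 0
  { case 1 show ?case by (simp add: continuous_on_sin continuous_on_id) }
  { case 2 show ?case by (simp add: continuous_on_cos continuous_on_id) }
next
  case (Suc k)
  { case 1 show ?case using Suc by (auto intro!: exI[of _ cos] DERIV_sin) }
  { case 2
    have "C_k1 k (\<lambda>x. (- 1) * sin x :: real)" by (intro C_k1_mult C_k1_const Suc)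
    then show ?case by (auto intro!: exI[of _ "\<lambda>x. - sin x"] DERIV_cos) }
qed

lemma C_k1_exp: "C_k1 k (exp :: real \<Rightarrow> real)"
proof (induction k)
  case (Suc k)
  then show ?case by (auto intro!: exI[of _ exp] DERIV_exp)
qed (auto intro: continuous_intros)

text \<open>The family of functions p(1/x) exp(-1/x), extended by 0, is closed under
  differentiation: p turns into X^2 (p - p'). Smoothness of all members then follows by one
  induction in which p varies.\<close>

definition flat :: "real poly \<Rightarrow> real \<Rightarrow> real" where
  "flat p x = (if 0 < x then poly p (1 / x) * exp (- (1 / x)) else 0)"

lemma poly_exp_tendsto_0: "((\<lambda>t. poly p t * exp (- t)) \<longlongrightarrow> (0::real)) at_top"
proof -
  have "((\<lambda>t. \<Sum>i\<le>degree p. coeff p i * (t ^ i / exp t)) \<longlongrightarrow> (\<Sum>i\<le>degree p. coeff p i * 0)) at_top"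
    by (intro tendsto_intros tendsto_power_div_exp_0)
  then show ?thesis
    by (simp add: poly_altdef sum_distrib_right exp_minus field_simps sum_divide_distrib)
qed

lemma flat_has_derivative:
  "(flat p has_real_derivative flat (monom 1 2 * (p - pderiv p)) x) (at x)"
proof -
  consider "x < 0" | "x = 0" | "x > 0" by linarith
  then show ?thesis
  proof cases
    case 1
    have "((\<lambda>_. 0) has_real_derivative 0) (at x)" by simp
    then have "(flat p has_real_derivative 0) (at x)"
      by (rule has_field_derivative_transform_within_open[of _ _ _ "{..<0}"])
        (use 1 in \<open>auto simp: flat_def\<close>)
    then show ?thesis using 1 by (simp add: flat_def)
  next
    case 3
    have "((\<lambda>x. poly p (1 / x) * exp (- (1 / x))) has_real_derivative
        flat (monom 1 2 * (p - pderiv p)) x) (at x)"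
      using 3 by (auto intro!: derivative_eq_intros simp: flat_def poly_monom field_simps power2_eq_square)
    then show ?thesis
      by (rule has_field_derivative_transform_within_open[of _ _ _ "{0<..}"])
        (use 3 in \<open>auto simp: flat_def\<close>)
  next
    case 2
    \<comment> \<open>From the right the difference quotient at 0 is (1/y) p(1/y) exp(-1/y), again
      of the same form with the polynomial X p.\<close>
    have "((\<lambda>y. poly (monom 1 1 * p) (inverse y) * exp (- inverse y)) \<longlongrightarrow> 0) (at_right (0::real))"
      by (rule filterlim_compose[OF poly_exp_tendsto_0 filterlim_inverse_at_top_right])
    then have "((\<lambda>y. (flat p y - flat p 0) / (y - 0)) \<longlongrightarrow> 0) (at_right 0)"
      by (rule Lim_transform_eventually)
        (auto simp: eventually_at_filter flat_def poly_monom field_simps)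
    moreover have "((\<lambda>y. (flat p y - flat p 0) / (y - 0)) \<longlongrightarrow> 0) (at_left 0)"
      by (rule Lim_transform_eventually[of "\<lambda>_. 0"])
        (auto simp: eventually_at_filter flat_def)
    ultimately have "((\<lambda>y. (flat p y - flat p 0) / (y - 0)) \<longlongrightarrow> 0) (at 0)"
      by (simp add: filterlim_split_at)
    then show ?thesis unfolding 2 has_field_derivative_iff by (simp add: flat_def)
  qed
qed

lemma C_k1_flat: "C_k1 k (flat p)"
proof (induction k arbitrary: p)
  case 0
  then show ?case using continuous_on_if_DERIV[OF flat_has_derivative] by simp
next
  case (Suc k)
  then show ?case using flat_has_derivative by (auto intro!: exI[of _ "flat (monom 1 2 * (p - pderiv p))"])
qed

text \<open>The transition sits in [1, 2] and not at 0: after scaling by N the step vanishes up to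
  distance 1/N from an end, which gives compact support in the open interval, and is inactive beyond
  2/N. The bound M >= 1 allows powers of M to be compared.\<close>

locale smooth_step =
  fixes s s1 s2 :: "real \<Rightarrow> real" and M :: real
  assumes sk: "\<And>k. C_k1 k s"
    and ds: "\<And>x. (s has_real_derivative s1 x) (at x)" and ds1: "\<And>x. (s1 has_real_derivative s2 x) (at x)"
    and cs2: "continuous_on UNIV s2"
    and s0: "\<And>x. x \<le> 1 \<Longrightarrow> s x = 0" and s1: "\<And>x. x \<ge> 2 \<Longrightarrow> s x = 1"
    and sn: "\<And>x. 0 \<le> s x" and sl: "\<And>x. s x \<le> 1"
    and s1z: "\<And>x. x \<notin> {1..2} \<Longrightarrow> s1 x = 0" and s2z: "\<And>x. x \<notin> {1..2} \<Longrightarrow> s2 x = 0"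
    and s1M: "\<And>x. \<bar>s1 x\<bar> \<le> M" and s2M: "\<And>x. \<bar>s2 x\<bar> \<le> M" and M: "M \<ge> 1"

lemma smooth_step_exists: "\<exists>s s1 s2 M. smooth_step s s1 s2 M"
proof -
  \<comment> \<open>A smooth bump positive exactly on (1, 2); the step is its normalised
    antiderivative.\<close>
  define b where "b = (\<lambda>x. flat 1 (1 * x + (- 1)) * flat 1 (- 1 * x + 2))"
  have bk: "C_k1 k b" for k
    unfolding b_def by (intro C_k1_mult C_k1_affine C_k1_flat)
  have cb: "continuous_on S b" for S using bk[of 0] continuous_on_subset by auto
  have b0: "b x = 0" if "x \<notin> {1<..<2}" for x using that by (auto simp: b_def flat_def)
  have bn: "0 \<le> b x" for x by (simp add: b_def flat_def)
  have bp: "0 < b x" if "x \<in> {1<..<2}" for x using that by (auto simp: b_def flat_def)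
  have ib: "b integrable_on {u..v}" for u v by (intro integrable_continuous_real cb)
  define N where "N = integral {0..2} b"
  have "integral {0..1} b + integral {1..2} b = N"
    unfolding N_def using ib by (intro Henstock_Kurzweil_Integration.integral_combine) auto
  moreover have "0 \<le> integral {0..1} b" using ib bn by (intro integral_nonneg) auto
  moreover have "integral {1..2::real} (\<lambda>_. 0) < integral {1..2} b"
    using bp cb by (intro integral_less_real) auto
  ultimately have N: "N > 0" by simp
  define s where "s = (\<lambda>x. integral {0..x} b / N)"
  define s1 where "s1 = (\<lambda>x. b x / N)"
  have s0: "s x = 0" if "x \<le> 1" for x
  proof -
    have "integral {0..x} b = integral {0..x} (\<lambda>_. 0)"
      using that b0 by (intro Henstock_Kurzweil_Integration.integral_cong) auto
    then show ?thesis by (simp add: s_def)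
  qed
  have ge: "s x = s u + integral {u..x} b / N" if "0 \<le> u" "u \<le> x" for u x
    using Henstock_Kurzweil_Integration.integral_combine[of 0 u x b] that ib
    by (simp add: s_def add_divide_distrib[symmetric])
  have s2: "s x = 1" if "x \<ge> 2" for x
  proof -
    have "integral {2..x} b = integral {2..x} (\<lambda>_. 0)"
      using that b0 by (intro Henstock_Kurzweil_Integration.integral_cong) auto
    then show ?thesis using ge[of 2 x] that N by (simp add: s_def N_def)
  qed
  have sn: "0 \<le> s x" for x
    unfolding s_def using N bn ib by (intro divide_nonneg_pos integral_nonneg) auto
  have sl: "s x \<le> 1" for x
  proof (cases "x \<le> 2")
    case True
    have "s x \<le> s 2"
    proof (cases "0 \<le> x")
      case True
      then have "0 \<le> integral {x..2} b / N" using N bn ib by (intro divide_nonneg_pos integral_nonneg) auto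
      then show ?thesis using ge[of x 2] True \<open>x \<le> 2\<close> by simp
    next
      case False
      then show ?thesis using s0[of x] sn[of 2] by simp
    qed
    then show ?thesis using s2[of 2] by simp
  qed (use s2 in simp)
  have ds: "(s has_real_derivative s1 x) (at x)" for x
  \<comment> \<open>For x < 0 the integral runs over an empty interval, and at 0 its derivative
    would be one-sided. Below 1 the step is locally constant, which settles both.\<close>
  proof (cases "x < 1")
    case True
    have "((\<lambda>_. 0) has_real_derivative 0) (at x)" by simp
    then have "(s has_real_derivative 0) (at x)"
      by (rule has_field_derivative_transform_within_open[of _ _ _ "{..<1}"]) (use True s0 in auto)
    then show ?thesis using b0[of x] True by (simp add: s1_def)
  next
    case False
    have "((\<lambda>u. integral {0..u} b) has_real_derivative b x) (at x within {0..x+1})"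
      by (rule integral_has_real_derivative[OF cb]) (use False in auto)
    then have "((\<lambda>u. integral {0..u} b) has_real_derivative b x) (at x)"
      using False by (simp add: at_within_Icc_at)
    then show ?thesis unfolding s_def s1_def by (rule DERIV_cdivide)
  qed
  obtain b' where b': "\<And>x. (b has_real_derivative b' x) (at x)" "C_k1 0 b'"
    using bk[of 1] by auto
  define s2' where "s2' = (\<lambda>x. b' x / N)"
  have ds1: "(s1 has_real_derivative s2' x) (at x)" for x
    unfolding s1_def s2'_def by (rule DERIV_cdivide[OF b'(1)])
  have cs2: "continuous_on S s2'" for S
    unfolding s2'_def using b'(2) N continuous_on_subset by (auto intro!: continuous_intros)
  have s1k: "C_k1 k s1" for k
    using C_k1_mult[OF bk C_k1_const[of k "1 / N"]] by (simp add: s1_def)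
  have sk: "C_k1 k s" for k
    by (rule C_k1_Suc_imp) (use ds s1k in auto)
  have s1z: "s1 x = 0" if "x \<notin> {1..2}" for x using b0[of x] that by (auto simp: s1_def)
  have s2z: "s2' x = 0" if "x \<notin> {1..2}" for x
  proof -
    have "((\<lambda>_. 0) has_real_derivative 0) (at x)" by simp
    then have "(s1 has_real_derivative 0) (at x)"
      by (rule has_field_derivative_transform_within_open[of _ _ _ "- {1..2}"]) (use that s1z in auto)
    then show ?thesis using ds1 DERIV_unique by blast
  qed
  have "compact (s1 ` {1..2})" "compact (s2' ` {1..2})"
    using continuous_on_if_DERIV[OF ds1] cs2 by (auto intro!: compact_continuous_image)
  then obtain M1 M2 where M: "\<And>x. x \<in> {1..2} \<Longrightarrow> \<bar>s1 x\<bar> \<le> M1" "\<And>x. x \<in> {1..2} \<Longrightarrow> \<bar>s2' x\<bar> \<le> M2"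
    by (metis bounded_iff compact_imp_bounded imageI real_norm_def)
  define M where "M = max 1 (max M1 M2)"
  have "\<bar>s1 x\<bar> \<le> M" "\<bar>s2' x\<bar> \<le> M" for x
    using M[of x] s1z[of x] s2z[of x] unfolding M_def by (cases "x \<in> {1..2}"; force)+
  moreover have "M \<ge> 1" by (simp add: M_def)
  ultimately have "smooth_step s s1 s2' M"
    unfolding smooth_step_def using sk ds ds1 cs2 s0 s2 sn sl s1z s2z by blast
  then show ?thesis by blast
qed

section \<open>Tensor products and the fundamental lemma\<close>

definition tensor :: "(real \<Rightarrow> real) \<Rightarrow> (real \<Rightarrow> real) \<Rightarrow> real \<times> real \<Rightarrow> complex" where
  "tensor g v = (\<lambda>p. complex_of_real (g (fst p) * v (snd p)))"

lemma tensor_has_derivative: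
  assumes "\<And>x. (g has_real_derivative g' x) (at x)" "\<And>x. (v has_real_derivative v' x) (at x)"
  shows "(tensor g v has_derivative
    (\<lambda>w. tensor (\<lambda>x. fst w * g' x) v p + tensor g (\<lambda>y. snd w * v' y) p)) (at p)"
proof -
  have "((\<lambda>p. g (fst p)) has_derivative (\<lambda>w. g' (fst p) * fst w)) (at p)"
    using has_derivative_compose[of fst fst p UNIV g "\<lambda>t. g' (fst p) * t"] assms(1)
    by (simp add: has_field_derivative_def has_derivative_fst)
  moreover have "((\<lambda>p. v (snd p)) has_derivative (\<lambda>w. v' (snd p) * snd w)) (at p)"
    using has_derivative_compose[of snd snd p UNIV v "\<lambda>t. v' (snd p) * t"] assms(2)
    by (simp add: has_field_derivative_def has_derivative_snd)
  ultimately have "((\<lambda>p. g (fst p) * v (snd p)) has_derivative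
      (\<lambda>w. g (fst p) * (v' (snd p) * snd w) + g' (fst p) * fst w * v (snd p))) (at p)"
    by (rule has_derivative_mult)
  from has_derivative_of_real[OF this, where 'a = complex] show ?thesis
    unfolding tensor_def by (rule has_derivative_eq_rhs) (auto simp: algebra_simps)
qed

lemma C_k_add:
  assumes "C_k k f" "C_k k g"
  shows "C_k k (\<lambda>p. f p + g p)"
  using assms
proof (induction k arbitrary: f g)
  case 0
  then show ?case by (auto intro: continuous_intros)
next
  case (Suc k)
  then have d: "f differentiable (at p)" "g differentiable (at p)" for p
    by (cases p, simp add: differentiable_on_def)+
  then have "frechet_derivative (\<lambda>p. f p + g p) (at p) = (\<lambda>v. frechet_derivative f (at p) v + frechet_derivative g (at p) v)" for p
    by (intro frechet_derivative_at[symmetric] has_derivative_add) (simp_all add: frechet_derivative_works[symmetric])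
  then show ?case using Suc d by (auto simp: differentiable_on_def)
qed

text \<open>Every directional derivative of a tensor product is a sum of two tensor products whose
  factors are smooth to one order less, so the induction closes.\<close>

lemma C_k_tensor: "C_k1 k g \<Longrightarrow> C_k1 k v \<Longrightarrow> C_k k (tensor g v)"
proof (induction k arbitrary: g v)
  case 0
  then have "continuous_on UNIV g" "continuous_on UNIV v" by auto
  then have "continuous_on UNIV (\<lambda>p. g (fst p))" "continuous_on UNIV (\<lambda>p. v (snd p))"
    using continuous_on_compose2[of UNIV g UNIV fst] continuous_on_compose2[of UNIV v UNIV snd]
    by (auto simp: continuous_on_fst continuous_on_snd continuous_on_id)
  then show ?case unfolding tensor_def by (auto intro!: continuous_intros)
next
  case (Suc k)
  then obtain g' v' where d: "\<And>x. (g has_real_derivative g' x) (at x)" "C_k1 k g'"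
    "\<And>x. (v has_real_derivative v' x) (at x)" "C_k1 k v'" by auto
  have gv: "C_k1 k g" "C_k1 k v" using Suc.prems C_k1_Suc_imp by blast+
  note D = tensor_has_derivative[OF d(1,3)]
  have "C_k k (\<lambda>p. tensor (\<lambda>x. fst w * g' x) v p + tensor g (\<lambda>y. snd w * v' y) p)" for w
    by (intro C_k_add Suc.IH C_k1_mult C_k1_const d gv)
  then show ?case
    using differentiableI[OF D]
    by (simp add: differentiable_on_def frechet_derivative_at[OF D, symmetric])
qed

lemma pd_tensor:
  assumes "\<And>x. (g has_real_derivative g' x) (at x)" "\<And>x. (v has_real_derivative v' x) (at x)"
  shows "pdx (tensor g v) = tensor g' v" "pdy (tensor g v) = tensor g v'"
  unfolding pdx_eq pdy_eq frechet_derivative_at[OF tensor_has_derivative[OF assms], symmetric]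
  by (simp_all add: tensor_def)

lemma tensor_in_test_fun:
  assumes "\<And>k. C_k1 k g" "\<And>k. C_k1 k v"
    and "\<And>x. x \<notin> {a..b} \<Longrightarrow> g x = 0" "\<And>y. y \<notin> {c..d} \<Longrightarrow> v y = 0"
    and "0 < a" "b < h" "0 < c" "d < 1"
  shows "tensor g v \<in> test_fun h"
  unfolding test_fun_def mem_Collect_eq
proof (intro conjI allI exI)
  show "C_k k (tensor g v)" for k using C_k_tensor assms(1,2) by blast
  show "compact ({a..b} \<times> {c..d})" by (intro compact_Times) auto
  show "{a..b} \<times> {c..d} \<subseteq> interior (rect h)" using assms(5-) by (auto simp: interior_rect)
  show "p \<notin> {a..b} \<times> {c..d} \<longrightarrow> tensor g v p = 0" for p
    using assms(3,4) by (cases p) (auto simp: tensor_def)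
qed

lemma box_Pair: "box (a, c) (b, d) = {a<..<b::real} \<times> {c<..<d::real}"
  unfolding set_eq_iff by (auto simp: mem_box Basis_prod_def)

lemma rect_sets: "rect h \<in> sets lebesgue"
  by (simp add: rect_eq_cbox)

text \<open>Products of two-sided cutoffs are test functions between 0 and 1 that converge pointwise
  to the indicator of the open box, and |w| dominates. The faces of the box do not contribute to its
  integral, and a degenerate box has empty interior.\<close>

lemma test_fun_integral_cbox_eq_0:
  fixes w :: "real \<times> real \<Rightarrow> complex"
  assumes w: "integrable (lebesgue_on (rect h)) w"
    and zero: "\<And>\<phi>. \<phi> \<in> test_fun h \<Longrightarrow> (\<integral>p. w p * \<phi> p \<partial>lebesgue_on (rect h)) = 0"
    and sub: "cbox (a, c) (b, d) \<subseteq> rect h"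
  shows "integral (cbox (a, c) (b, d)) w = 0"
proof (cases "a < b \<and> c < d")
  case False
  then have "box (a, c) (b, d) = {}" by (auto simp: box_Pair)
  then show ?thesis by (simp flip: integral_open_interval)
next
  case True
  then have "(a, c) \<in> cbox (a, c) (b, d)" "(b, d) \<in> cbox (a, c) (b, d)" by (auto simp: cbox_Pair_eq)
  then have "(a, c) \<in> rect h" "(b, d) \<in> rect h" using sub by auto
  then have bnd: "0 \<le> a" "b \<le> h" "0 \<le> c" "d \<le> 1" by (auto simp: rect_def)
  obtain s s1 s2 M where st: "smooth_step s s1 s2 M"
    using smooth_step_exists by blast
  note sk = smooth_step.sk[OF st] and s0 = smooth_step.s0[OF st] and s1 = smooth_step.s1[OF st]
    and sn = smooth_step.sn[OF st] smooth_step.sl[OF st]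
  define cut where "cut = (\<lambda>(n::nat) l r t. s (real (Suc n) * (t - l)) * s (real (Suc n) * (r - t)))"
  have ck: "C_k1 k (cut n l r)" for k n l r
  proof -
    have "C_k1 k (\<lambda>t. s (real (Suc n) * t + (- real (Suc n) * l)) * s (- real (Suc n) * t + real (Suc n) * r))"
      by (intro C_k1_mult C_k1_affine sk)
    then show ?thesis unfolding cut_def by (simp add: algebra_simps)
  qed
  have supp: "cut n l r t = 0" if "t \<notin> {l + 1 / real (Suc n)..r - 1 / real (Suc n)}" for n l r t
  proof -
    have "real (Suc n) * (t - l) \<le> 1 \<or> real (Suc n) * (r - t) \<le> 1"
      using that by (auto simp: field_simps)
    then show ?thesis unfolding cut_def using s0 by auto
  qed
  have c01: "0 \<le> cut n l r t" "cut n l r t \<le> 1" for n l r t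
    unfolding cut_def using sn by (auto intro: mult_le_one)
  have lim: "(\<lambda>n. cut n l r t) \<longlonglongrightarrow> indicator {l<..<r} t" for l r t
  proof (cases "t \<in> {l<..<r}")
    case True
    have "\<forall>\<^sub>F n in sequentially. 2 \<le> real (Suc n) * e" if "e > 0" for e
    proof -
      obtain N where N: "2 / e < real N" using reals_Archimedean2 by blast
      show ?thesis
      proof (rule eventually_sequentiallyI)
        fix n assume "N \<le> n"
        then have "2 / e \<le> real (Suc n)" using N by linarith
        then show "2 \<le> real (Suc n) * e" using that by (simp add: pos_divide_le_eq)
      qed
    qed
    then have "\<forall>\<^sub>F n in sequentially. 2 \<le> real (Suc n) * (t - l)"
      "\<forall>\<^sub>F n in sequentially. 2 \<le> real (Suc n) * (r - t)" using True by auto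
    then have "\<forall>\<^sub>F n in sequentially. cut n l r t = indicator {l<..<r} t"
      by eventually_elim (use True in \<open>simp add: cut_def s1 del: of_nat_Suc\<close>)
    then show ?thesis by (rule tendsto_eventually)
  next
    case False
    then have "cut n l r t = indicator {l<..<r} t" for n
    proof -
      have "t - l \<le> 0 \<or> r - t \<le> 0" using False by auto
      then have "real (Suc n) * (t - l) \<le> 0 \<or> real (Suc n) * (r - t) \<le> 0"
        by (auto intro: mult_nonneg_nonpos simp del: of_nat_Suc)
      then show ?thesis unfolding cut_def using s0 False by auto
    qed
    then show ?thesis by simp
  qed
  define \<phi> where "\<phi> = (\<lambda>n. tensor (cut n a b) (cut n c d))"
  have test: "\<phi> n \<in> test_fun h" for n
  proof -
    have pos: "0 < 1 / real (Suc n)" by simp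
    show ?thesis
      unfolding \<phi>_def by (rule tensor_in_test_fun, rule ck, rule ck, erule supp, erule supp) (use bnd pos in linarith)+
  qed
  have meas: "\<phi> n \<in> borel_measurable (lebesgue_on (rect h))" for n
    using continuous_integrable_rect[OF smooth_continuous_on[OF test_fun_smooth[OF test]]] by auto
  have wm: "w \<in> borel_measurable (lebesgue_on (rect h))" using w by auto
  let ?w = "\<lambda>p. indicator (box (a, c) (b, d)) p *\<^sub>R w p"
  have lim2: "(\<lambda>n. w p * \<phi> n p) \<longlonglongrightarrow> ?w p" for p
  proof -
    obtain x y where p: "p = (x, y)" by (cases p)
    have "(\<lambda>n. w p * complex_of_real (cut n a b x * cut n c d y)) \<longlonglongrightarrow>
        w p * complex_of_real (indicator {a<..<b} x * indicator {c<..<d} y)"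
      by (intro tendsto_intros lim)
    moreover have "w p * complex_of_real (indicator {a<..<b} x * indicator {c<..<d} y) = ?w p"
      by (auto simp: p box_Pair indicator_def)
    ultimately show ?thesis unfolding \<phi>_def tensor_def p by simp
  qed
  have bound: "norm (w p * \<phi> n p) \<le> norm (w p)" for n p
  proof -
    have "cmod (\<phi> n p) \<le> 1"
      unfolding \<phi>_def tensor_def norm_of_real using c01 by (simp add: abs_mult mult_le_one)
    then show ?thesis by (simp add: norm_mult mult_left_le)
  qed
  have im: "?w \<in> borel_measurable (lebesgue_on (rect h))"
    by (rule borel_measurable_LIMSEQ_metric[of "\<lambda>n p. w p * \<phi> n p"]) (use wm meas lim2 in auto)
  have "(\<lambda>n. \<integral>p. w p * \<phi> n p \<partial>lebesgue_on (rect h)) \<longlonglongrightarrow> (\<integral>p. ?w p \<partial>lebesgue_on (rect h))"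
    by (rule integral_dominated_convergence[where w = "\<lambda>p. norm (w p)"])
      (use wm meas im lim2 bound integrable_norm[OF w] in auto)
  then have I0: "(\<integral>p. ?w p \<partial>lebesgue_on (rect h)) = 0"
    unfolding zero[OF test] by (rule LIMSEQ_unique[OF tendsto_const, symmetric])
  have "integrable (lebesgue_on (rect h)) ?w"
    by (rule Bochner_Integration.integrable_bound[OF w im]) (auto simp: indicator_def)
  then have "integral (rect h) ?w = 0"
    using lebesgue_integral_eq_integral[OF _ rect_sets] I0 by metis
  moreover have "?w = (\<lambda>p. if p \<in> box (a, c) (b, d) then w p else 0)"
    by (auto simp: indicator_def)
  moreover have "box (a, c) (b, d) \<inter> rect h = box (a, c) (b, d)"
    using sub box_subset_cbox by blast
  ultimately have "integral (box (a, c) (b, d)) w = 0"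
    by (simp add: integral_restrict_Int)
  then show ?thesis by (simp add: integral_open_interval)
qed

text \<open>By the Henstock lemma, tagged sums of \<open>norm f\<close> are small when all integrals over boxes vanish.\<close>

lemma has_integral_norm_0:
  fixes f :: "'a::euclidean_space \<Rightarrow> 'b::euclidean_space"
  assumes "f integrable_on cbox a b"
    and zero: "\<And>u v. cbox u v \<subseteq> cbox a b \<Longrightarrow> integral (cbox u v) f = 0"
  shows "((\<lambda>x. norm (f x)) has_integral 0) (cbox a b)"
  unfolding has_integral
proof (intro allI impI)
    fix e :: real assume "0 < e"
    from Henstock_lemma[OF assms(1) this] obtain \<gamma> where g: "gauge \<gamma>"
      "\<And>p. p tagged_partial_division_of cbox a b \<Longrightarrow> \<gamma> fine p \<Longrightarrow>
        (\<Sum>(x, k)\<in>p. norm (measure lborel k *\<^sub>R f x - integral k f)) < e" by blast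
    have *: "norm ((\<Sum>(x, k)\<in>D. measure lborel k *\<^sub>R norm (f x)) - 0) < e"
      if D: "D tagged_division_of cbox a b" "\<gamma> fine D" for D
    proof -
      have "integral k f = 0" if "(x, k) \<in> D" for x k
        using tagged_division_ofD(3,4)[OF D(1) that] zero by metis
      then have "(\<Sum>(x, k)\<in>D. measure lborel k *\<^sub>R norm (f x)) = (\<Sum>(x, k)\<in>D. norm (measure lborel k *\<^sub>R f x - integral k f))"
        by (intro sum.cong refl) (clarsimp simp: abs_of_nonneg)
      moreover have "0 \<le> (\<Sum>(x, k)\<in>D. measure lborel k *\<^sub>R norm (f x))"
        by (intro sum_nonneg) (clarsimp simp: measure_nonneg)
      moreover have "(\<Sum>(x, k)\<in>D. norm (measure lborel k *\<^sub>R f x - integral k f)) < e"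
        by (rule g(2)[OF _ D(2)]) (use D(1) in \<open>simp add: tagged_division_of_def\<close>)
      ultimately show ?thesis by simp
    qed
    show "\<exists>\<gamma>. gauge \<gamma> \<and> (\<forall>D. D tagged_division_of cbox a b \<and> \<gamma> fine D \<longrightarrow>
        norm ((\<Sum>(x, k)\<in>D. measure lborel k *\<^sub>R norm (f x)) - 0) < e)"
      by (rule exI[of _ \<gamma>], intro conjI allI impI g(1), rule *) auto
qed

text \<open>All box integrals of w vanish, hence so does the integral of |w|. Its use is the
  uniqueness of weak derivatives, which ties the choice made in \<open>weak_partial\<close> to the
  classical derivatives of test functions.\<close>

lemma fundamental_lemma:
  assumes w: "integrable (lebesgue_on (rect h)) w"
    and zero: "\<And>\<phi>. \<phi> \<in> test_fun h \<Longrightarrow> (\<integral>p. w p * \<phi> p \<partial>lebesgue_on (rect h)) = 0"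
  shows "AE p in lebesgue_on (rect h). w p = 0"
proof -
  have "((\<lambda>p. norm (w p)) has_integral 0) (rect h)"
    unfolding rect_eq_cbox
  proof (rule has_integral_norm_0)
    show "w integrable_on cbox (0, 0) (h, 1)"
      using integrable_on_lebesgue_on[OF w rect_sets] by (simp add: rect_eq_cbox)
    show "integral (cbox u v) w = 0" if "cbox u v \<subseteq> cbox (0, 0) (h, 1)" for u v :: "real \<times> real"
      using test_fun_integral_cbox_eq_0[OF w zero, of "fst u" "snd u" "fst v" "snd v"] that
      by (simp add: rect_eq_cbox)
  qed
  then have "(\<integral>p. norm (w p) \<partial>lebesgue_on (rect h)) = 0"
    using lebesgue_integral_eq_integral[OF integrable_norm[OF w] rect_sets] by (simp add: integral_unique)
  then show ?thesis
    using integral_nonneg_eq_0_iff_AE[OF integrable_norm[OF w]] by simp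
qed

section \<open>Weak derivatives and the quadratic form\<close>

lemma L2_continuous:
  assumes "continuous_on UNIV F"
  shows "F \<in> L2 h"
  using continuous_integrable_rect[OF assms, of h]
    continuous_integrable_rect[OF continuous_on_power[OF continuous_on_norm[OF assms]], of h 2]
  by (simp add: L2_def borel_measurable_integrable)

lemma L2_D:
  assumes "f \<in> L2 h"
  shows "f \<in> borel_measurable (lebesgue_on (rect h))"
    "integrable (lebesgue_on (rect h)) (\<lambda>p. (cmod (f p))\<^sup>2)"
  using assms by (auto simp: L2_def)

text \<open>Young's inequality with a free parameter. The choice e = 1 serves closure of
  \<open>L2\<close> under sums; e tending to 0 keeps the constant sharp when a bound passes to a
  limit.\<close>

lemma cmod_add_square_le:
  assumes "e > 0"
  shows "(cmod (a + b))\<^sup>2 \<le> (1 + e) * (cmod a)\<^sup>2 + (1 + 1 / e) * (cmod b)\<^sup>2"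
proof -
  have "(cmod (a + b))\<^sup>2 \<le> (cmod a + cmod b)\<^sup>2"
    by (intro power_mono norm_triangle_ineq) auto
  also have "\<dots> = (1 + e) * (cmod a)\<^sup>2 + (1 + 1 / e) * (cmod b)\<^sup>2 - (e * cmod a - cmod b)\<^sup>2 / e"
    using assms by (simp add: field_simps power2_eq_square)
  also have "\<dots> \<le> (1 + e) * (cmod a)\<^sup>2 + (1 + 1 / e) * (cmod b)\<^sup>2"
    using assms by simp
  finally show ?thesis .
qed

lemma L2_add:
  assumes "f \<in> L2 h" "g \<in> L2 h"
  shows "(\<lambda>p. f p + g p) \<in> L2 h"
proof -
  note m = L2_D[OF assms(1)] L2_D[OF assms(2)]
  have "integrable (lebesgue_on (rect h)) (\<lambda>p. (cmod (f p + g p))\<^sup>2)"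
  proof (rule Bochner_Integration.integrable_bound)
    show "integrable (lebesgue_on (rect h)) (\<lambda>p. 2 * (cmod (f p))\<^sup>2 + 2 * (cmod (g p))\<^sup>2)"
      using m by auto
    show "AE p in lebesgue_on (rect h). norm ((cmod (f p + g p))\<^sup>2) \<le> norm (2 * (cmod (f p))\<^sup>2 + 2 * (cmod (g p))\<^sup>2)"
      using cmod_add_square_le[of 1] by auto
  qed (use m in auto)
  then show ?thesis using m by (auto simp: L2_def)
qed

lemma L2_uminus: "g \<in> L2 h \<Longrightarrow> (\<lambda>p. - g p) \<in> L2 h"
  by (auto simp: L2_def)

lemma L2_diff: "f \<in> L2 h \<Longrightarrow> g \<in> L2 h \<Longrightarrow> (\<lambda>p. f p - g p) \<in> L2 h"
  using L2_add[OF _ L2_uminus] by fastforce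

lemma L2_mult_integrable:
  assumes "f \<in> L2 h" "g \<in> L2 h"
  shows "integrable (lebesgue_on (rect h)) (\<lambda>p. f p * g p)"
proof (rule Bochner_Integration.integrable_bound)
  note m = L2_D[OF assms(1)] L2_D[OF assms(2)]
  show "integrable (lebesgue_on (rect h)) (\<lambda>p. (cmod (f p))\<^sup>2 + (cmod (g p))\<^sup>2)"
    using m by auto
  show "(\<lambda>p. f p * g p) \<in> borel_measurable (lebesgue_on (rect h))"
    using m by auto
  have "x * y \<le> x\<^sup>2 + y\<^sup>2" for x y :: real
    using sum_squares_bound[of x y] mult_nonneg_nonneg[of "x\<^sup>2" 1] zero_le_power2[of x] zero_le_power2[of y]
      zero_le_power2[of "x - y"] zero_le_power2[of "x + y"]
    by (simp add: power2_eq_square algebra_simps)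
  then show "AE p in lebesgue_on (rect h). norm (f p * g p) \<le> norm ((cmod (f p))\<^sup>2 + (cmod (g p))\<^sup>2)"
    by (auto simp: norm_mult)
qed

lemma L2_integrable:
  assumes "f \<in> L2 h"
  shows "integrable (lebesgue_on (rect h)) f"
  using L2_mult_integrable[OF assms L2_continuous[of "\<lambda>_. 1"]] by (simp add: continuous_on_const)

lemma norm2_square: "(norm2 h f)\<^sup>2 = (\<integral>p. (cmod (f p))\<^sup>2 \<partial>lebesgue_on (rect h))"
  unfolding norm2_def by (intro real_sqrt_pow2 Bochner_Integration.integral_nonneg) auto

lemma test_fun_L2: "\<phi> \<in> test_fun h \<Longrightarrow> \<phi> \<in> L2 h"
  by (intro L2_continuous smooth_continuous_on test_fun_smooth)

lemma test_fun_funpow: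
  assumes "\<phi> \<in> test_fun h"
  shows "(pdx ^^ i) \<phi> \<in> test_fun h" "(pdy ^^ i) \<phi> \<in> test_fun h"
  by (induction i) (use assms test_fun_pd in auto)

lemma test_fun_partial: "\<phi> \<in> test_fun h \<Longrightarrow> partial i j \<phi> \<in> test_fun h"
  by (simp add: partial_def test_fun_funpow)

text \<open>Integration by parts moves the x-derivatives first and the y-derivatives second, which
  produces the order opposite to the one in \<open>partial\<close>.\<close>

lemma funpow_pdy_pdx:
  assumes "\<phi> \<in> test_fun h"
  shows "(pdy ^^ j) ((pdx ^^ i) \<phi>) = (pdx ^^ i) ((pdy ^^ j) \<phi>)"
  using assms
proof (induction j arbitrary: \<phi>)
  case (Suc j)
  have 1: "pdy ((pdx ^^ i) \<psi>) = (pdx ^^ i) (pdy \<psi>)" if "\<psi> \<in> test_fun h" for \<psi>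
    using that
  proof (induction i)
    case (Suc i)
    then show ?case
      using pdx_pdy_commute[OF test_fun_smooth[OF test_fun_funpow(1)[OF Suc.prems]], of i] by simp
  qed simp
  show ?case
    using Suc 1[OF test_fun_funpow(2)[OF Suc.prems]] by simp
qed simp

lemma integral_mult_funpow:
  assumes "h \<ge> 0" "\<phi> \<in> test_fun h" "\<psi> \<in> test_fun h"
  shows "(\<integral>p. \<phi> p * (pdx ^^ i) \<psi> p \<partial>lebesgue_on (rect h)) =
      (-1) ^ i * (\<integral>p. (pdx ^^ i) \<phi> p * \<psi> p \<partial>lebesgue_on (rect h))"
    and "(\<integral>p. \<phi> p * (pdy ^^ i) \<psi> p \<partial>lebesgue_on (rect h)) =
      (-1) ^ i * (\<integral>p. (pdy ^^ i) \<phi> p * \<psi> p \<partial>lebesgue_on (rect h))"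
proof -
  show "(\<integral>p. \<phi> p * (pdx ^^ i) \<psi> p \<partial>lebesgue_on (rect h)) =
      (-1) ^ i * (\<integral>p. (pdx ^^ i) \<phi> p * \<psi> p \<partial>lebesgue_on (rect h))"
    using assms(2)
  proof (induction i arbitrary: \<phi>)
    case (Suc i)
    have "(\<integral>p. \<phi> p * pdx ((pdx ^^ i) \<psi>) p \<partial>lebesgue_on (rect h))
        = - (\<integral>p. pdx \<phi> p * (pdx ^^ i) \<psi> p \<partial>lebesgue_on (rect h))"
      using integral_rect_by_parts(1)[OF bounded_bilinear_mult Suc.prems _ assms(1)]
        test_fun_smooth[OF test_fun_funpow(1)[OF assms(3)]] by blast
    then show ?case
      using Suc.IH[OF test_fun_pd(1)[OF Suc.prems]] by (simp add: funpow_swap1)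
  qed simp
  show "(\<integral>p. \<phi> p * (pdy ^^ i) \<psi> p \<partial>lebesgue_on (rect h)) =
      (-1) ^ i * (\<integral>p. (pdy ^^ i) \<phi> p * \<psi> p \<partial>lebesgue_on (rect h))"
    using assms(2)
  proof (induction i arbitrary: \<phi>)
    case (Suc i)
    have "(\<integral>p. \<phi> p * pdy ((pdy ^^ i) \<psi>) p \<partial>lebesgue_on (rect h))
        = - (\<integral>p. pdy \<phi> p * (pdy ^^ i) \<psi> p \<partial>lebesgue_on (rect h))"
      using integral_rect_by_parts(2)[OF bounded_bilinear_mult Suc.prems _ assms(1)]
        test_fun_smooth[OF test_fun_funpow(2)[OF assms(3)]] by blast
    then show ?case
      using Suc.IH[OF test_fun_pd(2)[OF Suc.prems]] by (simp add: funpow_swap1)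
  qed simp
qed

lemma test_fun_has_weak_partial:
  assumes "h \<ge> 0" "\<phi> \<in> test_fun h"
  shows "has_weak_partial h i j \<phi> (partial i j \<phi>)"
  unfolding has_weak_partial_def
proof (intro conjI ballI)
  show "partial i j \<phi> \<in> L2 h" by (intro test_fun_L2 test_fun_partial assms)
  fix \<psi> assume \<psi>: "\<psi> \<in> test_fun h"
  show "(\<integral>p. \<phi> p * partial i j \<psi> p \<partial>lebesgue_on (rect h)) =
      (-1) ^ (i + j) * (\<integral>p. partial i j \<phi> p * \<psi> p \<partial>lebesgue_on (rect h))"
    unfolding partial_def funpow_pdy_pdx[OF assms(2), symmetric]
    using integral_mult_funpow(1)[OF assms test_fun_funpow(2)[OF \<psi>]]
      integral_mult_funpow(2)[OF assms(1) test_fun_funpow(1)[OF assms(2)] \<psi>]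
    by (simp add: power_add)
qed

lemma weak_partial_unique:
  assumes "has_weak_partial h i j f g1" "has_weak_partial h i j f g2"
  shows "AE p in lebesgue_on (rect h). g1 p = g2 p"
proof -
  have L: "g1 \<in> L2 h" "g2 \<in> L2 h" using assms by (auto simp: has_weak_partial_def)
  have "AE p in lebesgue_on (rect h). g1 p - g2 p = 0"
  proof (rule fundamental_lemma)
    show "integrable (lebesgue_on (rect h)) (\<lambda>p. g1 p - g2 p)"
      using L by (intro Bochner_Integration.integrable_diff L2_integrable)
    fix \<phi> assume \<phi>: "\<phi> \<in> test_fun h"
    have "(\<integral>p. g1 p * \<phi> p \<partial>lebesgue_on (rect h)) = (\<integral>p. g2 p * \<phi> p \<partial>lebesgue_on (rect h))"
      using assms \<phi> by (auto simp: has_weak_partial_def)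
    then show "(\<integral>p. (g1 p - g2 p) * \<phi> p \<partial>lebesgue_on (rect h)) = 0"
      unfolding left_diff_distrib
      by (subst Bochner_Integration.integral_diff) (auto intro!: L2_mult_integrable L test_fun_L2 \<phi>)
  qed
  then show ?thesis by simp
qed

lemma weak_partial_works:
  "has_weak_partial h i j f g \<Longrightarrow> has_weak_partial h i j f (weak_partial h i j f)"
  unfolding weak_partial_def by (rule someI[of "has_weak_partial h i j f"])

lemma weak_partial_test_fun:
  assumes "h \<ge> 0" "\<phi> \<in> test_fun h"
  shows "AE p in lebesgue_on (rect h). weak_partial h i j \<phi> p = partial i j \<phi> p"
  using test_fun_has_weak_partial[OF assms] weak_partial_works weak_partial_unique by blast

lemma test_fun_W22_0:
  assumes "h \<ge> 0" "\<phi> \<in> test_fun h"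
  shows "\<phi> \<in> W22_0 h"
proof -
  have "norm2 h (\<lambda>p. partial i j \<phi> p - weak_partial h i j \<phi> p) = 0" for i j
  proof -
    have "AE p in lebesgue_on (rect h). (cmod (partial i j \<phi> p - weak_partial h i j \<phi> p))\<^sup>2 = 0"
      using weak_partial_test_fun[OF assms, of i j] by eventually_elim simp
    then show ?thesis unfolding norm2_def by (simp add: integral_eq_zero_AE)
  qed
  moreover have "\<phi> \<in> W22 h"
    unfolding W22_def using test_fun_L2[OF assms(2)] test_fun_has_weak_partial[OF assms] by blast
  ultimately show ?thesis
    unfolding W22_0_def using assms(2) by (auto intro!: exI[of _ "\<lambda>_. \<phi>"])
qed

lemma partial_2:
  "partial 2 0 \<phi> = pdx (pdx \<phi>)" "partial 0 2 \<phi> = pdy (pdy \<phi>)" "partial 0 0 \<phi> = \<phi>"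
  by (simp_all add: partial_def numeral_2_eq_2)

lemma Q_test_fun:
  assumes "h \<ge> 0" "\<phi> \<in> test_fun h"
  shows "Q h \<phi> = ennreal (\<integral>p. (cmod (pdx (pdx \<phi>) p + pdy (pdy \<phi>) p))\<^sup>2 \<partial>lebesgue_on (rect h))"
proof -
  have "AE p in lebesgue_on (rect h). weak_laplacian h \<phi> p = pdx (pdx \<phi>) p + pdy (pdy \<phi>) p"
    using weak_partial_test_fun[OF assms, of 2 0] weak_partial_test_fun[OF assms, of 0 2]
    by eventually_elim (simp add: weak_laplacian_def partial_2)
  then have "AE p in lebesgue_on (rect h). ennreal ((cmod (weak_laplacian h \<phi> p))\<^sup>2)
      = ennreal ((cmod (pdx (pdx \<phi>) p + pdy (pdy \<phi>) p))\<^sup>2)"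
    by eventually_elim simp
  then have "Q h \<phi> = (\<integral>\<^sup>+p. ennreal ((cmod (pdx (pdx \<phi>) p + pdy (pdy \<phi>) p))\<^sup>2) \<partial>lebesgue_on (rect h))"
    unfolding Q_def using test_fun_W22_0[OF assms] by (simp add: nn_integral_cong_AE)
  also have "\<dots> = ennreal (\<integral>p. (cmod (pdx (pdx \<phi>) p + pdy (pdy \<phi>) p))\<^sup>2 \<partial>lebesgue_on (rect h))"
    by (intro nn_integral_eq_integral L2_D(2) L2_add test_fun_L2 test_fun_pd assms) auto
  finally show ?thesis .
qed

lemma L2_square_le:
  assumes "f \<in> L2 h" "g \<in> L2 h" "e > 0"
  shows "(norm2 h f)\<^sup>2 \<le> (1 + e) * (norm2 h g)\<^sup>2 + (1 + 1 / e) * (norm2 h (\<lambda>p. f p - g p))\<^sup>2"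
proof -
  have "(norm2 h f)\<^sup>2 \<le> (\<integral>p. (1 + e) * (cmod (g p))\<^sup>2 + (1 + 1 / e) * (cmod (f p - g p))\<^sup>2 \<partial>lebesgue_on (rect h))"
    unfolding norm2_square
  proof (rule integral_mono)
    show "(cmod (f p))\<^sup>2 \<le> (1 + e) * (cmod (g p))\<^sup>2 + (1 + 1 / e) * (cmod (f p - g p))\<^sup>2" for p
      using cmod_add_square_le[OF assms(3), of "g p" "f p - g p"] by simp
  qed (use assms L2_D(2) L2_diff in auto)
  also have "\<dots> = (1 + e) * (norm2 h g)\<^sup>2 + (1 + 1 / e) * (norm2 h (\<lambda>p. f p - g p))\<^sup>2"
    unfolding norm2_square
    by (subst Bochner_Integration.integral_add) (use assms L2_D(2) L2_diff in auto)
  finally show ?thesis .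
qed

lemma norm2_cong_AE:
  assumes "AE p in lebesgue_on (rect h). f p = g p" "f \<in> L2 h" "g \<in> L2 h"
  shows "norm2 h f = norm2 h g"
proof -
  have "(\<integral>p. (cmod (f p))\<^sup>2 \<partial>lebesgue_on (rect h)) = (\<integral>p. (cmod (g p))\<^sup>2 \<partial>lebesgue_on (rect h))"
  proof (rule integral_cong_AE)
    show "AE p in lebesgue_on (rect h). (cmod (f p))\<^sup>2 = (cmod (g p))\<^sup>2"
      using assms(1) by eventually_elim simp
  qed (use assms L2_D in auto)
  then show ?thesis by (simp add: norm2_def)
qed

text \<open>The inequality passes to the closure of the test functions: approximate f, spend a
  factor 1 + e on the norm and another on the Laplacian, let n tend to infinity and then e to 0.
  Outside the form domain the form is infinite.\<close>

lemma Q_lower_bound: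
  assumes L: "L \<ge> 0"
    and test: "\<And>\<phi>. \<phi> \<in> test_fun h \<Longrightarrow>
      L * (norm2 h \<phi>)\<^sup>2 \<le> (norm2 h (\<lambda>p. pdx (pdx \<phi>) p + pdy (pdy \<phi>) p))\<^sup>2"
    and f: "norm2 h f = 1"
  shows "ennreal L \<le> Q h f"
proof (cases "f \<in> W22_0 h")
  case False
  then show ?thesis by (simp add: Q_def)
next
  case True
  then have fL: "f \<in> L2 h" and W: "\<And>i j. i + j \<le> 2 \<Longrightarrow> \<exists>g. has_weak_partial h i j f g"
    by (auto simp: W22_0_def W22_def)
  from True obtain \<phi> where \<phi>: "\<And>n::nat. \<phi> n \<in> test_fun h"
    and conv: "\<And>i j. i + j \<le> 2 \<Longrightarrow> (\<lambda>n. norm2 h (\<lambda>p. partial i j (\<phi> n) p - weak_partial h i j f p)) \<longlonglongrightarrow> 0"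
    by (auto simp: W22_0_def)
  let ?F = "\<lambda>i j. weak_partial h i j f"
  have wp: "has_weak_partial h i j f (?F i j)" if "i + j \<le> 2" for i j
    using W[OF that] weak_partial_works by blast
  then have FL: "?F i j \<in> L2 h" if "i + j \<le> 2" for i j
    using that by (auto simp: has_weak_partial_def)
  \<comment> \<open>The convergence of order 0 is stated for the chosen weak derivative of order 0,
    which agrees with f only almost everywhere.\<close>
  have "has_weak_partial h 0 0 f f" using fL by (simp add: has_weak_partial_def partial_2)
  then have "AE p in lebesgue_on (rect h). ?F 0 0 p = f p"
    using wp[of 0 0] weak_partial_unique by auto
  then have F1: "norm2 h (?F 0 0) = 1"
    using norm2_cong_AE[OF _ FL[of 0 0] fL] f by simp
  let ?D = "\<lambda>p. ?F 2 0 p + ?F 0 2 p"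
  have DL: "?D \<in> L2 h" by (intro L2_add FL) auto
  define \<Delta> where "\<Delta> = (\<lambda>n p. partial 2 0 (\<phi> n) p + partial 0 2 (\<phi> n) p)"
  have pL: "partial i j (\<phi> n) \<in> L2 h" for i j n
    by (intro test_fun_L2 test_fun_partial \<phi>)
  have \<Delta>L: "\<Delta> n \<in> L2 h" for n unfolding \<Delta>_def by (intro L2_add pL)
  define \<delta> where "\<delta> = (\<lambda>i j n. (norm2 h (\<lambda>p. partial i j (\<phi> n) p - ?F i j p))\<^sup>2)"
  have \<delta>0: "\<delta> i j \<longlonglongrightarrow> 0" if "i + j \<le> 2" for i j
    unfolding \<delta>_def using tendsto_power[OF conv[OF that], of 2] by simp
  have swap: "norm2 h (\<lambda>p. f p - g p) = norm2 h (\<lambda>p. g p - f p)" for f g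
    by (simp add: norm2_def norm_minus_commute)
  have lap: "(norm2 h (\<lambda>p. \<Delta> n p - ?D p))\<^sup>2 \<le> 2 * \<delta> 2 0 n + 2 * \<delta> 0 2 n" for n
  proof -
    have "(norm2 h (\<lambda>p. \<Delta> n p - ?D p))\<^sup>2 \<le>
        (1 + 1) * (norm2 h (\<lambda>p. partial 2 0 (\<phi> n) p - ?F 2 0 p))\<^sup>2
        + (1 + 1 / 1) * (norm2 h (\<lambda>p. (\<Delta> n p - ?D p) - (partial 2 0 (\<phi> n) p - ?F 2 0 p)))\<^sup>2"
      by (rule L2_square_le) (auto intro!: L2_diff \<Delta>L DL pL FL)
    moreover have "(\<lambda>p. (\<Delta> n p - ?D p) - (partial 2 0 (\<phi> n) p - ?F 2 0 p)) = (\<lambda>p. partial 0 2 (\<phi> n) p - ?F 0 2 p)"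
      by (auto simp: \<Delta>_def)
    ultimately show ?thesis by (simp add: \<delta>_def)
  qed
  have main: "L \<le> (1 + e)\<^sup>2 * (norm2 h ?D)\<^sup>2" if e: "e > 0" for e
  proof (rule LIMSEQ_le_const)
    let ?r = "\<lambda>n. (1 + e)\<^sup>2 * (norm2 h ?D)\<^sup>2
      + ((1 + e) * (1 + 1 / e) * (2 * \<delta> 2 0 n + 2 * \<delta> 0 2 n) + L * (1 + 1 / e) * \<delta> 0 0 n)"
    have "?r \<longlonglongrightarrow> (1 + e)\<^sup>2 * (norm2 h ?D)\<^sup>2
      + ((1 + e) * (1 + 1 / e) * (2 * 0 + 2 * 0) + L * (1 + 1 / e) * 0)"
      by (intro tendsto_intros \<delta>0) auto
    then show "?r \<longlonglongrightarrow> (1 + e)\<^sup>2 * (norm2 h ?D)\<^sup>2" by simp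
    have "L \<le> ?r n" for n
    proof -
      have "1 \<le> (1 + e) * (norm2 h (\<phi> n))\<^sup>2 + (1 + 1 / e) * \<delta> 0 0 n"
        using L2_square_le[OF FL[of 0 0] pL[of 0 0 n] e] swap[of "?F 0 0" "\<phi> n"]
        by (simp add: F1 \<delta>_def partial_2)
      then have "L * 1 \<le> L * ((1 + e) * (norm2 h (\<phi> n))\<^sup>2 + (1 + 1 / e) * \<delta> 0 0 n)"
        using L by (rule mult_left_mono)
      also have "\<dots> = (1 + e) * (L * (norm2 h (\<phi> n))\<^sup>2) + L * (1 + 1 / e) * \<delta> 0 0 n"
        by (simp add: algebra_simps)
      also have "\<dots> \<le> (1 + e) * (norm2 h (\<Delta> n))\<^sup>2 + L * (1 + 1 / e) * \<delta> 0 0 n"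
        using test[OF \<phi>[of n]] e by (auto simp: \<Delta>_def partial_2 intro!: mult_left_mono)
      also have "\<dots> \<le> (1 + e) * ((1 + e) * (norm2 h ?D)\<^sup>2 + (1 + 1 / e) * (2 * \<delta> 2 0 n + 2 * \<delta> 0 2 n))
          + L * (1 + 1 / e) * \<delta> 0 0 n"
      proof -
        have "(norm2 h (\<Delta> n))\<^sup>2 \<le> (1 + e) * (norm2 h ?D)\<^sup>2 + (1 + 1 / e) * (norm2 h (\<lambda>p. \<Delta> n p - ?D p))\<^sup>2"
          by (rule L2_square_le[OF \<Delta>L DL e])
        also have "\<dots> \<le> (1 + e) * (norm2 h ?D)\<^sup>2 + (1 + 1 / e) * (2 * \<delta> 2 0 n + 2 * \<delta> 0 2 n)"
          using e by (intro add_left_mono mult_left_mono lap) auto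
        finally show ?thesis using e by (intro add_right_mono mult_left_mono) auto
      qed
      also have "\<dots> = ?r n" by (simp add: algebra_simps power2_eq_square)
      finally show ?thesis by simp
    qed
    then show "\<exists>N. \<forall>n\<ge>N. L \<le> ?r n" by blast
  qed
  have "((\<lambda>e. (1 + e)\<^sup>2 * (norm2 h ?D)\<^sup>2) \<longlongrightarrow> (1 + 0)\<^sup>2 * (norm2 h ?D)\<^sup>2) (at_right 0)"
    by (intro tendsto_intros)
  then have "L \<le> (1 + 0)\<^sup>2 * (norm2 h ?D)\<^sup>2"
    by (rule tendsto_lowerbound) (auto simp: eventually_at_filter main)
  then have "L \<le> (norm2 h ?D)\<^sup>2" by simp
  then have "ennreal L \<le> ennreal (\<integral>p. (cmod (?D p))\<^sup>2 \<partial>lebesgue_on (rect h))"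
    unfolding norm2_square by (rule ennreal_leI)
  also have "\<dots> = (\<integral>\<^sup>+p. ennreal ((cmod (?D p))\<^sup>2) \<partial>lebesgue_on (rect h))"
    using L2_D(2)[OF DL] by (intro nn_integral_eq_integral[symmetric]) auto
  also have "\<dots> = Q h f"
    using True by (simp add: Q_def weak_laplacian_def)
  finally show ?thesis .
qed

section \<open>Trial functions\<close>

lemma integral_mult_second_derivative:
  fixes f f1 f2 :: "real \<Rightarrow> real"
  assumes "a \<le> b"
    and der: "\<And>x. (f has_real_derivative f1 x) (at x)" "\<And>x. (f1 has_real_derivative f2 x) (at x)"
    and cont: "continuous_on UNIV f2" and bc: "f a = 0" "f b = 0"
  shows "integral {a..b} (\<lambda>x. f x * f2 x) = - integral {a..b} (\<lambda>x. (f1 x)\<^sup>2)"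
proof -
  have c: "continuous_on S f" "continuous_on S f1" "continuous_on S f2" for S
    using continuous_on_if_DERIV[OF der(1)] continuous_on_if_DERIV[OF der(2)] continuous_on_subset[OF cont]
    by auto
  have "((\<lambda>x. f x * f2 x + (f1 x)\<^sup>2) has_integral f b * f1 b - f a * f1 a) {a..b}"
  proof (rule fundamental_theorem_of_calculus[OF assms(1)])
    fix x
    have "((\<lambda>x. f x * f1 x) has_real_derivative f x * f2 x + (f1 x)\<^sup>2) (at x)"
      by (rule derivative_eq_intros der refl)+ (simp add: power2_eq_square)
    then show "((\<lambda>x. f x * f1 x) has_vector_derivative f x * f2 x + (f1 x)\<^sup>2) (at x within {a..b})"
      by (simp add: has_real_derivative_iff_has_vector_derivative has_vector_derivative_at_within)
  qed
  then have "integral {a..b} (\<lambda>x. f x * f2 x + (f1 x)\<^sup>2) = 0"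
    using bc by (simp add: integral_unique)
  then show ?thesis
    by (subst (asm) integral_add) (auto intro!: integrable_continuous_real continuous_intros c)
qed

text \<open>The cross term of the squared Laplacian splits into \<open>\<integral>g g2\<close> times
  \<open>\<integral>v v2\<close>. Each factor is minus the integral of a squared first derivative,
  because g and v vanish at the ends.\<close>

lemma tensor_integrals:
  fixes g g1 g2 v v1 v2 :: "real \<Rightarrow> real"
  assumes "h \<ge> 0"
    and dg: "\<And>x. (g has_real_derivative g1 x) (at x)" "\<And>x. (g1 has_real_derivative g2 x) (at x)"
      "continuous_on UNIV g2" "g 0 = 0" "g h = 0"
    and dv: "\<And>x. (v has_real_derivative v1 x) (at x)" "\<And>x. (v1 has_real_derivative v2 x) (at x)"
      "continuous_on UNIV v2" "v 0 = 0" "v 1 = 0"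
  defines "G \<equiv> \<lambda>f. integral {0..h} (\<lambda>x. (f x)\<^sup>2)" and "V \<equiv> \<lambda>f. integral {0..1} (\<lambda>y. (f y)\<^sup>2)"
  shows "(norm2 h (tensor g v))\<^sup>2 = G g * V v"
    and "(\<integral>p. (cmod (pdx (pdx (tensor g v)) p + pdy (pdy (tensor g v)) p))\<^sup>2 \<partial>lebesgue_on (rect h))
      = G g2 * V v + 2 * G g1 * V v1 + G g * V v2"
proof -
  have c: "continuous_on S g" "continuous_on S g1" "continuous_on S g2"
    "continuous_on S v" "continuous_on S v1" "continuous_on S v2" for S
    using continuous_on_if_DERIV[OF dg(1)] continuous_on_if_DERIV[OF dg(2)] continuous_on_subset[OF dg(3)]
     continuous_on_if_DERIV[OF dv(1)] continuous_on_if_DERIV[OF dv(2)] continuous_on_subset[OF dv(3)]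
    by auto
  have cf: "continuous_on S (\<lambda>p. f (fst p))" "continuous_on S (\<lambda>p. f (snd p))"
    if "\<And>S. continuous_on S f" for f :: "real \<Rightarrow> real" and S :: "(real \<times> real) set"
    by (rule continuous_on_compose2[OF that[of UNIV]]; auto intro!: continuous_intros)+
  have "(norm2 h (tensor g v))\<^sup>2 = (\<integral>p. (g (fst p))\<^sup>2 * (v (snd p))\<^sup>2 \<partial>lebesgue_on (rect h))"
    unfolding norm2_square tensor_def norm_of_real by (simp add: power_mult_distrib abs_mult)
  also have "\<dots> = integral {0..h} (\<lambda>x. integral {0..1} (\<lambda>y. (g x)\<^sup>2 * (v y)\<^sup>2))"
    by (subst integral_rect_iterated(1)) (auto intro!: continuous_intros cf c)
  also have "\<dots> = G g * V v" by (simp add: G_def V_def)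
  finally show "(norm2 h (tensor g v))\<^sup>2 = G g * V v" .
  have pd: "pdx (pdx (tensor g v)) = tensor g2 v" "pdy (pdy (tensor g v)) = tensor g v2"
    unfolding pd_tensor[OF dg(1) dv(1)] pd_tensor(1)[OF dg(2) dv(1)] pd_tensor(2)[OF dg(1) dv(2)] by simp_all
  have gg: "integral {0..h} (\<lambda>x. g x * g2 x) = - G g1"
    unfolding G_def by (rule integral_mult_second_derivative[OF assms(1) dg])
  have vv: "integral {0..1} (\<lambda>y. v y * v2 y) = - V v1"
    unfolding V_def by (rule integral_mult_second_derivative[OF _ dv]) simp
  have "(\<integral>p. (cmod (pdx (pdx (tensor g v)) p + pdy (pdy (tensor g v)) p))\<^sup>2 \<partial>lebesgue_on (rect h))
      = (\<integral>p. (g2 (fst p) * v (snd p) + g (fst p) * v2 (snd p))\<^sup>2 \<partial>lebesgue_on (rect h))"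
    unfolding pd unfolding tensor_def of_real_add[symmetric] norm_of_real power2_abs ..
  also have "\<dots> = integral {0..h} (\<lambda>x. integral {0..1} (\<lambda>y. (g2 x * v y + g x * v2 y)\<^sup>2))"
    by (subst integral_rect_iterated(1)) (auto intro!: continuous_intros cf c)
  also have "(\<lambda>x. integral {0..1} (\<lambda>y. (g2 x * v y + g x * v2 y)\<^sup>2)) =
      (\<lambda>x. V v * (g2 x)\<^sup>2 + 2 * (- V v1) * (g x * g2 x) + V v2 * (g x)\<^sup>2)"
  proof
    fix x
    show "integral {0..1} (\<lambda>y. (g2 x * v y + g x * v2 y)\<^sup>2)
      = V v * (g2 x)\<^sup>2 + 2 * (- V v1) * (g x * g2 x) + V v2 * (g x)\<^sup>2"
      using integral_square_lincomb[OF c(4) c(6), of "g2 x" "g x"] vv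
      by (simp add: V_def mult.commute mult.left_commute)
  qed
  also have "integral {0..h} (\<lambda>x. V v * (g2 x)\<^sup>2 + 2 * (- V v1) * (g x * g2 x) + V v2 * (g x)\<^sup>2)
      = V v * G g2 + 2 * (- V v1) * (- G g1) + V v2 * G g"
    unfolding G_def gg[symmetric, unfolded G_def]
    by (intro integral_unique has_integral_add has_integral_mult_right integrable_integral
        integrable_continuous_real continuous_intros c)
  finally show "(\<integral>p. (cmod (pdx (pdx (tensor g v)) p + pdy (pdy (tensor g v)) p))\<^sup>2 \<partial>lebesgue_on (rect h))
      = G g2 * V v + 2 * G g1 * V v1 + G g * V v2"
    by (simp add: mult.commute mult.left_commute)
qed

text \<open>Both parts need a unit test function: an infinite infimum would be mapped to \<open>0\<close> by
  \<open>enn2real\<close>.\<close>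

lemma mu1_le:
  assumes "h \<ge> 0" "\<phi> \<in> test_fun h" "norm2 h \<phi> = 1"
  shows "mu1 h \<le> (\<integral>p. (cmod (pdx (pdx \<phi>) p + pdy (pdy \<phi>) p))\<^sup>2 \<partial>lebesgue_on (rect h))" (is "_ \<le> ?E")
    and "L \<ge> 0 \<Longrightarrow> (\<And>\<phi>. \<phi> \<in> test_fun h \<Longrightarrow>
      L * (norm2 h \<phi>)\<^sup>2 \<le> (norm2 h (\<lambda>p. pdx (pdx \<phi>) p + pdy (pdy \<phi>) p))\<^sup>2) \<Longrightarrow> L \<le> mu1 h"
proof -
  let ?I = "INF f\<in>{f \<in> L2 h. norm2 h f = 1}. Q h f"
  have I: "?I \<le> ennreal ?E"
    using Q_test_fun[OF assms(1,2)] test_fun_L2[OF assms(2)] assms(3)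
    by (metis (mono_tags, lifting) INF_lower mem_Collect_eq)
  have E: "?E \<ge> 0" by (intro Bochner_Integration.integral_nonneg) auto
  have "enn2real ?I \<le> enn2real (ennreal ?E)" by (rule enn2real_mono[OF I]) simp
  then show "mu1 h \<le> ?E" using E by (simp add: mu1_def)
  assume L: "L \<ge> 0" and test: "\<And>\<phi>. \<phi> \<in> test_fun h \<Longrightarrow>
      L * (norm2 h \<phi>)\<^sup>2 \<le> (norm2 h (\<lambda>p. pdx (pdx \<phi>) p + pdy (pdy \<phi>) p))\<^sup>2"
  have "ennreal L \<le> ?I"
    by (rule INF_greatest) (use Q_lower_bound[OF L test] in blast)
  then have "enn2real (ennreal L) \<le> enn2real ?I"
    by (rule enn2real_mono) (use I in \<open>simp add: le_less_trans\<close>)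
  then show "L \<le> mu1 h" using L by (simp add: mu1_def)
qed

text \<open>The product is scaled to unit norm by a constant in its first factor. The same unit
  vector makes the infimum finite, which the second conclusion relies on.\<close>

lemma mu1_le_tensor:
  fixes g g1 g2 v v1 v2 :: "real \<Rightarrow> real"
  assumes "h \<ge> 0"
    and dg: "\<And>x. (g has_real_derivative g1 x) (at x)" "\<And>x. (g1 has_real_derivative g2 x) (at x)"
      "continuous_on UNIV g2" "\<And>k. C_k1 k g" "\<And>x. x \<notin> {a..b} \<Longrightarrow> g x = 0" "0 < a" "b < h"
    and dv: "\<And>x. (v has_real_derivative v1 x) (at x)" "\<And>x. (v1 has_real_derivative v2 x) (at x)"
      "continuous_on UNIV v2" "\<And>k. C_k1 k v" "\<And>y. y \<notin> {c..d} \<Longrightarrow> v y = 0" "0 < c" "d < 1"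
  defines "G \<equiv> \<lambda>f. integral {0..h} (\<lambda>x. (f x)\<^sup>2)" and "V \<equiv> \<lambda>f. integral {0..1} (\<lambda>y. (f y)\<^sup>2)"
  assumes pos: "G g > 0" "V v > 0"
  shows "mu1 h \<le> G g2 / G g + 2 * (G g1 / G g) * (V v1 / V v) + V v2 / V v"
    and "L \<ge> 0 \<Longrightarrow> (\<And>\<phi>. \<phi> \<in> test_fun h \<Longrightarrow>
      L * (norm2 h \<phi>)\<^sup>2 \<le> (norm2 h (\<lambda>p. pdx (pdx \<phi>) p + pdy (pdy \<phi>) p))\<^sup>2) \<Longrightarrow> L \<le> mu1 h"
proof -
  define k where "k = 1 / sqrt (G g * V v)"
  have k: "k\<^sup>2 = 1 / (G g * V v)" using pos by (simp add: k_def power_divide)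
  define \<phi> where "\<phi> = tensor (\<lambda>x. k * g x) v"
  have bc: "g 0 = 0" "g h = 0" "v 0 = 0" "v 1 = 0" using dg(5,6,7) dv(5,6,7) by auto
  have \<phi>: "\<phi> \<in> test_fun h"
    unfolding \<phi>_def
    by (rule tensor_in_test_fun[of _ _ a b c d])
      (use dg dv in \<open>auto intro: C_k1_mult C_k1_const\<close>)
  have dk: "((\<lambda>x. k * g x) has_real_derivative k * g1 x) (at x)"
    "((\<lambda>x. k * g1 x) has_real_derivative k * g2 x) (at x)" for x
    by (intro DERIV_cmult dg)+
  have ck: "continuous_on UNIV (\<lambda>x. k * g2 x)" by (intro continuous_intros dg)
  have Gk: "integral {0..h} (\<lambda>x. (k * f x)\<^sup>2) = G f / (G g * V v)" for f
    by (simp add: power_mult_distrib G_def k)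
  have "(norm2 h \<phi>)\<^sup>2 = 1"
    unfolding \<phi>_def
    by (subst tensor_integrals(1)[OF assms(1) dk ck _ _ dv(1,2,3)])
      (use bc pos in \<open>auto simp: Gk V_def\<close>)
  then have n: "norm2 h \<phi> = 1"
    by (simp add: power2_eq_1_iff norm2_def)
  have "(\<integral>p. (cmod (pdx (pdx \<phi>) p + pdy (pdy \<phi>) p))\<^sup>2 \<partial>lebesgue_on (rect h))
      = G g2 / (G g * V v) * V v + 2 * (G g1 / (G g * V v)) * V v1 + G g / (G g * V v) * V v2"
    unfolding \<phi>_def
    by (subst tensor_integrals(2)[OF assms(1) dk ck _ _ dv(1,2,3)])
      (use bc in \<open>auto simp: Gk V_def\<close>)
  also have "\<dots> = G g2 / G g + 2 * (G g1 / G g) * (V v1 / V v) + V v2 / V v"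
    using pos by (simp add: field_simps)
  finally show "mu1 h \<le> G g2 / G g + 2 * (G g1 / G g) * (V v1 / V v) + V v2 / V v"
    using mu1_le(1)[OF assms(1) \<phi> n] by simp
  show "L \<ge> 0 \<Longrightarrow> (\<And>\<phi>. \<phi> \<in> test_fun h \<Longrightarrow>
      L * (norm2 h \<phi>)\<^sup>2 \<le> (norm2 h (\<lambda>p. pdx (pdx \<phi>) p + pdy (pdy \<phi>) p))\<^sup>2) \<Longrightarrow> L \<le> mu1 h"
    using mu1_le(2)[OF assms(1) \<phi> n] by blast
qed

section \<open>Cutting a profile off at both ends of an interval\<close>

context smooth_step
begin

text \<open>The layers are [1/N, 2/N] and its mirror image in [0, L]. The sine uses N = 1 and L = h;
  the beam uses L = 1 and N tending to infinity.\<close>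

definition cut :: "real \<Rightarrow> real \<Rightarrow> (real \<Rightarrow> real) \<Rightarrow> real \<Rightarrow> real" where
  "cut N L u t = s (N * t) * s (N * (L - t)) * u t"

definition cut1 :: "real \<Rightarrow> real \<Rightarrow> (real \<Rightarrow> real) \<Rightarrow> (real \<Rightarrow> real) \<Rightarrow> real \<Rightarrow> real" where
  "cut1 N L u u1 t = N * (s1 (N * t) * s (N * (L - t)) - s (N * t) * s1 (N * (L - t))) * u t
    + s (N * t) * s (N * (L - t)) * u1 t"

definition cut2 :: "real \<Rightarrow> real \<Rightarrow> (real \<Rightarrow> real) \<Rightarrow> (real \<Rightarrow> real) \<Rightarrow> (real \<Rightarrow> real) \<Rightarrow> real \<Rightarrow> real" where
  "cut2 N L u u1 u2 t = N\<^sup>2 * (s2 (N * t) * s (N * (L - t)) - 2 * s1 (N * t) * s1 (N * (L - t))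
      + s (N * t) * s2 (N * (L - t))) * u t
    + 2 * N * (s1 (N * t) * s (N * (L - t)) - s (N * t) * s1 (N * (L - t))) * u1 t
    + s (N * t) * s (N * (L - t)) * u2 t"

lemma DERIV_affine:
  assumes "\<And>x. (f has_real_derivative f' x) (at x)"
  shows "((\<lambda>t. f (N * t)) has_real_derivative f' (N * t) * N) (at t)"
    "((\<lambda>t. f (N * (L - t))) has_real_derivative f' (N * (L - t)) * (- N)) (at t)"
  by (rule DERIV_chain'[OF _ assms]; auto intro!: derivative_eq_intros)+

lemma cut_derivs:
  assumes "\<And>x. (u has_real_derivative u1 x) (at x)" "\<And>x. (u1 has_real_derivative u2 x) (at x)"
  shows "(cut N L u has_real_derivative cut1 N L u u1 t) (at t)"
    "(cut1 N L u u1 has_real_derivative cut2 N L u u1 u2 t) (at t)"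
  unfolding cut_def[abs_def] cut1_def[abs_def] cut2_def
  by (rule derivative_eq_intros DERIV_affine[OF ds] DERIV_affine[OF ds1] assms refl
      | simp add: algebra_simps power2_eq_square)+

lemma cut_continuous:
  assumes "\<And>x. (u has_real_derivative u1 x) (at x)" "\<And>x. (u1 has_real_derivative u2 x) (at x)"
    "continuous_on UNIV u2"
  shows "continuous_on S (cut N L u)" "continuous_on S (cut1 N L u u1)" "continuous_on S (cut2 N L u u1 u2)"
proof -
  show "continuous_on S (cut N L u)" by (rule continuous_on_if_DERIV[OF cut_derivs(1)[OF assms(1,2)]])
  show "continuous_on S (cut1 N L u u1)" by (rule continuous_on_if_DERIV[OF cut_derivs(2)[OF assms(1,2)]])
  have a: "continuous_on S (\<lambda>t. f (N * t))" "continuous_on S (\<lambda>t. f (N * (L - t)))"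
    if "continuous_on UNIV f" for f :: "real \<Rightarrow> real"
    by (rule continuous_on_compose2[OF that]; auto intro!: continuous_intros)+
  have "continuous_on UNIV s" "continuous_on UNIV s1"
    using continuous_on_if_DERIV[OF ds] continuous_on_if_DERIV[OF ds1] by auto
  moreover have "continuous_on S u" "continuous_on S u1" "continuous_on S u2"
    using continuous_on_if_DERIV[OF assms(1)] continuous_on_if_DERIV[OF assms(2)]
      continuous_on_subset[OF assms(3)] by auto
  ultimately show "continuous_on S (cut2 N L u u1 u2)"
    unfolding cut2_def[abs_def] by (intro continuous_intros a cs2)
qed

lemma cut_C_k1:
  assumes "C_k1 k u"
  shows "C_k1 k (cut N L u)"
proof -
  have "C_k1 k (\<lambda>t. s (N * t + 0) * s (- N * t + N * L) * u t)"
    by (intro C_k1_mult C_k1_affine sk assms)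
  then show ?thesis unfolding cut_def[abs_def] by (simp add: algebra_simps)
qed

lemma cut_support:
  assumes "N > 0" "t \<notin> {1 / N..L - 1 / N}"
  shows "cut N L u t = 0"
proof -
  have "N * t \<le> 1 \<or> N * (L - t) \<le> 1" using assms by (auto simp: field_simps)
  then show ?thesis using s0 by (auto simp: cut_def)
qed

lemma cut_inside:
  assumes "N * t > 2" "N * (L - t) > 2"
  shows "cut N L u t = u t" "cut1 N L u u1 t = u1 t" "cut2 N L u u1 u2 t = u2 t"
  using assms s1[of "N * t"] s1[of "N * (L - t)"] s1z[of "N * t"] s1z[of "N * (L - t)"]
    s2z[of "N * t"] s2z[of "N * (L - t)"]
  by (auto simp: cut_def cut1_def cut2_def)

text \<open>Both derivatives live on [1, 2], where the weights r and r^2 are at most 2 and 4. With r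
  = N t this says that N s'(N t) is O(1/t) and N^2 s''(N t) is O(1/t^2), uniformly in N.\<close>

lemma step_weighted_bounds:
  "\<bar>r * s1 r\<bar> \<le> 2 * M" "\<bar>r\<^sup>2 * s2 r\<bar> \<le> 4 * M"
proof -
  have "\<bar>r\<bar> * \<bar>s1 r\<bar> \<le> 2 * M" if "r \<in> {1..2}"
    using that s1M[of r] M by (intro mult_mono) auto
  then show "\<bar>r * s1 r\<bar> \<le> 2 * M"
    using s1z[of r] M by (cases "r \<in> {1..2}") (auto simp: abs_mult)
  have "\<bar>r\<^sup>2\<bar> * \<bar>s2 r\<bar> \<le> 2\<^sup>2 * M" if "r \<in> {1..2}"
    using that s2M[of r] M power_mono[of r 2 2] by (intro mult_mono) auto
  then show "\<bar>r\<^sup>2 * s2 r\<bar> \<le> 4 * M"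
    using s2z[of r] M by (cases "r \<in> {1..2}") (auto simp: abs_mult)
qed

end

text \<open>Pointwise equality is asked only in the open interval: at the ends a cut profile and its
  derivatives are 0, whereas for instance \<open>beam2 0\<close> is not.\<close>

lemma square_integral_limit:
  fixes f :: "nat \<Rightarrow> real \<Rightarrow> real" and F :: "real \<Rightarrow> real"
  assumes c: "\<And>n S. continuous_on S (f n)" "\<And>S. continuous_on S F"
    and bound: "\<And>n t. t \<in> {0..1} \<Longrightarrow> \<bar>f n t\<bar> \<le> B"
    and conv: "\<And>t. t \<in> {0<..<1} \<Longrightarrow> \<forall>\<^sub>F n in sequentially. f n t = F t"
  shows "(\<lambda>n. integral {0..1} (\<lambda>t. (f n t)\<^sup>2)) \<longlonglongrightarrow> integral {0..1} (\<lambda>t. (F t)\<^sup>2)"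
  unfolding integral_open_interval_real
proof (rule dominated_convergence(2)[where h = "\<lambda>_. B\<^sup>2"])
  show "(\<lambda>t. (f n t)\<^sup>2) integrable_on {0<..<1}" for n
    unfolding integrable_on_open_interval_real by (intro integrable_continuous_real continuous_intros c)
  show "(\<lambda>t. B\<^sup>2) integrable_on {0<..<1::real}"
    unfolding integrable_on_open_interval_real by (intro integrable_continuous_real continuous_intros)
  show "norm ((f n t)\<^sup>2) \<le> B\<^sup>2" if "t \<in> {0<..<1}" for n t
    using bound[of t n] that by (auto simp: abs_le_square_iff[symmetric])
  show "(\<lambda>n. (f n t)\<^sup>2) \<longlonglongrightarrow> (F t)\<^sup>2" if "t \<in> {0<..<1}" for t
    by (rule tendsto_eventually) (use conv[OF that] in \<open>auto elim: eventually_mono\<close>)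
qed

text \<open>The zeros of the beam at both ends are double, by the mean value theorem applied twice
  to a bound on u''. The bound with t (1 - t) is the geometric mean of the two quadratic ones; it
  meets the term in which the step derivatives of both ends are multiplied.\<close>

lemma beam_bounds:
  obtains K where "K \<ge> 1"
    "\<And>t. t \<in> {0..1} \<Longrightarrow> \<bar>beam t\<bar> \<le> K * t\<^sup>2" "\<And>t. t \<in> {0..1} \<Longrightarrow> \<bar>beam t\<bar> \<le> K * (1 - t)\<^sup>2"
    "\<And>t. t \<in> {0..1} \<Longrightarrow> \<bar>beam t\<bar> \<le> K * (t * (1 - t))"
    "\<And>t. t \<in> {0..1} \<Longrightarrow> \<bar>beam1 t\<bar> \<le> K * t" "\<And>t. t \<in> {0..1} \<Longrightarrow> \<bar>beam1 t\<bar> \<le> K * (1 - t)"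
    "\<And>t. t \<in> {0..1} \<Longrightarrow> \<bar>beam2 t\<bar> \<le> K"
proof -
  have "compact (beam2 ` {0..1})" by (intro compact_continuous_image beam_continuous) auto
  then obtain K0 where K0: "\<And>t. t \<in> {0..1} \<Longrightarrow> \<bar>beam2 t\<bar> \<le> K0"
    by (metis bounded_iff compact_imp_bounded imageI real_norm_def)
  define K where "K = max 1 K0"
  have K: "K \<ge> 1" and b2: "\<bar>beam2 t\<bar> \<le> K" if "t \<in> {0..1}" for t
    using K0[OF that] by (auto simp: K_def)
  have K1: "K \<ge> 1" by (simp add: K_def)
  have lip: "\<bar>f b - f a\<bar> \<le> C * (b - a)"
    if "a \<le> b" "\<And>x. (f has_real_derivative f' x) (at x)" "\<And>x. a < x \<Longrightarrow> x < b \<Longrightarrow> \<bar>f' x\<bar> \<le> C"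
    for f f' :: "real \<Rightarrow> real" and a b C
  proof (cases "a = b")
    case False
    then have "a < b" using that(1) by simp
    from MVT2[OF this that(2)] obtain z where z: "a < z" "z < b" "f b - f a = (b - a) * f' z"
      by blast
    then have "\<bar>f b - f a\<bar> = (b - a) * \<bar>f' z\<bar>" using that(1) by (simp add: abs_mult)
    also have "\<dots> \<le> (b - a) * C" using that z by (intro mult_left_mono) auto
    finally show ?thesis by (simp add: mult.commute)
  qed simp
  have b1: "\<bar>beam1 t\<bar> \<le> K * t" "\<bar>beam1 t\<bar> \<le> K * (1 - t)" if t: "t \<in> {0..1}" for t
  proof -
    have "\<bar>beam1 t - beam1 0\<bar> \<le> K * (t - 0)"
      by (rule lip[OF _ beam_derivs(2)]) (use t b2 in auto)
    then show "\<bar>beam1 t\<bar> \<le> K * t" by (simp add: beam_boundary)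
    have "\<bar>beam1 1 - beam1 t\<bar> \<le> K * (1 - t)"
      by (rule lip[OF _ beam_derivs(2)]) (use t b2 in auto)
    then show "\<bar>beam1 t\<bar> \<le> K * (1 - t)" by (simp add: beam_boundary)
  qed
  have b0: "\<bar>beam t\<bar> \<le> K * t\<^sup>2" "\<bar>beam t\<bar> \<le> K * (1 - t)\<^sup>2" if t: "t \<in> {0..1}" for t
  proof -
    have "\<bar>beam t - beam 0\<bar> \<le> (K * t) * (t - 0)"
    proof (rule lip[OF _ beam_derivs(1)])
      fix x assume x: "0 < x" "x < t"
      have "\<bar>beam1 x\<bar> \<le> K * x" using b1(1)[of x] x t by simp
      also have "\<dots> \<le> K * t" using x K1 by (intro mult_left_mono) auto
      finally show "\<bar>beam1 x\<bar> \<le> K * t" .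
    qed (use t in auto)
    then show "\<bar>beam t\<bar> \<le> K * t\<^sup>2" by (simp add: beam_boundary power2_eq_square mult.assoc)
    have "\<bar>beam 1 - beam t\<bar> \<le> (K * (1 - t)) * (1 - t)"
    proof (rule lip[OF _ beam_derivs(1)])
      fix x assume x: "t < x" "x < 1"
      have "\<bar>beam1 x\<bar> \<le> K * (1 - x)" using b1(2)[of x] x t by simp
      also have "\<dots> \<le> K * (1 - t)" using x K1 by (intro mult_left_mono) auto
      finally show "\<bar>beam1 x\<bar> \<le> K * (1 - t)" .
    qed (use t in auto)
    then show "\<bar>beam t\<bar> \<le> K * (1 - t)\<^sup>2" by (simp add: beam_boundary power2_eq_square mult.assoc)
  qed
  have "\<bar>beam t\<bar> \<le> K * (t * (1 - t))" if t: "t \<in> {0..1}" for t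
  proof (rule power2_le_imp_le)
    have "\<bar>beam t\<bar> * \<bar>beam t\<bar> \<le> (K * t\<^sup>2) * (K * (1 - t)\<^sup>2)"
      using b0[OF t] K1 by (intro mult_mono) auto
    then show "\<bar>beam t\<bar>\<^sup>2 \<le> (K * (t * (1 - t)))\<^sup>2"
      by (simp only: power2_eq_square mult_ac)
    show "0 \<le> K * (t * (1 - t))" using K1 t by auto
  qed
  then show ?thesis using that[of K] K1 b0 b1 b2 by blast
qed

lemma has_integral_indicator_Icc:
  fixes a b :: real
  assumes "0 \<le> a" "a \<le> b" "b \<le> h"
  shows "((\<lambda>t. indicator {a..b} t :: real) has_integral b - a) {0..h}"
proof -
  have "((\<lambda>_. 1) has_integral b - a) {a..b}"
    using has_integral_const_real[of "1::real" a b] assms by simp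
  then have "((\<lambda>t. if t \<in> {a..b} then 1 else 0) has_integral b - a) {0..h}"
    using assms by (subst has_integral_restrict) auto
  then show ?thesis by (simp add: indicator_def of_bool_def)
qed

lemma has_integral_sine_square:
  assumes "h > 0"
  shows "((\<lambda>t. (sin (pi / h * t))\<^sup>2) has_integral h / 2) {0..h}"
proof -
  define w where "w = pi / h"
  have w: "w > 0" "w * h = pi" using assms by (simp_all add: w_def)
  let ?F = "\<lambda>t. t / 2 - sin (2 * (w * t)) / (4 * w)"
  have "((\<lambda>t. (sin (w * t))\<^sup>2) has_integral ?F h - ?F 0) {0..h}"
  proof (rule fundamental_theorem_of_calculus)
    fix t
    have "((\<lambda>t. sin (2 * (w * t))) has_real_derivative cos (2 * (w * t)) * (2 * w)) (at t)"
      by (auto intro!: derivative_eq_intros)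
    then have "(?F has_real_derivative 1 / 2 - cos (2 * (w * t)) * (2 * w) / (4 * w)) (at t)"
      by (intro DERIV_diff DERIV_cdivide DERIV_ident)
    moreover have "1 / 2 - cos (2 * (w * t)) * (2 * w) / (4 * w) = (sin (w * t))\<^sup>2"
      using w(1) by (simp add: cos_double_sin diff_divide_distrib)
    ultimately have "(?F has_real_derivative (sin (w * t))\<^sup>2) (at t)" by simp
    then show "(?F has_vector_derivative (sin (w * t))\<^sup>2) (at t within {0..h})"
      by (simp add: has_real_derivative_iff_has_vector_derivative has_vector_derivative_at_within)
  qed (use assms in simp)
  then show ?thesis unfolding w_def[symmetric] by (simp add: w(2))
qed

section \<open>Estimates for the cut beam and the cut sine\<close>

context smooth_step
begin

lemma abs_step_le_1: "\<bar>s r\<bar> \<le> 1"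
  using sn[of r] sl[of r] by simp

text \<open>The bounds do not depend on N: each factor N from differentiating the cutoff costs 1/t
  or 1/(1 - t), and the zeros of the beam and its slope pay for it.\<close>

lemma cut_beam_bounds:
  assumes K: "K \<ge> 1"
    "\<bar>beam t\<bar> \<le> K * t\<^sup>2" "\<bar>beam t\<bar> \<le> K * (1 - t)\<^sup>2" "\<bar>beam t\<bar> \<le> K * (t * (1 - t))"
    "\<bar>beam1 t\<bar> \<le> K * t" "\<bar>beam1 t\<bar> \<le> K * (1 - t)" "\<bar>beam2 t\<bar> \<le> K"
    and t: "t \<in> {0..1}" and N: "N > 0"
  shows "\<bar>cut N 1 beam t\<bar> \<le> K" "\<bar>cut1 N 1 beam beam1 t\<bar> \<le> 5 * M * K"
    "\<bar>cut2 N 1 beam beam1 beam2 t\<bar> \<le> 25 * M\<^sup>2 * K"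
proof -
  define a a1 a2 b b1 b2 where "a = s (N * t)" "a1 = s1 (N * t)" "a2 = s2 (N * t)"
    "b = s (N * (1 - t))" "b1 = s1 (N * (1 - t))" "b2 = s2 (N * (1 - t))"
  note defs = this
  have ab: "\<bar>a\<bar> \<le> 1" "\<bar>b\<bar> \<le> 1" by (simp_all add: defs abs_step_le_1)
  have w: "\<bar>(N * t) * a1\<bar> \<le> 2 * M" "\<bar>(N * (1 - t)) * b1\<bar> \<le> 2 * M"
    "\<bar>(N * t)\<^sup>2 * a2\<bar> \<le> 4 * M" "\<bar>(N * (1 - t))\<^sup>2 * b2\<bar> \<le> 4 * M"
    unfolding defs by (rule step_weighted_bounds)+
  \<comment> \<open>The weight Z extracted from the small profile factor z is handed to the large
    cutoff factor x.\<close>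
  have le: "\<bar>x * y * z\<bar> \<le> X * K" if "\<bar>z\<bar> \<le> K * Z" "\<bar>Z * x\<bar> \<le> X" "\<bar>y\<bar> \<le> 1" "0 \<le> Z" for x y z X Z
  proof -
    have "\<bar>x * y * z\<bar> = (\<bar>x\<bar> * \<bar>z\<bar>) * \<bar>y\<bar>" by (simp add: abs_mult)
    also have "\<dots> \<le> (\<bar>x\<bar> * (K * Z)) * 1"
      using that K(1) by (intro mult_mono mult_left_mono) auto
    also have "\<dots> = \<bar>Z * x\<bar> * K" using that(4) by (simp add: abs_mult)
    also have "\<dots> \<le> X * K" using that K(1) by (intro mult_right_mono) auto
    finally show ?thesis .
  qed
  have u: "\<bar>beam t\<bar> \<le> K * 1"
  proof -
    have "t\<^sup>2 \<le> 1" using t by (intro power_le_one) auto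
    then have "K * t\<^sup>2 \<le> K * 1" using K(1) by (intro mult_left_mono) auto
    then show ?thesis using K(2) by simp
  qed
  have ut: "\<bar>beam t\<bar> \<le> K * t" "\<bar>beam t\<bar> \<le> K * (1 - t)"
  proof -
    have "K * (t * (1 - t)) \<le> K * (t * 1)" "K * (t * (1 - t)) \<le> K * (1 * (1 - t))"
      using K(1) t by (intro mult_left_mono mult_right_mono; simp)+
    then show "\<bar>beam t\<bar> \<le> K * t" "\<bar>beam t\<bar> \<le> K * (1 - t)" using K(4) by auto
  qed
  have u1: "\<bar>beam1 t\<bar> \<le> K * 1"
  proof -
    have "K * t \<le> K * 1" using K(1) t by (intro mult_left_mono) auto
    then show ?thesis using K(5) by simp
  qed
  have z1: "\<bar>1 * a\<bar> \<le> 1" using ab by simp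
  note T = t[unfolded atLeastAtMost_iff]
  have n0: "0 \<le> t" "0 \<le> 1 - t" "0 \<le> t\<^sup>2" "0 \<le> (1 - t)\<^sup>2" "0 \<le> t * (1 - t)" using T by auto
  have p: "\<bar>a * b * beam t\<bar> \<le> 1 * K" by (rule le[OF u z1 ab(2)]) simp
  then show "\<bar>cut N 1 beam t\<bar> \<le> K" by (simp add: cut_def defs)
  have q1: "\<bar>(N * a1) * b * beam t\<bar> \<le> (2 * M) * K"
    by (rule le[OF ut(1) _ ab(2) n0(1)]) (use w(1) in \<open>simp add: mult_ac\<close>)
  have q2: "\<bar>(N * b1) * a * beam t\<bar> \<le> (2 * M) * K"
    by (rule le[OF ut(2) _ ab(1) n0(2)]) (use w(2) in \<open>simp only: mult_ac\<close>)
  have q3: "\<bar>a * b * beam1 t\<bar> \<le> 1 * K" by (rule le[OF u1 z1 ab(2)]) simp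
  have MK: "K \<le> M * K" "M * K \<le> M\<^sup>2 * K"
    using M K(1) by (auto simp: power2_eq_square)
  have "cut1 N 1 beam beam1 t = (N * a1) * b * beam t - (N * b1) * a * beam t + a * b * beam1 t"
    by (simp add: cut1_def defs algebra_simps)
  then show "\<bar>cut1 N 1 beam beam1 t\<bar> \<le> 5 * M * K" using q1 q2 q3 MK by linarith
  have r1: "\<bar>(N\<^sup>2 * a2) * b * beam t\<bar> \<le> (4 * M) * K"
    by (rule le[OF K(2) _ ab(2) n0(3)]) (use w(3) in \<open>simp only: power_mult_distrib mult_ac\<close>)
  have r2: "\<bar>(N\<^sup>2 * b2) * a * beam t\<bar> \<le> (4 * M) * K"
    by (rule le[OF K(3) _ ab(1) n0(4)]) (use w(4) in \<open>simp only: power_mult_distrib mult_ac\<close>)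
  have "\<bar>(N * t) * a1\<bar> * \<bar>(N * (1 - t)) * b1\<bar> \<le> (2 * M) * (2 * M)"
    using w M by (intro mult_mono) auto
  then have "\<bar>(t * (1 - t)) * (N\<^sup>2 * a1 * b1)\<bar> \<le> 4 * M\<^sup>2"
    by (simp only: abs_mult[symmetric] power2_eq_square mult_ac)
  then have r3: "\<bar>(N\<^sup>2 * a1 * b1) * 1 * beam t\<bar> \<le> (4 * M\<^sup>2) * K"
    by (intro le[OF K(4) _ _ n0(5)]) auto
  have r4: "\<bar>(N * a1) * b * beam1 t\<bar> \<le> (2 * M) * K"
    by (rule le[OF K(5) _ ab(2) n0(1)]) (use w(1) in \<open>simp only: mult_ac\<close>)
  have r5: "\<bar>(N * b1) * a * beam1 t\<bar> \<le> (2 * M) * K"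
    by (rule le[OF K(6) _ ab(1) n0(2)]) (use w(2) in \<open>simp only: mult_ac\<close>)
  have r6: "\<bar>a * b * beam2 t\<bar> \<le> 1 * K" by (rule le[of _ 1, OF _ z1 ab(2)]) (use K(7) in auto)
  have "cut2 N 1 beam beam1 beam2 t = (N\<^sup>2 * a2) * b * beam t - 2 * ((N\<^sup>2 * a1 * b1) * 1 * beam t)
      + (N\<^sup>2 * b2) * a * beam t + 2 * ((N * a1) * b * beam1 t) - 2 * ((N * b1) * a * beam1 t)
      + a * b * beam2 t"
    by (simp add: cut2_def defs algebra_simps)
  then have "\<bar>cut2 N 1 beam beam1 beam2 t\<bar> \<le> 16 * (M * K) + 8 * (M\<^sup>2 * K) + K"
    using r1 r2 r3 r4 r5 r6 by linarith
  also have "\<dots> \<le> 25 * (M\<^sup>2 * K)" using MK by linarith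
  finally show "\<bar>cut2 N 1 beam beam1 beam2 t\<bar> \<le> 25 * M\<^sup>2 * K" by simp
qed

lemma eventually_cut_inside:
  assumes "t \<in> {0<..<1}"
  shows "\<forall>\<^sub>F n in sequentially. real (Suc n) * t > 2 \<and> real (Suc n) * (1 - t) > 2"
proof -
  have "\<forall>\<^sub>F n in sequentially. real (Suc n) * e > 2" if "e > 0" for e
  proof -
    obtain N where N: "2 / e < real N" using reals_Archimedean2 by blast
    show ?thesis
    proof (rule eventually_sequentiallyI)
      fix n assume "N \<le> n"
      then have "2 / e < real (Suc n)" using N by linarith
      then show "2 < real (Suc n) * e" using that by (simp add: pos_divide_less_eq)
    qed
  qed
  then show ?thesis using assms by (intro eventually_conj) auto
qed

text \<open>Dominated convergence without a rate is enough, since N is sent to infinity while h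
  stays fixed.\<close>

lemma cut_beam_limits:
  "(\<lambda>n. integral {0..1} (\<lambda>t. (cut (real (Suc n)) 1 beam t)\<^sup>2)) \<longlonglongrightarrow> 1"
  "(\<lambda>n. integral {0..1} (\<lambda>t. (cut1 (real (Suc n)) 1 beam beam1 t)\<^sup>2)) \<longlonglongrightarrow> d_beam * c_beam\<^sup>2"
  "(\<lambda>n. integral {0..1} (\<lambda>t. (cut2 (real (Suc n)) 1 beam beam1 beam2 t)\<^sup>2)) \<longlonglongrightarrow> c_beam ^ 4"
proof -
  obtain K where K: "K \<ge> 1"
    "\<And>t. t \<in> {0..1} \<Longrightarrow> \<bar>beam t\<bar> \<le> K * t\<^sup>2" "\<And>t. t \<in> {0..1} \<Longrightarrow> \<bar>beam t\<bar> \<le> K * (1 - t)\<^sup>2"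
    "\<And>t. t \<in> {0..1} \<Longrightarrow> \<bar>beam t\<bar> \<le> K * (t * (1 - t))"
    "\<And>t. t \<in> {0..1} \<Longrightarrow> \<bar>beam1 t\<bar> \<le> K * t" "\<And>t. t \<in> {0..1} \<Longrightarrow> \<bar>beam1 t\<bar> \<le> K * (1 - t)"
    "\<And>t. t \<in> {0..1} \<Longrightarrow> \<bar>beam2 t\<bar> \<le> K"
    using beam_bounds by blast
  note B = cut_beam_bounds[OF K(1) K(2) K(3) K(4) K(5) K(6) K(7)]
  note c = cut_continuous[OF beam_derivs(1,2) beam_continuous(3)]
  have ev: "\<forall>\<^sub>F n in sequentially. cut (real (Suc n)) 1 beam t = beam t"
    "\<forall>\<^sub>F n in sequentially. cut1 (real (Suc n)) 1 beam beam1 t = beam1 t"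
    "\<forall>\<^sub>F n in sequentially. cut2 (real (Suc n)) 1 beam beam1 beam2 t = beam2 t" if "t \<in> {0<..<1}" for t
    using eventually_cut_inside[OF that] by (eventually_elim, simp add: cut_inside del: of_nat_Suc)+
  have "(\<lambda>n. integral {0..1} (\<lambda>t. (cut (real (Suc n)) 1 beam t)\<^sup>2)) \<longlonglongrightarrow> integral {0..1} (\<lambda>t. (beam t)\<^sup>2)"
    by (rule square_integral_limit[OF c(1) beam_continuous(1) B(1) ev(1)]) auto
  then show "(\<lambda>n. integral {0..1} (\<lambda>t. (cut (real (Suc n)) 1 beam t)\<^sup>2)) \<longlonglongrightarrow> 1"
    unfolding integral_beam_square .
  have "(\<lambda>n. integral {0..1} (\<lambda>t. (cut1 (real (Suc n)) 1 beam beam1 t)\<^sup>2)) \<longlonglongrightarrow> integral {0..1} (\<lambda>t. (beam1 t)\<^sup>2)"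
    by (rule square_integral_limit[OF c(2) beam_continuous(2) B(2) ev(2)]) auto
  then show "(\<lambda>n. integral {0..1} (\<lambda>t. (cut1 (real (Suc n)) 1 beam beam1 t)\<^sup>2)) \<longlonglongrightarrow> d_beam * c_beam\<^sup>2"
    unfolding integral_beam1_square .
  have "(\<lambda>n. integral {0..1} (\<lambda>t. (cut2 (real (Suc n)) 1 beam beam1 beam2 t)\<^sup>2)) \<longlonglongrightarrow> integral {0..1} (\<lambda>t. (beam2 t)\<^sup>2)"
    by (rule square_integral_limit[OF c(3) beam_continuous(3) B(3) ev(3)]) auto
  then show "(\<lambda>n. integral {0..1} (\<lambda>t. (cut2 (real (Suc n)) 1 beam beam1 beam2 t)\<^sup>2)) \<longlonglongrightarrow> c_beam ^ 4"
    unfolding integral_beam2_square .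
qed

text \<open>The two unit intervals on which the cutoff of the sine varies; their total length 2 is
  independent of h.\<close>

definition layers :: "real \<Rightarrow> real \<Rightarrow> real" where
  "layers h t = indicator {1..2} t + indicator {h-2..h-1} t"

lemma layers_integral:
  assumes "h \<ge> 2"
  shows "(layers h has_integral 2) {0..h}"
proof -
  have "((\<lambda>t. indicator {1..2} t + indicator {h-2..h-1} t) has_integral (2 - 1) + ((h-1) - (h-2))) {0..h}"
    by (intro has_integral_add has_integral_indicator_Icc) (use assms in auto)
  then show ?thesis by (simp add: layers_def[abs_def])
qed

text \<open>In the layers |sin(\<omega> t)| is at most \<omega> times the distance to the nearer
  end, hence at most 2 \<omega>. Every term with a derivative of the cutoff is therefore O(\<omega>)
  on a set of length 2.\<close>

lemma cut_sine_estimates: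
  assumes h: "h \<ge> 16"
  defines "\<omega> \<equiv> pi / h"
  defines "g \<equiv> cut 1 h (\<lambda>t. sin (\<omega> * t))"
    and "g1 \<equiv> cut1 1 h (\<lambda>t. sin (\<omega> * t)) (\<lambda>t. cos (\<omega> * t) * \<omega>)"
    and "g2 \<equiv> cut2 1 h (\<lambda>t. sin (\<omega> * t)) (\<lambda>t. cos (\<omega> * t) * \<omega>) (\<lambda>t. - sin (\<omega> * t) * \<omega> * \<omega>)"
  shows "h / 4 \<le> integral {0..h} (\<lambda>t. (g t)\<^sup>2)"
    and "integral {0..h} (\<lambda>t. (g1 t)\<^sup>2) \<le> \<omega>\<^sup>2 * integral {0..h} (\<lambda>t. (g t)\<^sup>2) + 16 * M\<^sup>2 * \<omega>\<^sup>2"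
    and "integral {0..h} (\<lambda>t. (g2 t)\<^sup>2) \<le> 512 * M ^ 4 * \<omega>\<^sup>2 + 2 * \<omega> ^ 4 * h"
proof -
  let ?u = "\<lambda>t. sin (\<omega> * t)" and ?u1 = "\<lambda>t. cos (\<omega> * t) * \<omega>" and ?u2 = "\<lambda>t. - sin (\<omega> * t) * \<omega> * \<omega>"
  have \<omega>: "\<omega> > 0" using h by (simp add: \<omega>_def)
  have \<omega>h: "\<omega> * h = pi" using h by (simp add: \<omega>_def)
  have du: "(?u has_real_derivative ?u1 t) (at t)" "(?u1 has_real_derivative ?u2 t) (at t)" for t
    by (auto intro!: derivative_eq_intros)
  have cu2: "continuous_on UNIV ?u2" by (intro continuous_intros)
  note c = cut_continuous[OF du cu2, of _ 1 h, folded g_def g1_def g2_def]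
  note dg = cut_derivs[OF du, of 1 h, folded g_def g1_def g2_def]
  have sin_abs: "\<bar>sin x\<bar> \<le> \<bar>x\<bar>" for x :: real by (rule abs_sin_x_le_abs_x)
  have u: "\<bar>?u t\<bar> \<le> \<omega> * \<bar>t\<bar>" "\<bar>?u t\<bar> \<le> \<omega> * \<bar>h - t\<bar>" for t
  proof -
    show "\<bar>?u t\<bar> \<le> \<omega> * \<bar>t\<bar>" using sin_abs[of "\<omega> * t"] \<omega> by (simp add: abs_mult)
    have "?u t = sin (\<omega> * (h - t))" by (simp add: right_diff_distrib \<omega>h sin_diff)
    then show "\<bar>?u t\<bar> \<le> \<omega> * \<bar>h - t\<bar>" using sin_abs[of "\<omega> * (h - t)"] \<omega> by (simp add: abs_mult)
  qed
  have sq2: "(x + y)\<^sup>2 \<le> 2 * x\<^sup>2 + 2 * y\<^sup>2" for x y :: real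
    using zero_le_power2[of "x - y"] by (simp add: power2_eq_square algebra_simps)
  have lay: "s1 (1 * t) = 0" "s2 (1 * t) = 0" if "t \<notin> {1..2}" for t
    using that s1z s2z by auto
  have layh: "s1 (1 * (h - t)) = 0" "s2 (1 * (h - t)) = 0" if "t \<notin> {h-2..h-1}" for t
    using that s1z[of "h - t"] s2z[of "h - t"] by auto
  define A1 where "A1 = (\<lambda>t. \<bar>s1 (1 * t) * ?u t\<bar>)"
  define A2 where "A2 = (\<lambda>t. \<bar>s2 (1 * t) * ?u t\<bar>)"
  define B1 where "B1 = (\<lambda>t. \<bar>s1 (1 * (h - t)) * ?u t\<bar>)"
  define B2 where "B2 = (\<lambda>t. \<bar>s2 (1 * (h - t)) * ?u t\<bar>)"
  let ?I1 = "\<lambda>t. indicator {1..2} t :: real" and ?I2 = "\<lambda>t. indicator {h-2..h-1} t :: real"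
  have AB: "A1 t \<le> 2 * M * \<omega> * ?I1 t" "A2 t \<le> 2 * M * \<omega> * ?I1 t"
    "B1 t \<le> 2 * M * \<omega> * ?I2 t" "B2 t \<le> 2 * M * \<omega> * ?I2 t" for t
  proof -
    have *: "\<bar>x\<bar> * \<bar>?u t\<bar> \<le> M * (\<omega> * 2)" if "\<bar>x\<bar> \<le> M" "\<bar>?u t\<bar> \<le> \<omega> * \<bar>r\<bar>" "r \<in> {1..2}" for x r
    proof -
      have "\<omega> * \<bar>r\<bar> \<le> \<omega> * 2" using that \<omega> by (intro mult_left_mono) auto
      then show ?thesis using that M by (intro mult_mono) auto
    qed
    show "A1 t \<le> 2 * M * \<omega> * ?I1 t" "A2 t \<le> 2 * M * \<omega> * ?I1 t"
      using *[OF s1M u(1), of t] *[OF s2M u(1), of t] lay[of t]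
      by (cases "t \<in> {1..2}"; simp add: A1_def A2_def abs_mult mult_ac)+
    show "B1 t \<le> 2 * M * \<omega> * ?I2 t" "B2 t \<le> 2 * M * \<omega> * ?I2 t"
      using *[OF s1M u(2), of "h - t"] *[OF s2M u(2), of "h - t"] layh[of t]
      by (cases "t \<in> {h-2..h-1}"; simp add: B1_def B2_def abs_mult mult_ac)+
  qed
  have I01: "?I1 t \<in> {0, 1}" "?I2 t \<in> {0, 1}" for t by (auto simp: indicator_def)

  have sin2: "((\<lambda>t. (?u t)\<^sup>2) has_integral h / 2) {0..h}"
    unfolding \<omega>_def by (rule has_integral_sine_square) (use h in simp)
  note ind = has_integral_indicator_Icc
  have ig: "((\<lambda>t. (g t)\<^sup>2) has_integral integral {0..h} (\<lambda>t. (g t)\<^sup>2)) {0..h}"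
    "((\<lambda>t. (g1 t)\<^sup>2) has_integral integral {0..h} (\<lambda>t. (g1 t)\<^sup>2)) {0..h}"
    "((\<lambda>t. (g2 t)\<^sup>2) has_integral integral {0..h} (\<lambda>t. (g2 t)\<^sup>2)) {0..h}"
    by (intro integrable_integral integrable_continuous_real continuous_intros c)+
  \<comment> \<open>At most the length 4 of the two end pieces is lost from
    \<open>\<integral>sin\<^sup>2\<close> = h/2, and h/2 - 4 >= h/4 is the condition h >=
    16.\<close>
  have "h / 2 - ((2 - 0) + (h - (h - 2))) \<le> integral {0..h} (\<lambda>t. (g t)\<^sup>2)"
  proof (rule has_integral_le[OF _ ig(1)])
    show "((\<lambda>t. (?u t)\<^sup>2 - (indicator {0..2} t + indicator {h-2..h} t)) has_integral
        h / 2 - ((2 - 0) + (h - (h - 2)))) {0..h}"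
      by (intro has_integral_diff has_integral_add sin2 ind) (use h in auto)
    fix t assume t: "t \<in> {0..h}"
    have "(?u t)\<^sup>2 \<le> 1" by (simp add: abs_square_le_1)
    show "(?u t)\<^sup>2 - (indicator {0..2} t + indicator {h-2..h} t) \<le> (g t)\<^sup>2"
    proof (cases "t \<in> {0..2} \<or> t \<in> {h-2..h}")
      case True
      then have "(1::real) \<le> indicator {0..2} t + indicator {h-2..h} t" by (auto simp: indicator_def)
      then show ?thesis using \<open>(?u t)\<^sup>2 \<le> 1\<close> zero_le_power2[of "g t"] by linarith
    next
      case False
      then have "g t = ?u t" unfolding g_def using t by (intro cut_inside) auto
      then show ?thesis using False by simp
    qed
  qed
  then show "h / 4 \<le> integral {0..h} (\<lambda>t. (g t)\<^sup>2)" using h by simp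

  let ?P = "\<lambda>t. (s1 (1 * t) * s (1 * (h - t)) - s (1 * t) * s1 (1 * (h - t))) * ?u t"
  have absP: "\<bar>?P t\<bar> \<le> A1 t + B1 t" for t
  proof -
    have "\<bar>?P t\<bar> \<le> \<bar>s1 (1 * t) * ?u t * s (1 * (h - t))\<bar> + \<bar>s1 (1 * (h - t)) * ?u t * s (1 * t)\<bar>"
      unfolding left_diff_distrib by (rule order_trans[OF abs_triangle_ineq4]) (simp add: mult_ac)
    also have "\<dots> \<le> A1 t * 1 + B1 t * 1"
      unfolding abs_mult[of _ "s _"] A1_def B1_def using abs_step_le_1
      by (intro add_mono mult_left_mono) auto
    finally show ?thesis by simp
  qed
  have "?P t ^ 2 \<le> 8 * M\<^sup>2 * \<omega>\<^sup>2 * layers h t" for t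
  proof -
    have "\<bar>?P t\<bar>\<^sup>2 \<le> (2 * M * \<omega> * ?I1 t + 2 * M * \<omega> * ?I2 t)\<^sup>2"
      using absP[of t] AB(1,3)[of t] by (intro power_mono) linarith+
    also have "\<dots> \<le> 2 * (2 * M * \<omega> * ?I1 t)\<^sup>2 + 2 * (2 * M * \<omega> * ?I2 t)\<^sup>2" by (rule sq2)
    also have "\<dots> = 8 * M\<^sup>2 * \<omega>\<^sup>2 * layers h t"
      using I01[of t] by (auto simp: layers_def power_mult_distrib)
    finally show ?thesis by simp
  qed
  note P2 = this
  have "integral {0..h} (\<lambda>t. (g1 t)\<^sup>2) \<le> 8 * M\<^sup>2 * \<omega>\<^sup>2 * 2 + (?u h * ?u1 h * (s (1 * h) * s (1 * (h - h)))\<^sup>2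
      - ?u 0 * ?u1 0 * (s (1 * 0) * s (1 * (h - 0)))\<^sup>2) + \<omega>\<^sup>2 * integral {0..h} (\<lambda>t. (g t)\<^sup>2)"
  proof (rule has_integral_le[OF ig(2)])
    let ?X = "\<lambda>t. s (1 * t) * s (1 * (h - t))"
    let ?X1 = "\<lambda>t. s1 (1 * t) * s (1 * (h - t)) - s (1 * t) * s1 (1 * (h - t))"
    \<comment> \<open>With the cutoff X and g = X u, u'' = - \<omega>^2 u turns (g')^2 into (X' u)^2
      + \<omega>^2 g^2 plus the exact derivative of u u' X^2. The last integrates to 0 since X
      vanishes at 0 and h. So the coefficient \<omega>^2 stays sharp and only the layers add an
      error.\<close>
    let ?F = "\<lambda>t. ?u t * ?u1 t * (?X t)\<^sup>2"
    let ?F' = "\<lambda>t. (?u1 t)\<^sup>2 * (?X t)\<^sup>2 - \<omega>\<^sup>2 * (?u t * ?X t)\<^sup>2 + 2 * ?u t * ?u1 t * ?X t * ?X1 t"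
    have "(?F' has_integral ?F h - ?F 0) {0..h}"
    proof (rule fundamental_theorem_of_calculus)
      fix t
      have X: "(?X has_real_derivative ?X1 t) (at t)"
        by (rule derivative_eq_intros DERIV_affine[OF ds] refl | simp)+
      have "(?F has_real_derivative ?F' t) (at t)"
        by (rule derivative_eq_intros X du refl)+ (simp add: algebra_simps power2_eq_square)
      then show "(?F has_vector_derivative ?F' t) (at t within {0..h})"
        by (simp add: has_real_derivative_iff_has_vector_derivative has_vector_derivative_at_within)
    qed (use h in simp)
    then show "((\<lambda>t. 8 * M\<^sup>2 * \<omega>\<^sup>2 * layers h t + ?F' t + \<omega>\<^sup>2 * (g t)\<^sup>2) has_integral
        8 * M\<^sup>2 * \<omega>\<^sup>2 * 2 + (?F h - ?F 0) + \<omega>\<^sup>2 * integral {0..h} (\<lambda>t. (g t)\<^sup>2)) {0..h}"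
      by (intro has_integral_add has_integral_mult_right layers_integral ig) (use h in auto)
    fix t
    have "(g1 t)\<^sup>2 = (?P t)\<^sup>2 + ?F' t + \<omega>\<^sup>2 * (g t)\<^sup>2"
      by (simp add: g1_def g_def cut1_def cut_def power2_eq_square algebra_simps)
    then show "(g1 t)\<^sup>2 \<le> 8 * M\<^sup>2 * \<omega>\<^sup>2 * layers h t + ?F' t + \<omega>\<^sup>2 * (g t)\<^sup>2"
      using P2[of t] by simp
  qed
  then show "integral {0..h} (\<lambda>t. (g1 t)\<^sup>2) \<le> \<omega>\<^sup>2 * integral {0..h} (\<lambda>t. (g t)\<^sup>2) + 16 * M\<^sup>2 * \<omega>\<^sup>2"
    using s0 by simp

  have M2: "M \<le> M\<^sup>2" using M by (simp add: power2_eq_square)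
  have g2_abs: "\<bar>g2 t\<bar> \<le> 8 * M\<^sup>2 * \<omega> * layers h t + \<omega>\<^sup>2" for t
  proof -
    have m1: "\<bar>x * y\<bar> \<le> X" if "\<bar>x\<bar> \<le> X" "\<bar>y\<bar> \<le> 1" for x y X :: real
      using mult_left_mono[OF that(2), of "\<bar>x\<bar>"] that(1) by (simp add: abs_mult)
    have "\<bar>s2 (1 * t) * ?u t * s (1 * (h - t))\<bar> \<le> 2 * M * \<omega> * ?I1 t"
      by (rule m1; use AB(2)[of t] abs_step_le_1 in \<open>simp add: A2_def\<close>)
    moreover have "\<bar>s2 (1 * (h - t)) * ?u t * s (1 * t)\<bar> \<le> 2 * M * \<omega> * ?I2 t"
      by (rule m1; use AB(4)[of t] abs_step_le_1 in \<open>simp add: B2_def\<close>)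
    moreover have "\<bar>s1 (1 * t) * ?u t * s1 (1 * (h - t))\<bar> \<le> (2 * M * \<omega> * ?I1 t) * M"
      using mult_mono[OF AB(1)[of t] s1M[of "1 * (h - t)"]] \<omega> M by (simp add: A1_def abs_mult)
    moreover have "\<bar>s1 (1 * t) * s (1 * (h - t)) * ?u1 t\<bar> \<le> M * \<omega> * ?I1 t"
    proof -
      have "\<bar>s1 (1 * t)\<bar> \<le> M * ?I1 t" using s1M[of t] lay[of t] by (auto simp: indicator_def)
      then have "\<bar>s1 (1 * t) * s (1 * (h - t)) * cos (\<omega> * t)\<bar> \<le> M * ?I1 t"
        by (intro m1 abs_step_le_1) (auto simp: abs_cos_le_one)
      then have "\<bar>s1 (1 * t) * s (1 * (h - t)) * cos (\<omega> * t)\<bar> * \<omega> \<le> M * ?I1 t * \<omega>"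
        using \<omega> by (intro mult_right_mono) auto
      then show ?thesis using \<omega> by (simp add: abs_mult mult_ac)
    qed
    moreover have "\<bar>s1 (1 * (h - t)) * s (1 * t) * ?u1 t\<bar> \<le> M * \<omega> * ?I2 t"
    proof -
      have "\<bar>s1 (1 * (h - t))\<bar> \<le> M * ?I2 t" using s1M[of "h - t"] layh[of t] by (auto simp: indicator_def)
      then have "\<bar>s1 (1 * (h - t)) * s (1 * t) * cos (\<omega> * t)\<bar> \<le> M * ?I2 t"
        by (intro m1 abs_step_le_1) (auto simp: abs_cos_le_one)
      then have "\<bar>s1 (1 * (h - t)) * s (1 * t) * cos (\<omega> * t)\<bar> * \<omega> \<le> M * ?I2 t * \<omega>"
        using \<omega> by (intro mult_right_mono) auto
      then show ?thesis using \<omega> by (simp add: abs_mult mult_ac)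
    qed
    moreover have "\<bar>s (1 * t) * s (1 * (h - t)) * ?u2 t\<bar> \<le> \<omega>\<^sup>2"
    proof -
      have "\<bar>s (1 * t) * s (1 * (h - t)) * sin (\<omega> * t)\<bar> \<le> 1"
        by (intro m1 abs_step_le_1) (auto simp: abs_sin_le_one)
      then have "\<bar>s (1 * t) * s (1 * (h - t)) * sin (\<omega> * t)\<bar> * \<omega>\<^sup>2 \<le> 1 * \<omega>\<^sup>2"
        by (intro mult_right_mono) auto
      then show ?thesis by (simp add: abs_mult power2_eq_square mult_ac)
    qed
    moreover have "g2 t = s2 (1 * t) * ?u t * s (1 * (h - t)) - 2 * (s1 (1 * t) * ?u t * s1 (1 * (h - t)))
        + s2 (1 * (h - t)) * ?u t * s (1 * t) + 2 * (s1 (1 * t) * s (1 * (h - t)) * ?u1 t)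
        - 2 * (s1 (1 * (h - t)) * s (1 * t) * ?u1 t) + s (1 * t) * s (1 * (h - t)) * ?u2 t"
      unfolding g2_def cut2_def by (simp add: algebra_simps)
    ultimately have "\<bar>g2 t\<bar> \<le> 2 * M * \<omega> * ?I1 t + 2 * ((2 * M * \<omega> * ?I1 t) * M) + 2 * M * \<omega> * ?I2 t
        + 2 * (M * \<omega> * ?I1 t) + 2 * (M * \<omega> * ?I2 t) + \<omega>\<^sup>2"
      by linarith
    also have "\<dots> = (4 * M + 4 * M\<^sup>2) * (\<omega> * ?I1 t) + (4 * M) * (\<omega> * ?I2 t) + \<omega>\<^sup>2"
      by (simp add: algebra_simps power2_eq_square)
    also have "\<dots> \<le> (8 * M\<^sup>2) * (\<omega> * ?I1 t) + (8 * M\<^sup>2) * (\<omega> * ?I2 t) + \<omega>\<^sup>2"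
      using M2 M \<omega> by (intro add_mono mult_right_mono order_refl) auto
    finally show ?thesis by (simp add: layers_def algebra_simps)
  qed
  have "integral {0..h} (\<lambda>t. (g2 t)\<^sup>2) \<le> 256 * M ^ 4 * \<omega>\<^sup>2 * 2 + 2 * \<omega> ^ 4 * h"
  proof (rule has_integral_le[OF ig(3)])
    have "((\<lambda>_. 2 * \<omega> ^ 4) has_integral 2 * \<omega> ^ 4 * h) {0..h}"
      using has_integral_const_real[of "2 * \<omega> ^ 4" 0 h] h by (simp add: mult.commute)
    then show "((\<lambda>t. 256 * M ^ 4 * \<omega>\<^sup>2 * layers h t + 2 * \<omega> ^ 4) has_integral
        256 * M ^ 4 * \<omega>\<^sup>2 * 2 + 2 * \<omega> ^ 4 * h) {0..h}"
      by (intro has_integral_add has_integral_mult_right layers_integral) (use h in auto)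
    fix t
    have "(g2 t)\<^sup>2 \<le> (8 * M\<^sup>2 * \<omega> * layers h t + \<omega>\<^sup>2)\<^sup>2"
      using g2_abs[of t] by (metis abs_ge_zero power2_abs power_mono)
    also have "\<dots> \<le> 2 * (8 * M\<^sup>2 * \<omega> * layers h t)\<^sup>2 + 2 * (\<omega>\<^sup>2)\<^sup>2" by (rule sq2)
    also have "(8 * M\<^sup>2 * \<omega> * layers h t)\<^sup>2 = 64 * M ^ 4 * \<omega>\<^sup>2 * (layers h t)\<^sup>2"
      by (simp add: power_mult_distrib flip: power_mult)
    also have "2 * (64 * M ^ 4 * \<omega>\<^sup>2 * (layers h t)\<^sup>2) + 2 * (\<omega>\<^sup>2)\<^sup>2
        \<le> 2 * (64 * M ^ 4 * \<omega>\<^sup>2 * (2 * layers h t)) + 2 * (\<omega>\<^sup>2)\<^sup>2"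
    proof -
      \<comment> \<open>\<open>layers\<close> takes only the values 0, 1 and 2.\<close>
      have "(layers h t)\<^sup>2 \<le> 2 * layers h t" using I01[of t] by (auto simp: layers_def)
      then show ?thesis using M by (intro add_mono mult_left_mono order_refl) auto
    qed
    finally show "(g2 t)\<^sup>2 \<le> 256 * M ^ 4 * \<omega>\<^sup>2 * layers h t + 2 * \<omega> ^ 4"
      by (simp flip: power_mult)
  qed
  then show "integral {0..h} (\<lambda>t. (g2 t)\<^sup>2) \<le> 512 * M ^ 4 * \<omega>\<^sup>2 + 2 * \<omega> ^ 4 * h" by simp
qed

lemma mu1_bounds:
  assumes h: "h \<ge> 16"
  shows "mu1 h \<le> c_beam ^ 4 + 2 * ((pi / h)\<^sup>2 + 64 * M\<^sup>2 * (pi / h)\<^sup>2 / h) * (d_beam * c_beam\<^sup>2)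
      + (2048 * M ^ 4 * (pi / h)\<^sup>2 / h + 8 * (pi / h) ^ 4)"
    and "c_beam ^ 4 + 2 * d_beam * c_beam\<^sup>2 * (pi / h)\<^sup>2 - 4 * c_beam ^ 4 * (pi / h) ^ 4 \<le> mu1 h"
proof -
  define w where "w = pi / h"
  have w: "w > 0" using h by (simp add: w_def)
  let ?u = "\<lambda>t. sin (w * t)" and ?u1 = "\<lambda>t. cos (w * t) * w" and ?u2 = "\<lambda>t. - sin (w * t) * w * w"
  define g where "g = cut 1 h ?u"
  define g1 where "g1 = cut1 1 h ?u ?u1"
  define g2 where "g2 = cut2 1 h ?u ?u1 ?u2"
  define G where "G = (\<lambda>f :: real \<Rightarrow> real. integral {0..h} (\<lambda>t. (f t)\<^sup>2))"
  define V where "V = (\<lambda>f :: real \<Rightarrow> real. integral {0..1} (\<lambda>t. (f t)\<^sup>2))"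
  let ?v = "\<lambda>n. cut (real (Suc n)) 1 beam" and ?v1 = "\<lambda>n. cut1 (real (Suc n)) 1 beam beam1"
    and ?v2 = "\<lambda>n. cut2 (real (Suc n)) 1 beam beam1 beam2"
  have est: "h / 4 \<le> G g" "G g1 \<le> w\<^sup>2 * G g + 16 * M\<^sup>2 * w\<^sup>2"
    "G g2 \<le> 512 * M ^ 4 * w\<^sup>2 + 2 * w ^ 4 * h"
    using cut_sine_estimates[OF h, folded w_def, folded g_def g1_def g2_def] unfolding G_def by simp_all
  have G0: "G g > 0" using est(1) h by simp
  have du: "(?u has_real_derivative ?u1 t) (at t)" "(?u1 has_real_derivative ?u2 t) (at t)" for t
    by (auto intro!: derivative_eq_intros)
  have cu2: "continuous_on UNIV ?u2" by (intro continuous_intros)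
  note dg = cut_derivs[OF du, of 1 h, folded g_def g1_def g2_def]
  note cg = cut_continuous(3)[OF du cu2, of UNIV 1 h, folded g2_def]
  have gk: "C_k1 k g" for k
    using cut_C_k1[OF C_k1_affine[OF C_k1_sin_cos(1)], of k 1 h w 0] by (simp add: g_def)
  have gs: "t \<notin> {1..h - 1} \<Longrightarrow> g t = 0" for t
    using cut_support[of 1 t h ?u] by (simp add: g_def)
  note dv = cut_derivs[OF beam_derivs(1,2)]
  note cv = cut_continuous(3)[OF beam_derivs(1,2) beam_continuous(3)]
  have beam_k: "C_k1 k beam" for k
  proof -
    \<comment> \<open>Written with exponentials so that the closure rules for \<open>C_k1\<close>
      apply.\<close>
    have eq: "beam = (\<lambda>y. (1 / 2) * (exp (c_beam * y + 0) + exp (- c_beam * y + 0)) + (- 1) * cos (c_beam * y + 0)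
        + (- beam_ratio) * ((1 / 2) * (exp (c_beam * y + 0) + (- 1) * exp (- c_beam * y + 0))
          + (- 1) * sin (c_beam * y + 0)))"
      by (rule ext) (simp add: beam_def cosh_field_def sinh_field_def field_simps)
    show ?thesis
      unfolding eq by (intro C_k1_add C_k1_mult C_k1_const C_k1_affine[OF C_k1_exp]
          C_k1_affine[OF C_k1_sin_cos(1)] C_k1_affine[OF C_k1_sin_cos(2)])
  qed
  have vs: "t \<notin> {1 / real (Suc n)..1 - 1 / real (Suc n)} \<Longrightarrow> ?v n t = 0" for n t
    by (rule cut_support) auto
  have lim: "(\<lambda>n. V (?v n)) \<longlonglongrightarrow> 1" "(\<lambda>n. V (?v1 n)) \<longlonglongrightarrow> d_beam * c_beam\<^sup>2"
    "(\<lambda>n. V (?v2 n)) \<longlonglongrightarrow> c_beam ^ 4"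
    unfolding V_def by (rule cut_beam_limits)+
  have V0: "\<forall>\<^sub>F n in sequentially. V (?v n) > 0"
    using order_tendstoD(1)[OF lim(1), of 0] by simp
  have mu: "mu1 h \<le> G g2 / G g + 2 * (G g1 / G g) * (V (?v1 n) / V (?v n)) + V (?v2 n) / V (?v n)"
    "L \<ge> 0 \<Longrightarrow> (\<And>\<phi>. \<phi> \<in> test_fun h \<Longrightarrow>
      L * (norm2 h \<phi>)\<^sup>2 \<le> (norm2 h (\<lambda>p. pdx (pdx \<phi>) p + pdy (pdy \<phi>) p))\<^sup>2) \<Longrightarrow> L \<le> mu1 h"
    if "V (?v n) > 0" for n L
    using mu1_le_tensor[OF _ dg cg gk gs _ _ dv cv cut_C_k1[OF beam_k] vs _ _ G0[unfolded G_def] that[unfolded V_def]] h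
    unfolding G_def V_def by simp_all
  \<comment> \<open>The cutoff of the beam disappears here: h and the cut sine stay fixed while n
    tends to infinity.\<close>
  have "(\<lambda>n. G g2 / G g + 2 * (G g1 / G g) * (V (?v1 n) / V (?v n)) + V (?v2 n) / V (?v n)) \<longlonglongrightarrow>
      G g2 / G g + 2 * (G g1 / G g) * (d_beam * c_beam\<^sup>2 / 1) + c_beam ^ 4 / 1"
    by (intro tendsto_intros lim) auto
  then have "mu1 h \<le> G g2 / G g + 2 * (G g1 / G g) * (d_beam * c_beam\<^sup>2 / 1) + c_beam ^ 4 / 1"
    by (rule tendsto_lowerbound) (use V0 mu(1) in \<open>auto elim!: eventually_mono\<close>)
  also have "\<dots> = G g2 / G g + 2 * (G g1 / G g) * (d_beam * c_beam\<^sup>2) + c_beam ^ 4" by simp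
  also have "\<dots> \<le> (2048 * M ^ 4 * w\<^sup>2 / h + 8 * w ^ 4)
      + 2 * (w\<^sup>2 + 64 * M\<^sup>2 * w\<^sup>2 / h) * (d_beam * c_beam\<^sup>2) + c_beam ^ 4"
  proof -
    \<comment> \<open>Dividing by a norm of order h turns layer contributions of order h^-2 into
      order h^-3.\<close>
    have inv: "x / G g \<le> x / (h / 4)" if "x \<ge> 0" for x
      using that est(1) h G0 by (intro divide_left_mono) auto
    have "G g1 / G g \<le> (w\<^sup>2 * G g + 16 * M\<^sup>2 * w\<^sup>2) / G g"
      using est(2) G0 by (intro divide_right_mono) auto
    also have "\<dots> = w\<^sup>2 + (16 * M\<^sup>2 * w\<^sup>2) / G g" using G0 by (simp add: field_simps)
    also have "\<dots> \<le> w\<^sup>2 + (16 * M\<^sup>2 * w\<^sup>2) / (h / 4)" by (intro add_left_mono inv) auto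
    also have "\<dots> = w\<^sup>2 + 64 * M\<^sup>2 * w\<^sup>2 / h" by simp
    finally have 1: "G g1 / G g \<le> w\<^sup>2 + 64 * M\<^sup>2 * w\<^sup>2 / h" .
    have "G g2 / G g \<le> (512 * M ^ 4 * w\<^sup>2 + 2 * w ^ 4 * h) / G g"
      using est(3) G0 by (intro divide_right_mono) auto
    also have "\<dots> \<le> (512 * M ^ 4 * w\<^sup>2 + 2 * w ^ 4 * h) / (h / 4)"
      using w h M by (intro inv add_nonneg_nonneg mult_nonneg_nonneg) auto
    also have "\<dots> = 2048 * M ^ 4 * w\<^sup>2 / h + 8 * w ^ 4" using h by (simp add: field_simps)
    finally have 2: "G g2 / G g \<le> 2048 * M ^ 4 * w\<^sup>2 / h + 8 * w ^ 4" .
    have "d_beam * c_beam\<^sup>2 \<ge> 0" using d_beam_approx[unfolded abs_less_iff] by simp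
    then show ?thesis using 1 2 by (intro add_mono mult_mono mult_left_mono mult_right_mono order_refl) auto
  qed
  finally show "mu1 h \<le> c_beam ^ 4 + 2 * ((pi / h)\<^sup>2 + 64 * M\<^sup>2 * (pi / h)\<^sup>2 / h) * (d_beam * c_beam\<^sup>2)
      + (2048 * M ^ 4 * (pi / h)\<^sup>2 / h + 8 * (pi / h) ^ 4)"
    unfolding w_def by (simp add: algebra_simps)
  obtain n where n: "V (?v n) > 0" using eventually_happens[OF V0] by auto
  show "c_beam ^ 4 + 2 * d_beam * c_beam\<^sup>2 * (pi / h)\<^sup>2 - 4 * c_beam ^ 4 * (pi / h) ^ 4 \<le> mu1 h"
  proof (rule mu(2)[OF n])
    \<comment> \<open>The transfer to \<open>mu1\<close> goes through \<open>ennreal\<close> and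
      asks for a nonnegative constant; pi/h <= 1/4 makes the negative term at most c^4.\<close>
    have "pi / h \<le> 4 / 16" using h pi_less_4 by (intro frac_le) auto
    then have "(pi / h) ^ 4 \<le> (1 / 4) ^ 4" using h by (intro power_mono) auto
    also have "(1 / 4 :: real) ^ 4 = 1 / 256" by (simp add: power_divide)
    finally have "4 * (pi / h) ^ 4 \<le> 1" by linarith
    then have "c_beam ^ 4 * (4 * (pi / h) ^ 4) \<le> c_beam ^ 4 * 1"
      by (rule mult_left_mono) simp
    moreover have "0 \<le> 2 * d_beam * c_beam\<^sup>2 * (pi / h)\<^sup>2"
      using d_beam_approx[unfolded abs_less_iff] by simp
    ultimately show "0 \<le> c_beam ^ 4 + 2 * d_beam * c_beam\<^sup>2 * (pi / h)\<^sup>2 - 4 * c_beam ^ 4 * (pi / h) ^ 4"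
      by (simp add: mult_ac)
    show "(c_beam ^ 4 + 2 * d_beam * c_beam\<^sup>2 * (pi / h)\<^sup>2 - 4 * c_beam ^ 4 * (pi / h) ^ 4) * (norm2 h \<phi>)\<^sup>2
        \<le> (norm2 h (\<lambda>p. pdx (pdx \<phi>) p + pdy (pdy \<phi>) p))\<^sup>2" if "\<phi> \<in> test_fun h" for \<phi>
      unfolding norm2_square using test_fun_lower_bound[OF that] h pi_less_4 by simp
  qed
qed

end

section \<open>Asymptotics of the first eigenvalue\<close>

lemma mu1_asymptotics:
  "(\<lambda>h. mu1 h - (c_beam ^ 4 + 2 * d_beam * c_beam\<^sup>2 * pi\<^sup>2 * h powi (-2))) \<in> O[at_top](\<lambda>h. h powi (-3))"
proof -
  obtain s s1 s2 M where st: "smooth_step s s1 s2 M"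
    using smooth_step_exists by blast
  have M: "M \<ge> 1" by (rule smooth_step.M[OF st])
  define C where "C = 128 * M\<^sup>2 * pi\<^sup>2 * (d_beam * c_beam\<^sup>2) + 2048 * M ^ 4 * pi\<^sup>2 + 8 * pi ^ 4 + 4 * c_beam ^ 4 * pi ^ 4"
  have dc: "0 \<le> d_beam * c_beam\<^sup>2" using d_beam_approx[unfolded abs_less_iff] by simp
  show ?thesis
  proof (rule bigoI[of _ C], rule eventually_mono[OF eventually_ge_at_top[of 16]])
    fix h :: real assume h: "16 \<le> h"
    have p: "h powi (-2) = 1 / h\<^sup>2" "h powi (-3) = 1 / h ^ 3"
      by (simp_all add: power_int_minus divide_inverse)
    have h43: "1 / h ^ 4 \<le> 1 / h ^ 3" using h by (intro divide_left_mono power_increasing) auto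
    note b = smooth_step.mu1_bounds[OF st h]
    define E where "E = mu1 h - (c_beam ^ 4 + 2 * d_beam * c_beam\<^sup>2 * pi\<^sup>2 * h powi (-2))"
    have 1: "E \<le> (128 * M\<^sup>2 * pi\<^sup>2 * (d_beam * c_beam\<^sup>2) + 2048 * M ^ 4 * pi\<^sup>2) * (1 / h ^ 3) + 8 * pi ^ 4 * (1 / h ^ 4)"
    proof -
      have h0: "h \<noteq> 0" using h by simp
      have "c_beam ^ 4 + 2 * ((pi / h)\<^sup>2 + 64 * M\<^sup>2 * (pi / h)\<^sup>2 / h) * (d_beam * c_beam\<^sup>2)
          + (2048 * M ^ 4 * (pi / h)\<^sup>2 / h + 8 * (pi / h) ^ 4)
          = c_beam ^ 4 + 2 * d_beam * c_beam\<^sup>2 * pi\<^sup>2 * (1 / h\<^sup>2)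
          + ((128 * M\<^sup>2 * pi\<^sup>2 * (d_beam * c_beam\<^sup>2) + 2048 * M ^ 4 * pi\<^sup>2) * (1 / h ^ 3) + 8 * pi ^ 4 * (1 / h ^ 4))"
        using h0 by (simp add: field_simps power2_eq_square power3_eq_cube power4_eq_xxxx)
      then show ?thesis using b(1) unfolding E_def p by linarith
    qed
    have 2: "- E \<le> 4 * c_beam ^ 4 * pi ^ 4 * (1 / h ^ 4)"
      using b(2) unfolding E_def p power_divide by simp
    have 3: "8 * pi ^ 4 * (1 / h ^ 4) \<le> 8 * pi ^ 4 * (1 / h ^ 3)"
      "4 * c_beam ^ 4 * pi ^ 4 * (1 / h ^ 4) \<le> 4 * c_beam ^ 4 * pi ^ 4 * (1 / h ^ 3)"
      by (intro mult_left_mono h43; simp)+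
    have 4: "0 \<le> (128 * M\<^sup>2 * pi\<^sup>2 * (d_beam * c_beam\<^sup>2) + 2048 * M ^ 4 * pi\<^sup>2) * (1 / h ^ 3)"
      "0 \<le> 8 * pi ^ 4 * (1 / h ^ 3)" "0 \<le> 4 * c_beam ^ 4 * pi ^ 4 * (1 / h ^ 3)"
      using dc M h by simp_all
    have "C * (1 / h ^ 3) = (128 * M\<^sup>2 * pi\<^sup>2 * (d_beam * c_beam\<^sup>2) + 2048 * M ^ 4 * pi\<^sup>2) * (1 / h ^ 3)
        + 8 * pi ^ 4 * (1 / h ^ 3) + 4 * c_beam ^ 4 * pi ^ 4 * (1 / h ^ 3)"
      unfolding C_def by (simp only: distrib_right)
    then have "\<bar>E\<bar> \<le> C * (1 / h ^ 3)" using 1 2 3 4 by (intro abs_leI) linarith+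
    then show "norm (mu1 h - (c_beam ^ 4 + 2 * d_beam * c_beam\<^sup>2 * pi\<^sup>2 * h powi (-2))) \<le> C * norm (h powi (-3))"
      using h unfolding E_def[symmetric] unfolding p by simp
  qed
qed

theorem theorem12:
  shows "0 < c_beam \<and> cosh c_beam * cos c_beam = 1 \<and>
      (\<forall>x. 0 < x \<and> x < c_beam \<longrightarrow> cosh x * cos x \<noteq> 1) \<and>
      \<bar>c_beam - 4.73004\<bar> < 0.000005 \<and> \<bar>d_beam - 0.54988\<bar> < 0.000005 \<and>
      (\<lambda>h. mu1 h - (c_beam ^ 4 + 2 * d_beam * c_beam\<^sup>2 * pi\<^sup>2 * h powi (-2)))
        \<in> O[at_top](\<lambda>h. h powi (-3))"
proof (intro conjI allI impI)
  show "\<bar>c_beam - 4.73004\<bar> < 0.000005"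
    using c_beam_props(5,6) unfolding abs_less_iff by simp
  show "cosh x * cos x \<noteq> 1" if "0 < x \<and> x < c_beam" for x
    using c_beam_props(4) that by blast
qed (fact c_beam_pos c_beam_props(3) d_beam_approx mu1_asymptotics)+

end
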